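(* Let $n\ge1$, let $z_1,\dots,z_n$ be the linear coordinates on the $n$ factors of $\widetilde E^{\,n}=\mathbb{C}^n$ in $\widetilde E^{\,n}\times\mathrm{Conf}_n(E)$, and let $q=e^{2\pi i\tau}$. Let $F_n(z_1,\dots,z_n;q)$ be the $n$-point generating function of disconnected stationary descendent Gromov–Witten invariants of an elliptic curve, and $$T_n(z_1,\dots,z_n;q)=\theta\Big(\sum_{i=1}^n z_i\Big)\cdot (q)_\infty\, F_n(z_1,\dots,z_n;q),\qquad (q)_\infty=\prod_{k\ge1}(1-q^k).$$ Then $$T_n(z_1,\dots,z_n;q)=\langle\gamma_n^{\mathrm{GW}},\varphi_n^{\mathrm{GW}}\rangle .$$
   Context: Fix $\tau$ with $\mathrm{Im}\,\tau>0$, $q=e^{2\pi i\tau}$, $\Lambda_\tau=2\pi i\mathbb{Z}\oplus 2\pi i\tau\mathbb{Z}$, $E=\mathbb{C}/\Lambda_\tau$, $\widetilde E=\mathbb{C}$ its universal cover. Let $$\theta(z)=\frac{\sum_{m\in\mathbb{Z}}(-1)^m q^{\frac12(m+\frac12)^2}e^{(m+\frac12)z}}{\sum_{m\in\mathbb{Z}}(-1)^m (m+\frac12)q^{\frac12(m+\frac12)^2}}$$ be the odd Jacobi theta function normalized by $\theta'(0)=1$. GW generating function. Let $\mathcal{E}$ be an elliptic curve with Kähler (point) class $\omega$, and let $\langle\langle\prod_{i=1}^n\omega\psi_i^{\ell_i}\rangle\rangle^{\bullet\mathcal{E}}_{g,n,d}$ be the disconnected stationary descendent GW invariant of genus $g$,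 degree $d$ with $n$ marked points, where $2g-2+n=\sum_i(\ell_i+1)$ and $\psi_i$ is the cotangent line class at the $i$-th marking. Put $\langle\langle\prod_i\omega\psi_i^{\ell_i}\rangle\rangle^{\bullet\mathcal{E}}_{g,n}=\sum_{d\ge0}\langle\langle\prod_i\omega\psi_i^{\ell_i}\rangle\rangle^{\bullet\mathcal{E}}_{g,n,d}\,q^d$, with the unstable convention $\langle\langle\omega\psi^{-2}\rangle\rangle^{\bullet\mathcal{E}}_{0,1}:=1$, and $$F_n(z_1,\dots,z_n;q)=\sum_{\ell_1,\dots,\ell_n\ge-2}\langle\langle\textstyle\prod_{i=1}^n\omega\psi_i^{\ell_i}\rangle\rangle^{\bullet\mathcal{E}}_{g,n}\ \prod_{i=1}^n z_i^{\ell_i+1}.$$ By the GW/Hurwitz correspondence of Okounkov–Pandharipande (which may be taken as the definition of $F_n$), $F_n$ is the $q$-trace over the charge-zero semi-infinite wedge: $$F_n(z_1,\dots,z_n;q)=\sum_{\lambda}q^{|\lambda|}\prod_{i=1}^n\Big(\sum_{k\ge1}e^{z_i(\lambda_k-k+\frac12)}\Big),$$ the sum being over all integer partitions $\lambda=(\lambda_1\ge\lambda_2\ge\cdots)$ (understood where convergent and extended meromorphically in $z$). The pairing. Write $u_k=e^{z_k}$, $v_k=e^{w_k}$, where $w_1,\dots,w_n$ are linear coordinates on the $n$ points of $\mathrm{Conf}_n(E)$. Consider $$C_{2n}=\frac{\theta(c+\sum_k z_k)}{\theta(c)}\cdot\frac{\prod_{i<j}\theta(z_i+w_i-z_j-w_j)\,\theta(w_i-w_j)}{\prod_i\theta(z_i)\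 \prod_{i<j}\theta(z_i+w_i-w_j)\,\theta(w_i-z_j-w_j)}$$ (the free fermion $2n$-point function, a section constructed from the Poincaré bundle with parameter $c\in\mathrm{Pic}^0(E)$), and its residue at $c=0$, $$\varpi=\theta\Big(\sum_k z_k\Big)\cdot\frac{\prod_{i<j}\theta(z_i+w_i-z_j-w_j)\,\theta(w_i-w_j)}{\prod_i\theta(z_i)\ \prod_{i<j}\theta(z_i+w_i-w_j)\,\theta(w_i-z_j-w_j)},$$ which is $\Lambda_\tau$-periodic in each $w_i$. The class $\varphi_n^{\mathrm{GW}}$ is the relative (fiberwise, with $z$ fixed) de Rham cohomology class of the holomorphic $n$-form $\varpi\,dw_1\wedge\cdots\wedge dw_n$ on the complement of its poles. The class $\gamma_n^{\mathrm{GW}}$ is represented, for given $u$, by the image in $E^n$ of a product of counterclockwise circles $\{v\in(\mathbb{C}^* )^n: |v_j|=\text{const}_j\}$ with $1<|u_iv_i/v_j|<|q|^{-1}$ and $1<|v_i/(u_jv_j)|<|q|^{-1}$ for all $i<j$. The pairing is the fiberwise integral $$\langle \gamma_n^{\mathrm{GW}},\varphi_n^{\mathrm{GW}}\rangle=\Big(\frac1{2\pi i}\Big)^n\int_{\gamma_n^{\mathrm{GW}}}\varpi\;\frac{dv_1}{v_1}\cdots\frac{dv_n}{v_n},$$ defined on the nonempty open set of $u$ for which such circles exist and extended by analytic continuation to a meromorphic function of $(z_1,\dots,z_n)$. *)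

theory Defs
  imports "HOL-Complex_Analysis.Complex_Analysis"
begin

section \<open>Holomorphic and meromorphic functions of several variables\<close>

definition holomorphic_vec :: "(complex ^ 'n \<Rightarrow> complex) \<Rightarrow> (complex ^ 'n) set \<Rightarrow> bool" where
  "holomorphic_vec f U \<longleftrightarrow>
     (\<forall>z\<in>U. \<exists>f'. (f has_derivative f') (at z) \<and> (\<forall>c v. f' (c *s v) = c * f' v))"

text \<open>
  A meromorphic function on $\mathbb{C}^n$ is locally a quotient \<open>g / h\<close> of holomorphic
  functions with \<open>h\<close> not identically zero on any open set.  It is represented by a total
  function, whose values are prescribed only where some local denominator does not vanish;
  two representatives are the same meromorphic function iff they agree on a dense open set.
\<close>

definition meromorphic_vec :: "(complex ^ 'n \<Rightarrow> complex) \<Rightarrow> bool" where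
  "meromorphic_vec f \<longleftrightarrow>
     (\<forall>p. \<exists>U g h. open U \<and> p \<in> U \<and> holomorphic_vec g U \<and> holomorphic_vec h U \<and>
        interior {z \<in> U. h z = 0} = {} \<and> (\<forall>z\<in>U. h z \<noteq> 0 \<longrightarrow> f z = g z / h z))"

definition meromorphic_eq ::
    "(complex ^ 'n \<Rightarrow> complex) \<Rightarrow> (complex ^ 'n \<Rightarrow> complex) \<Rightarrow> bool" where
  "meromorphic_eq f g \<longleftrightarrow> closure (interior {z. f z = g z}) = UNIV"


section \<open>The theta function\<close>

definition nome :: "complex \<Rightarrow> complex" where
  "nome \<tau> = exp (2 * pi * \<i> * \<tau>)"

text \<open>The power $q^{(m+1/2)^2/2}$ is read as $e^{\pi i \tau (m+1/2)^2}$.\<close>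

definition theta :: "complex \<Rightarrow> complex \<Rightarrow> complex" where
  "theta \<tau> z =
     (\<Sum>\<^sub>\<infinity>m::int. (- 1) powi m * exp (pi * \<i> * \<tau> * (of_int m + 1/2)\<^sup>2) * exp ((of_int m + 1/2) * z)) /
     (\<Sum>\<^sub>\<infinity>m::int. (- 1) powi m * (of_int m + 1/2) * exp (pi * \<i> * \<tau> * (of_int m + 1/2)\<^sup>2))"

definition euler_prod :: "complex \<Rightarrow> complex" where
  "euler_prod q = (\<Prod>k. 1 - q ^ Suc k)"


section \<open>The Gromov--Witten generating function\<close>

text \<open>
  Integer partitions are weakly decreasing, finitely supported sequences indexed from 0,
  so that the part $\lambda_k$ of the usual notation is \<open>lam (k - 1)\<close>, and
  $\lambda_k - k + \frac12$ becomes \<open>lam k - k - 1/2\<close>.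
\<close>

definition int_partitions :: "(nat \<Rightarrow> nat) set" where
  "int_partitions = {lam. antimono lam \<and> finite {k. lam k \<noteq> 0}}"

definition partition_size :: "(nat \<Rightarrow> nat) \<Rightarrow> nat" where
  "partition_size lam = (\<Sum>k | lam k \<noteq> 0. lam k)"

definition partition_exp :: "complex \<Rightarrow> (nat \<Rightarrow> nat) \<Rightarrow> nat \<Rightarrow> complex" where
  "partition_exp x lam k = exp (x * (of_nat (lam k) - of_nat k - 1/2))"

definition trace_term :: "complex \<Rightarrow> complex ^ 'n \<Rightarrow> (nat \<Rightarrow> nat) \<Rightarrow> complex" where
  "trace_term \<tau> z lam =
     nome \<tau> ^ partition_size lam * (\<Prod>i\<in>UNIV. \<Sum>\<^sub>\<infinity>k. partition_exp (z $ i) lam k)"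

definition trace_convergent :: "complex \<Rightarrow> complex ^ 'n \<Rightarrow> bool" where
  "trace_convergent \<tau> z \<longleftrightarrow>
     (\<forall>lam\<in>int_partitions. \<forall>i. partition_exp (z $ i) lam summable_on UNIV) \<and>
     trace_term \<tau> z summable_on int_partitions"

text \<open>
  The generating function $F_n$ is given by its expression as a $q$-trace (the GW/Hurwitz
  correspondence), extended meromorphically from the domain of convergence.
\<close>

definition is_GW_function :: "complex \<Rightarrow> (complex ^ 'n \<Rightarrow> complex) \<Rightarrow> bool" where
  "is_GW_function \<tau> F \<longleftrightarrow> meromorphic_vec F \<and>
     (\<forall>z. trace_convergent \<tau> z \<longrightarrow> F z = (\<Sum>\<^sub>\<infinity>lam\<in>int_partitions. trace_term \<tau> z lam))"

definition T_function ::
    "complex \<Rightarrow> (complex ^ 'n \<Rightarrow> complex) \<Rightarrow> complex ^ 'n \<Rightarrow> complex" where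
  "T_function \<tau> F z = theta \<tau> (\<Sum>i\<in>UNIV. z $ i) * euler_prod (nome \<tau>) * F z"


section \<open>The pairing\<close>

definition varpi ::
    "complex \<Rightarrow> complex ^ 'n::{finite,linorder} \<Rightarrow> complex ^ 'n::{finite,linorder} \<Rightarrow> complex" where
  "varpi \<tau> z w =
     theta \<tau> (\<Sum>k\<in>UNIV. z $ k) *
     ((\<Prod>(i,j)\<in>{(i,j). i < j}.
         theta \<tau> (z $ i + w $ i - z $ j - w $ j) * theta \<tau> (w $ i - w $ j)) /
      ((\<Prod>i\<in>UNIV. theta \<tau> (z $ i)) *
       (\<Prod>(i,j)\<in>{(i,j). i < j}.
         theta \<tau> (z $ i + w $ i - w $ j) * theta \<tau> (w $ i - z $ j - w $ j))))"

text \<open>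
  The cycle is the image of the torus $|v_j| = \rho_j$; as $|v_j|$ is constant, the
  conditions on $|u_i v_i / v_j|$ and $|v_i / (u_j v_j)|$ only involve the radii.
\<close>

definition admissible_radii ::
    "complex \<Rightarrow> complex ^ 'n::{finite,linorder} \<Rightarrow> real ^ 'n::{finite,linorder} \<Rightarrow> bool" where
  "admissible_radii \<tau> z \<rho> \<longleftrightarrow>
     (\<forall>j. 0 < \<rho> $ j) \<and>
     (\<forall>i j. i < j \<longrightarrow>
        1 < norm (exp (z $ i)) * \<rho> $ i / \<rho> $ j \<and>
        norm (exp (z $ i)) * \<rho> $ i / \<rho> $ j < inverse (norm (nome \<tau>)) \<and>
        1 < \<rho> $ i / (norm (exp (z $ j)) * \<rho> $ j) \<and>
        \<rho> $ i / (norm (exp (z $ j)) * \<rho> $ j) < inverse (norm (nome \<tau>)))"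

text \<open>
  The circle \<open>v\<^sub>j = circlepath 0 \<rho>\<^sub>j t\<^sub>j\<close> is lifted along \<open>v = exp w\<close> to
  \<open>w\<^sub>j = ln \<rho>\<^sub>j + 2 \<pi> \<i> t\<^sub>j\<close>.
\<close>

definition torus_lift :: "real ^ 'n \<Rightarrow> real ^ 'n \<Rightarrow> complex ^ 'n" where
  "torus_lift \<rho> t = (\<chi> j. of_real (ln (\<rho> $ j)) + 2 * pi * \<i> * of_real (t $ j))"

definition torus_integral ::
    "complex \<Rightarrow> complex ^ 'n::{finite,linorder} \<Rightarrow> real ^ 'n::{finite,linorder} \<Rightarrow> complex" where
  "torus_integral \<tau> z \<rho> = (1 / (2 * pi * \<i>)) ^ CARD('n::{finite,linorder}) *
     integral (cbox 0 1) (\<lambda>t. varpi \<tau> z (torus_lift \<rho> t) *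
       (\<Prod>j\<in>UNIV. vector_derivative (circlepath 0 (\<rho> $ j)) (at (t $ j)) /
                  circlepath 0 (\<rho> $ j) (t $ j)))"

text \<open>
  The pairing of \<open>\<gamma>\<close> with \<open>\<phi>\<close> is the meromorphic function continuing the integral over any
  admissible torus.  The form itself has poles along \<open>theta \<tau> (z $ i) = 0\<close>; there the
  integral is meaningless and imposes no condition.
\<close>

definition is_GW_pairing ::
    "complex \<Rightarrow> (complex ^ 'n::{finite,linorder} \<Rightarrow> complex) \<Rightarrow> bool" where
  "is_GW_pairing \<tau> P \<longleftrightarrow> meromorphic_vec P \<and>
     (\<forall>z \<rho>. (\<forall>i. theta \<tau> (z $ i) \<noteq> 0) \<and> admissible_radii \<tau> z \<rho> \<longrightarrow>
        P z = torus_integral \<tau> z \<rho>)"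

end

theory Submission
  imports Defs "HOL-Combinatorics.Orbits"
begin

text \<open>
  Both sides are evaluated at an auxiliary parameter \<open>c\<close> of the free fermion.  Write \<open>p k\<close> for the
  Fermi occupation number of the site \<open>k\<close>, with \<open>c\<close> as chemical potential, and
  \<open>K c x = \<theta>(c + x) / (\<theta> c \<theta> x)\<close> for the Kronecker function.

  The $q$-trace over all charges, not only over charge zero, is a sum over independent sites, so that it
  equals a theta constant times the sum over \<open>m \<in> \<int>\<^sup>n\<close> of \<open>\<Prod>\<^sub>i exp (z\<^sub>i m\<^sub>i) \<cdot> \<Prod>\<^sub>s p s\<close>, where \<open>s\<close> runs over the
  distinct values of \<open>m\<close>.  Changing the charge only multiplies the charge-zero trace by a power of
  \<open>exp (\<Sum>\<^sub>i z\<^sub>i)\<close>, which accounts for the factor \<open>\<theta> (c + \<Sum>\<^sub>i z\<^sub>i) / \<theta> c\<close>.  For \<open>n = 1\<close> this is the Laurent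
  expansion of \<open>K c\<close> with coefficients \<open>p k\<close> on the strip \<open>0 < Re x < 2 \<pi> Im \<tau>\<close>; by reflection the
  coefficients are \<open>p k - 1\<close> on \<open>- 2 \<pi> Im \<tau> < Re x < 0\<close>.

  Frobenius' determinant turns the integrand into the determinant of the matrix
  \<open>K c (z\<^sub>i + w\<^sub>i - w\<^sub>j)\<close>.  On an admissible torus the entries above and below the diagonal lie in the two
  strips, so integrating term by term leaves, for each permutation, the \<open>m\<close> that are constant on its
  cycles.  As \<open>det\<close> of the matrix with entries \<open>p\<close> for \<open>i \<le> j\<close> and \<open>p - 1\<close> for \<open>i > j\<close> is \<open>p\<close>, the two sums
  agree.  The cycle sums are linear combinations of derivatives of \<open>K\<close> in \<open>c\<close>, because \<open>p' = p (1 - p)\<close>; this gives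
  the meromorphic continuation of both sides.
\<close>

text \<open>A generic \<open>c\<close> is forced: at \<open>c = 0\<close> the site 0 has weight -1,
  so the vacuum sum over all charges vanishes while the occupation number of that site has a pole.
  The value \<open>c = 0\<close> is still used twice. The charge-weighted sum there evaluates the
  normalising constant \<open>theta_den\<close>, and the one-point trace there collapses to the
  single site 0. Comparing this with the one-point trace at generic \<open>c\<close> gives the
  expansion of the Kronecker function, and it also shows that theta has no zero in the open strip.
  The obstacle to continuation is that a coordinate z_i of an admissible point need not lie in the
  strip where its own series converges. Only totals over nontrivial cycles are controlled, because
  the logarithms of the radii cancel around a cycle. Hence fixed points are kept as values of the
  Kronecker function, while the series of a longer cycle converges on a strip whose two sides are
  set by the numbers of ascents and descents of the cycle. The domain of the trace and the
  admissible points both satisfy these bounds, so a single formula continues the two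
  functions.\<close>

no_notation fps_nth (infixl "$" 75)


section \<open>Holomorphic and meromorphic functions of several variables\<close>

lemma holomorphic_vec_const: "holomorphic_vec (\<lambda>_. k) U"
  unfolding holomorphic_vec_def by (auto intro!: exI[of _ "\<lambda>_. 0"])

lemma holomorphic_vec_mult:
  assumes "holomorphic_vec f U" "holomorphic_vec g U"
  shows "holomorphic_vec (\<lambda>z. f z * g z) U"
  unfolding holomorphic_vec_def
proof
  fix z assume "z \<in> U"
  with assms obtain f' g' where f: "(f has_derivative f') (at z)" "\<forall>c v. f' (c *s v) = c * f' v"
    and g: "(g has_derivative g') (at z)" "\<forall>c v. g' (c *s v) = c * g' v"
    unfolding holomorphic_vec_def by metis
  show "\<exists>h'. ((\<lambda>z. f z * g z) has_derivative h') (at z) \<and> (\<forall>c v. h' (c *s v) = c * h' v)"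
    using has_derivative_mult[OF f(1) g(1)] f(2) g(2)
    by (intro exI[of _ "\<lambda>h. f z * g' h + f' h * g z"]) (auto simp: algebra_simps)
qed

lemma holomorphic_vec_add:
  assumes "holomorphic_vec f U" "holomorphic_vec g U"
  shows "holomorphic_vec (\<lambda>z. f z + g z) U"
  unfolding holomorphic_vec_def
proof
  fix z assume "z \<in> U"
  with assms obtain f' g' where f: "(f has_derivative f') (at z)" "\<forall>c v. f' (c *s v) = c * f' v"
    and g: "(g has_derivative g') (at z)" "\<forall>c v. g' (c *s v) = c * g' v"
    unfolding holomorphic_vec_def by metis
  show "\<exists>h'. ((\<lambda>z. f z + g z) has_derivative h') (at z) \<and> (\<forall>c v. h' (c *s v) = c * h' v)"
    using has_derivative_add[OF f(1) g(1)] f(2) g(2)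
    by (intro exI[of _ "\<lambda>h. f' h + g' h"]) (auto simp: algebra_simps)
qed

lemma holomorphic_vec_diff:
  assumes "holomorphic_vec f U" "holomorphic_vec g U"
  shows "holomorphic_vec (\<lambda>z. f z - g z) U"
  using holomorphic_vec_add[OF assms(1) holomorphic_vec_mult[OF holomorphic_vec_const[of "-1"] assms(2)]]
  by simp

lemma holomorphic_vec_sum:
  assumes "\<And>i. i \<in> I \<Longrightarrow> holomorphic_vec (f i) U"
  shows "holomorphic_vec (\<lambda>z. \<Sum>i\<in>I. f i z) U"
  using assms
  by (induction I rule: infinite_finite_induct) (auto intro: holomorphic_vec_const holomorphic_vec_add)

lemma holomorphic_vec_prod:
  assumes "\<And>i. i \<in> I \<Longrightarrow> holomorphic_vec (f i) U"
  shows "holomorphic_vec (\<lambda>z. \<Prod>i\<in>I. f i z) U"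
  using assms
  by (induction I rule: infinite_finite_induct) (auto intro: holomorphic_vec_const holomorphic_vec_mult)

lemma holomorphic_vec_subset: "holomorphic_vec f U \<Longrightarrow> V \<subseteq> U \<Longrightarrow> holomorphic_vec f V"
  by (auto simp: holomorphic_vec_def)

lemma holomorphic_vec_comp_sum:
  fixes f :: "complex \<Rightarrow> complex" and S :: "'n::finite set"
  assumes "f holomorphic_on UNIV"
  shows "holomorphic_vec (\<lambda>z. f (c + (\<Sum>i\<in>S. z $ i))) U"
  unfolding holomorphic_vec_def
proof
  fix z :: "complex ^ 'n"
  let ?l = "\<lambda>z :: complex ^ 'n. c + (\<Sum>i\<in>S. z $ i)"
  have 1: "(?l has_derivative (\<lambda>v. \<Sum>i\<in>S. v $ i)) (at z)"
    by (auto intro!: derivative_eq_intros bounded_linear_imp_has_derivative bounded_linear_vec_nth)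
  have "(f has_field_derivative deriv f (?l z)) (at (?l z))"
    using assms holomorphic_derivI by blast
  from has_derivative_compose[OF 1 this[unfolded has_field_derivative_def]]
  show "\<exists>f'. ((\<lambda>z. f (?l z)) has_derivative f') (at z) \<and> (\<forall>c v. f' (c *s v) = c * f' v)"
    by (intro exI[of _ "\<lambda>v. deriv f (?l z) * (\<Sum>i\<in>S. v $ i)"])
      (auto simp: sum_distrib_left[symmetric] mult.commute mult.left_commute)
qed

lemma holomorphic_vec_continuous_on: "holomorphic_vec f U \<Longrightarrow> continuous_on U f"
  unfolding holomorphic_vec_def
  by (intro continuous_at_imp_continuous_on ballI) (metis has_derivative_continuous)

lemma scaleR_conv_vector_scalar_mult: "r *\<^sub>R (v :: complex ^ 'n) = complex_of_real r *s v"
  by (simp add: vec_eq_iff scaleR_conv_of_real[where 'a = complex])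

text \<open>Restriction to complex lines reduces the identity theorem to one variable.\<close>

lemma holomorphic_vec_eq_zero:
  fixes f :: "complex ^ 'n \<Rightarrow> complex"
  assumes U: "open U" "convex U" and f: "holomorphic_vec f U"
    and V: "open V" "V \<subseteq> U" "V \<noteq> {}" "\<And>z. z \<in> V \<Longrightarrow> f z = 0" and z: "z \<in> U"
  shows "f z = 0"
proof -
  from V(3) obtain a where a: "a \<in> V" by blast
  define l where "l = (\<lambda>t::complex. a + t *s (z - a))"
  have "bounded_linear (\<lambda>s::complex. s *s (z - a))"
    by (rule linear_conv_bounded_linear[THEN iffD1], rule linearI)
      (simp_all add: vec_eq_iff algebra_simps scaleR_conv_of_real[where 'a = complex])
  from has_derivative_add[OF has_derivative_const[of a] bounded_linear_imp_has_derivative[OF this]]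
  have dl: "(l has_derivative (\<lambda>s. s *s (z - a))) (at t)" for t
    unfolding l_def by (simp only: add_0_left)
  have cl: "continuous_on UNIV l"
    by (intro continuous_at_imp_continuous_on ballI has_derivative_continuous[OF dl])
  define W where "W = l -` U"
  have W: "open W" unfolding W_def using cl U(1) by (simp add: open_vimage)
  \<comment> \<open>One-variable continuation needs a connected domain; a complex line meets the
    convex set \<open>U\<close> in a convex set.\<close>
  have "convex W"
  proof (rule convexI)
    fix x y :: complex and u v :: real assume *: "x \<in> W" "y \<in> W" "0 \<le> u" "0 \<le> v" "u + v = 1"
    hence v: "v = 1 - u" by simp
    have "l (u *\<^sub>R x + v *\<^sub>R y) = u *\<^sub>R l x + v *\<^sub>R l y"
      by (simp add: l_def scaleR_conv_vector_scalar_mult vec_eq_iff scaleR_conv_of_real[where 'a = complex] v algebra_simps)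
    thus "u *\<^sub>R x + v *\<^sub>R y \<in> W" using * convexD[OF U(2)] by (auto simp: W_def)
  qed
  have hol: "(\<lambda>t. f (l t)) holomorphic_on W"
  proof (subst holomorphic_on_open[OF W], intro ballI)
    fix t assume "t \<in> W"
    then obtain f' where f': "(f has_derivative f') (at (l t))" "\<forall>c v. f' (c *s v) = c * f' v"
      using f unfolding holomorphic_vec_def W_def by auto
    have "((\<lambda>t. f (l t)) has_derivative (\<lambda>s. f' (s *s (z - a)))) (at t)"
      using has_derivative_compose[OF dl f'(1)] .
    moreover have "(\<lambda>s. f' (s *s (z - a))) = (*) (f' (z - a))" using f'(2) by (auto simp del: vector_ssub_ldistrib simp add: fun_eq_iff)
    ultimately show "\<exists>d. ((\<lambda>t. f (l t)) has_field_derivative d) (at t)"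
      unfolding has_field_derivative_def by (intro exI[of _ "f' (z - a)"]) (simp only:)
  qed
  have oV: "open (l -` V)" using cl V(1) by (simp add: open_vimage)
  have "f (l 1) = 0"
  proof (rule analytic_continuation_open[OF oV W _ _ _ hol, of "\<lambda>_. 0"])
    have "l 0 \<in> V" using a by (simp add: l_def)
    hence "0 \<in> l -` V" by (rule vimageI2)
    thus "l -` V \<noteq> {}" by (intro notI) (simp only: empty_iff)
    show "connected W" using \<open>convex W\<close> by (rule convex_connected)
    show "l -` V \<subseteq> W" using V(2) by (auto simp: W_def)
    show "1 \<in> W" using z by (simp add: W_def l_def)
    show "f (l t) = 0" if "t \<in> l -` V" for t using V(4) that by simp
  qed (rule holomorphic_on_const)
  thus ?thesis by (simp add: l_def)
qed

lemma interior_zeros_empty: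
  fixes h :: "complex ^ 'n \<Rightarrow> complex"
  assumes "holomorphic_vec h UNIV" "h z \<noteq> 0"
  shows "interior {z. h z = 0} = {}"
  using holomorphic_vec_eq_zero[of UNIV h "interior {z. h z = 0}" z] assms interior_subset[of "{z. h z = 0}"]
  by auto

section \<open>Meromorphic functions and agreement on dense open sets\<close>

lemma meromorphic_vecI:
  fixes f :: "complex ^ 'n \<Rightarrow> complex"
  assumes "holomorphic_vec g UNIV" "holomorphic_vec h UNIV" "h z \<noteq> 0"
    and "\<And>z. h z \<noteq> 0 \<Longrightarrow> f z = g z / h z"
  shows "meromorphic_vec f"
  unfolding meromorphic_vec_def
  using interior_zeros_empty[OF assms(2,3)] assms(1,2,4)
  by (intro allI exI[of _ UNIV] exI[of _ g] exI[of _ h] conjI ballI impI) (simp_all only: open_UNIV UNIV_I simp_thms)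

lemma meromorphic_vecE:
  assumes "meromorphic_vec f"
  obtains U g h where "open U" "p \<in> U" "holomorphic_vec g U" "holomorphic_vec h U"
    "interior {z \<in> U. h z = 0} = {}" "\<And>z. z \<in> U \<Longrightarrow> h z \<noteq> 0 \<Longrightarrow> f z = g z / h z"
proof -
  have "\<exists>U g h. open U \<and> p \<in> U \<and> holomorphic_vec g U \<and> holomorphic_vec h U \<and>
        interior {z \<in> U. h z = 0} = {} \<and> (\<forall>z\<in>U. h z \<noteq> 0 \<longrightarrow> f z = g z / h z)"
    using assms[unfolded meromorphic_vec_def, THEN spec[of _ p]] .
  thus ?thesis
  proof (elim exE conjE)
    fix U g h
    assume 1: "open U" "p \<in> U" "holomorphic_vec g U" "holomorphic_vec h U" "interior {z \<in> U. h z = 0} = {}"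
      and 2: "\<forall>z\<in>U. h z \<noteq> 0 \<longrightarrow> f z = g z / h z"
    show ?thesis by (rule that[OF 1 2[rule_format]])
  qed
qed

lemma meromorphic_vec_mult_left:
  assumes e: "holomorphic_vec e UNIV" and f: "meromorphic_vec f"
  shows "meromorphic_vec (\<lambda>z. e z * f z)"
  unfolding meromorphic_vec_def
proof
  fix p
  obtain U g h where "open U" "p \<in> U" "holomorphic_vec g U" "holomorphic_vec h U"
    "interior {z \<in> U. h z = 0} = {}" and fz: "\<And>z. z \<in> U \<Longrightarrow> h z \<noteq> 0 \<Longrightarrow> f z = g z / h z"
    by (fact meromorphic_vecE[OF f])
  moreover have "\<forall>z\<in>U. h z \<noteq> 0 \<longrightarrow> e z * f z = e z * g z / h z" by (simp add: fz)
  ultimately show "\<exists>U g h. open U \<and> p \<in> U \<and> holomorphic_vec g U \<and> holomorphic_vec h U \<and>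
        interior {z \<in> U. h z = 0} = {} \<and> (\<forall>z\<in>U. h z \<noteq> 0 \<longrightarrow> e z * f z = g z / h z)"
    using holomorphic_vec_mult[OF holomorphic_vec_subset[OF e subset_UNIV] \<open>holomorphic_vec g U\<close>]
    by (intro exI[of _ U] exI[of _ "\<lambda>z. e z * g z"] exI[of _ h] conjI) simp_all
qed

lemma open_nonzero:
  assumes "open U" "holomorphic_vec h U"
  shows "open {z \<in> U. h z \<noteq> 0}"
proof -
  have "open (U \<inter> h -` (- {0}))"
    by (rule continuous_open_preimage[OF holomorphic_vec_continuous_on[OF assms(2)] assms(1)]) (simp add: open_Compl)
  moreover have "U \<inter> h -` (- {0}) = {z \<in> U. h z \<noteq> 0}" by auto
  ultimately show ?thesis by simp
qed

lemma nonzero_meets_open: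
  assumes "interior {z \<in> U. h z = 0} = {}" "open V" "V \<subseteq> U" "V \<noteq> {}"
  obtains z where "z \<in> V" "h z \<noteq> 0"
proof -
  have "\<not> V \<subseteq> {z \<in> U. h z = 0}"
    using assms interior_maximal by blast
  thus ?thesis using that assms by blast
qed

text \<open>The closure of the interior \<open>W\<close> of the agreement set is shown to be open,
  and a nonempty clopen set is everything. Near a point of that closure both functions are quotients
  on a ball; the cross difference of the fractions vanishes on part of \<open>W\<close>, hence on
  the ball, which gives agreement wherever both denominators are nonzero.\<close>

lemma meromorphic_eqI:
  fixes f g :: "complex ^ 'n \<Rightarrow> complex"
  assumes f: "meromorphic_vec f" and g: "meromorphic_vec g"
    and V: "open V" "V \<noteq> {}" "\<And>z. z \<in> V \<Longrightarrow> f z = g z"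
  shows "meromorphic_eq f g"
proof -
  define W where "W = interior {z. f z = g z}"
  have W: "open W" "W \<noteq> {}" using V interior_maximal[of V "{z. f z = g z}"] by (auto simp: W_def)
  have "p \<in> interior (closure W)" if p: "p \<in> closure W" for p
  proof -
    obtain U1 g1 h1 where 1: "open U1" "p \<in> U1" "holomorphic_vec g1 U1" "holomorphic_vec h1 U1"
      "interior {z \<in> U1. h1 z = 0} = {}" "\<And>z. z \<in> U1 \<Longrightarrow> h1 z \<noteq> 0 \<Longrightarrow> f z = g1 z / h1 z"
      by (fact meromorphic_vecE[OF f])
    obtain U2 g2 h2 where 2: "open U2" "p \<in> U2" "holomorphic_vec g2 U2" "holomorphic_vec h2 U2"
      "interior {z \<in> U2. h2 z = 0} = {}" "\<And>z. z \<in> U2 \<Longrightarrow> h2 z \<noteq> 0 \<Longrightarrow> g z = g2 z / h2 z"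
      by (fact meromorphic_vecE[OF g])
    obtain r where r: "r > 0" "ball p r \<subseteq> U1 \<inter> U2"
      using openE[of "U1 \<inter> U2" p] 1(1,2) 2(1,2) by blast
    define B where "B = ball p r"
    have B: "open B" "convex B" "B \<subseteq> U1" "B \<subseteq> U2" "p \<in> B" using r by (auto simp: B_def)
    define N where "N = {z \<in> B. h1 z \<noteq> 0} \<inter> {z \<in> B. h2 z \<noteq> 0}"
    have hB: "holomorphic_vec g1 B" "holomorphic_vec h1 B" "holomorphic_vec g2 B" "holomorphic_vec h2 B"
      using holomorphic_vec_subset 1(3,4) 2(3,4) B(3,4) by metis+
    have N: "open N" unfolding N_def using B hB by (intro open_Int open_nonzero)
    \<comment> \<open>Neither zero set has interior points, so \<open>Q\<close> meets the nonzero
      set of \<open>h1\<close> in an open set, which in turn meets that of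
      \<open>h2\<close>.\<close>
    have dense: "N \<inter> Q \<noteq> {}" if Q: "open Q" "Q \<subseteq> B" "Q \<noteq> {}" for Q
    proof -
      have "Q \<subseteq> U1" using Q B by blast
      then obtain z where z: "z \<in> Q" "h1 z \<noteq> 0"
        using nonzero_meets_open[OF 1(5) Q(1) _ Q(3)] by blast
      let ?Q = "{z \<in> B. h1 z \<noteq> 0} \<inter> Q"
      have "?Q \<noteq> {}" using z Q by auto
      moreover have "open ?Q" using Q B hB by (intro open_Int open_nonzero)
      moreover have "?Q \<subseteq> U2" using B by auto
      ultimately obtain y where "y \<in> ?Q" "h2 y \<noteq> 0"
        using nonzero_meets_open[OF 2(5), of ?Q] by blast
      thus ?thesis unfolding N_def using Q by blast
    qed
    have "W \<inter> B \<noteq> {}" using p B(5) open_Int_closure_eq_empty[OF B(1), of W] by blast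
    have eq0: "g1 z * h2 z - g2 z * h1 z = 0" if "z \<in> B" for z
    proof (rule holomorphic_vec_eq_zero[OF B(1,2) _ _ _ _ _ that])
      show "holomorphic_vec (\<lambda>z. g1 z * h2 z - g2 z * h1 z) B"
        using hB by (intro holomorphic_vec_diff holomorphic_vec_mult)
      show "open (N \<inter> (W \<inter> B))" using N W B by (intro open_Int)
      show "N \<inter> (W \<inter> B) \<noteq> {}" using \<open>W \<inter> B \<noteq> {}\<close> W B by (intro dense open_Int) auto
      fix z assume z: "z \<in> N \<inter> (W \<inter> B)"
      hence "f z = g z" using interior_subset[of "{z. f z = g z}"] by (auto simp: W_def)
      moreover have "z \<in> U1" "h1 z \<noteq> 0" "z \<in> U2" "h2 z \<noteq> 0" using z B by (auto simp: N_def)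
      ultimately show "g1 z * h2 z - g2 z * h1 z = 0" using 1(6) 2(6) by (auto simp: field_simps)
    qed auto
    have "f z = g z" if "z \<in> N" for z
    proof -
      have nz: "z \<in> U1" "h1 z \<noteq> 0" "z \<in> U2" "h2 z \<noteq> 0" "z \<in> B" using that B by (auto simp: N_def)
      show ?thesis using 1(6)[OF nz(1,2)] 2(6)[OF nz(3,4)] eq0[OF nz(5)] nz(2,4) by (simp add: frac_eq_eq)
    qed
    hence "N \<subseteq> {z. f z = g z}" by blast
    hence "N \<subseteq> W" unfolding W_def using interior_maximal N by metis
    have "B \<subseteq> closure N"
    proof
      fix x assume x: "x \<in> B"
      show "x \<in> closure N"
      proof (rule ccontr)
        assume "x \<notin> closure N"
        hence "N \<inter> (- closure N \<inter> B) \<noteq> {}" using x B by (intro dense) auto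
        thus False using closure_subset by blast
      qed
    qed
    hence "B \<subseteq> closure W" using \<open>N \<subseteq> W\<close> closure_mono by blast
    thus ?thesis using B interior_maximal by blast
  qed
  hence "interior (closure W) = closure W" using interior_subset[of "closure W"] by blast
  hence "open (closure W)" using open_interior[of "closure W"] by simp
  moreover have "closure W \<noteq> {}" using W by simp
  ultimately have "closure W = UNIV" using clopen[of "closure W"] by simp
  thus ?thesis by (simp add: meromorphic_eq_def W_def)
qed


section \<open>Theta series\<close>

text \<open>Weierstrass' theorem for unordered sums: local majorants give uniform convergence along
  the net of finite subsets, and uniform limits of holomorphic functions may be differentiated
  termwise.\<close>

lemma holomorphic_infsum:
  fixes f :: "'k \<Rightarrow> complex \<Rightarrow> complex"
  assumes "open \<Omega>" and hol: "\<And>k. f k holomorphic_on \<Omega>"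
    and loc: "\<And>z. z \<in> \<Omega> \<Longrightarrow> \<exists>d>0. \<exists>M. cball z d \<subseteq> \<Omega> \<and> M summable_on UNIV \<and>
                 (\<forall>k. \<forall>w\<in>cball z d. norm (f k w) \<le> M k)"
  shows "(\<lambda>z. \<Sum>\<^sub>\<infinity>k. f k z) holomorphic_on \<Omega>"
    and "z \<in> \<Omega> \<Longrightarrow> ((\<lambda>k. deriv (f k) z) has_sum deriv (\<lambda>z. \<Sum>\<^sub>\<infinity>k. f k z) z) UNIV"
proof -
  have main: "\<exists>g'. ((\<lambda>z. \<Sum>\<^sub>\<infinity>k. f k z) has_field_derivative g') (at z) \<and> ((\<lambda>k. deriv (f k) z) has_sum g') UNIV"
    if z: "z \<in> \<Omega>" for z
  proof -
    obtain d M where d: "d > 0" "cball z d \<subseteq> \<Omega>" "M summable_on UNIV"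
      "\<And>k w. w \<in> cball z d \<Longrightarrow> norm (f k w) \<le> M k"
      using loc[OF z] by blast
    have ul: "uniform_limit (cball z d) (\<lambda>X w. \<Sum>k\<in>X. f k w) (\<lambda>w. \<Sum>\<^sub>\<infinity>k. f k w) (finite_subsets_at_top UNIV)"
      using d by (intro Weierstrass_m_test_general[where M = M]) auto
    have hd: "(f k has_field_derivative deriv (f k) w) (at w)" if "w \<in> cball z d" for k w
      using hol assms(1) d that by (meson holomorphic_derivI subsetD)
    have cont: "continuous_on (cball z d) (f k)" for k
      using hd by (meson DERIV_isCont continuous_at_imp_continuous_on)
    have ev: "\<forall>\<^sub>F X in finite_subsets_at_top UNIV. continuous_on (cball z d) (\<lambda>w. \<Sum>k\<in>X. f k w) \<and>
       (\<forall>w\<in>ball z d. ((\<lambda>w. \<Sum>k\<in>X. f k w) has_field_derivative (\<Sum>k\<in>X. deriv (f k) w)) (at w))"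
      using cont hd by (intro always_eventually allI conjI ballI continuous_on_sum DERIV_sum) auto
    obtain g' where "\<And>w. w \<in> ball z d \<Longrightarrow> ((\<lambda>w. \<Sum>\<^sub>\<infinity>k. f k w) has_field_derivative g' w) (at w) \<and>
        ((\<lambda>X. \<Sum>k\<in>X. deriv (f k) w) \<longlongrightarrow> g' w) (finite_subsets_at_top UNIV)"
      using has_complex_derivative_uniform_limit[OF ev ul _ d(1)] by (metis finite_subsets_at_top_neq_bot)
    thus ?thesis using d(1) by (auto simp: has_sum_def intro!: exI[of _ "g' z"])
  qed
  show "(\<lambda>z. \<Sum>\<^sub>\<infinity>k. f k z) holomorphic_on \<Omega>"
    using main by (subst holomorphic_on_open[OF assms(1)]) blast
  show "((\<lambda>k. deriv (f k) z) has_sum deriv (\<lambda>z. \<Sum>\<^sub>\<infinity>k. f k z) z) UNIV" if "z \<in> \<Omega>"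
    using main[OF that] DERIV_imp_deriv by blast
qed

lemma summable_on_intI:
  fixes f :: "int \<Rightarrow> 'a :: banach"
  assumes "(\<lambda>n. f (int n)) summable_on UNIV" "(\<lambda>n. f (- int n - 1)) summable_on UNIV"
  shows "f summable_on UNIV"
proof -
  have b1: "bij_betw int UNIV {0..}"
    by (rule bij_betwI[of _ _ _ nat]) auto
  have b2: "bij_betw (\<lambda>n. - int n - 1) UNIV {..<0}"
    by (rule bij_betwI[of _ _ _ "\<lambda>k. nat (- k - 1)"]) auto
  have "f summable_on {0..}" using summable_on_reindex_bij_betw[OF b1, of f] assms(1) by simp
  moreover have "f summable_on {..<0}" using summable_on_reindex_bij_betw[OF b2, of f] assms(2) by simp
  ultimately have "f summable_on ({0..} \<union> {..<0})" by (intro summable_on_Un_disjoint) auto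
  moreover have "{0..} \<union> {..<0::int} = UNIV" by auto
  ultimately show ?thesis by simp
qed

lemma geometric_summable_on:
  fixes a :: real assumes "0 \<le> a" "a < 1"
  shows "(\<lambda>n. C * a ^ n) summable_on (UNIV :: nat set)"
proof -
  have "summable (\<lambda>n. norm (C * a ^ n))"
    using assms by (auto simp: abs_mult intro!: summable_mult summable_geometric)
  thus ?thesis by (rule norm_summable_imp_summable_on)
qed

lemma summable_on_int_geometric:
  fixes f :: "int \<Rightarrow> 'a :: banach"
  assumes "0 \<le> a" "a < 1" "0 \<le> b" "b < 1"
    and "\<And>n. norm (f (int n)) \<le> C * a ^ n" "\<And>n. norm (f (- int n - 1)) \<le> C * b ^ n"
  shows "(\<lambda>k. norm (f k)) summable_on UNIV"
proof (rule summable_on_intI)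
  show "(\<lambda>n. norm (f (int n))) summable_on UNIV"
    by (rule summable_on_comparison_test[OF geometric_summable_on[OF assms(1,2)]]) (use assms in auto)
  show "(\<lambda>n. norm (f (- int n - 1))) summable_on UNIV"
    by (rule summable_on_comparison_test[OF geometric_summable_on[OF assms(3,4)]]) (use assms in auto)
qed

lemma gauss_summable:
  fixes \<beta> \<delta> R :: real
  assumes "\<beta> > 0" "0 \<le> \<delta>" "\<delta> \<le> 1"
  shows "(\<lambda>m::int. exp (- \<beta> * (of_int m + \<delta>)\<^sup>2 + R * \<bar>of_int m + \<delta>\<bar>)) summable_on UNIV"
proof -
  \<comment> \<open>Completing the square: \<open>K\<close> is the maximum of (R + 1) t - \<beta>
    t^2 over real t. The surplus 1 in R + 1 leaves a factor exp (- |s|), hence a geometric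
    majorant.\<close>
  define K where "K = (R + 1)\<^sup>2 / (4 * \<beta>)"
  have K: "- \<beta> * s\<^sup>2 + R * \<bar>s\<bar> \<le> K - \<bar>s\<bar>" for s :: real
  proof -
    have "0 \<le> \<beta> * (\<bar>s\<bar> - (R + 1) / (2 * \<beta>))\<^sup>2" using assms by simp
    also have "\<dots> = \<beta> * s\<^sup>2 - (R + 1) * \<bar>s\<bar> + K"
      using assms by (simp add: K_def power2_diff power_divide field_simps power2_eq_square)
    finally show ?thesis by (simp add: algebra_simps)
  qed
  have le: "exp (- \<beta> * s\<^sup>2 + R * \<bar>s\<bar>) \<le> exp K * exp (- 1) ^ n" if "real n \<le> \<bar>s\<bar>" for s n
  proof -
    have "exp (- \<beta> * s\<^sup>2 + R * \<bar>s\<bar>) \<le> exp (K - real n)" using K[of s] that by simp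
    also have "\<dots> = exp K * exp (- 1) ^ n" by (simp add: exp_diff exp_minus power_inverse divide_inverse flip: exp_of_nat_mult)
    finally show ?thesis .
  qed
  have "(\<lambda>m::int. norm (exp (- \<beta> * (of_int m + \<delta>)\<^sup>2 + R * \<bar>of_int m + \<delta>\<bar>))) summable_on UNIV"
    by (rule summable_on_int_geometric[where a = "exp (-1)" and b = "exp (-1)" and C = "exp K"])
      (use assms le[of n "of_int (int n) + \<delta>" for n] le[of n "of_int (- int n - 1) + \<delta>" for n] in simp_all)
  thus ?thesis by simp
qed

definition theta_num :: "complex \<Rightarrow> complex \<Rightarrow> complex" where
  "theta_num \<tau> z =
     (\<Sum>\<^sub>\<infinity>m::int. (- 1) powi m * exp (pi * \<i> * \<tau> * (of_int m + 1/2)\<^sup>2) * exp ((of_int m + 1/2) * z))"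

text \<open>The termwise derivative of \<open>theta_num\<close> at 0. That it does not vanish is
  hidden in the series and comes later from Fock space.\<close>

definition theta_den :: "complex \<Rightarrow> complex" where
  "theta_den \<tau> =
     (\<Sum>\<^sub>\<infinity>m::int. (- 1) powi m * (of_int m + 1/2) * exp (pi * \<i> * \<tau> * (of_int m + 1/2)\<^sup>2))"

lemma theta_eq: "theta \<tau> z = theta_num \<tau> z / theta_den \<tau>"
  by (simp add: theta_def theta_num_def theta_den_def)

lemma norm_gauss_term:
  "norm (exp (of_real b * \<i> * \<tau> * (of_real s)\<^sup>2) * exp (of_real s * z)) = exp (- (b * Im \<tau>) * s\<^sup>2 + s * Re z)"
proof -
  have "of_real b * \<i> * \<tau> * (of_real s)\<^sup>2 + of_real s * z = of_real (b * s\<^sup>2) * (\<i> * \<tau>) + of_real s * z"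
    by (simp only: of_real_mult of_real_power mult_ac)
  hence "norm (exp (of_real b * \<i> * \<tau> * (of_real s)\<^sup>2) * exp (of_real s * z)) =
      exp (Re (of_real (b * s\<^sup>2) * (\<i> * \<tau>) + of_real s * z))"
    by (simp only: exp_add[symmetric] norm_exp_eq_Re)
  also have "Re (of_real (b * s\<^sup>2) * (\<i> * \<tau>) + of_real s * z) = - (b * Im \<tau>) * s\<^sup>2 + s * Re z"
    by (simp del: of_real_mult of_real_power)
  finally show ?thesis .
qed

lemma norm_gauss_term_le:
  assumes "norm z \<le> R"
  shows "norm (exp (of_real b * \<i> * \<tau> * (of_real s)\<^sup>2) * exp (of_real s * z)) \<le> exp (- (b * Im \<tau>) * s\<^sup>2 + R * \<bar>s\<bar>)"
proof -
  have "\<bar>Re z\<bar> \<le> R" using assms abs_Re_le_cmod order_trans by blast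
  hence "\<bar>s\<bar> * \<bar>Re z\<bar> \<le> \<bar>s\<bar> * R" by (intro mult_left_mono) auto
  hence "s * Re z \<le> R * \<bar>s\<bar>" using abs_ge_self[of "s * Re z"] by (simp add: abs_mult mult.commute)
  thus ?thesis unfolding norm_gauss_term by simp
qed

lemma norm_neg_one_powi [simp]: "norm ((- 1 :: complex) powi m) = 1"
  by (simp add: norm_power_int)

lemma half_of_real: "(of_int m + 1/2 :: complex) = of_real (of_int m + 1/2)"
  by simp

lemma theta_term_le:
  assumes "norm z \<le> R"
  shows "norm ((- 1) powi m * exp (pi * \<i> * \<tau> * (of_int m + 1/2)\<^sup>2) * exp ((of_int m + 1/2) * z))
     \<le> exp (- (pi * Im \<tau>) * (of_int m + 1/2)\<^sup>2 + R * \<bar>of_int m + 1/2\<bar>)"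
  using norm_gauss_term_le[OF assms, of pi \<tau> "of_int m + 1/2"]
  by (simp only: norm_mult norm_neg_one_powi half_of_real mult_1)

lemma theta_terms_summable:
  assumes "Im \<tau> > 0"
  shows "(\<lambda>m. norm ((- 1) powi m * exp (pi * \<i> * \<tau> * (of_int m + 1/2)\<^sup>2) * exp ((of_int m + 1/2) * z))) summable_on UNIV"
  by (rule summable_on_comparison_test[OF gauss_summable[of "pi * Im \<tau>" "1/2" "norm z"]])
    (use assms theta_term_le[of z "norm z"] in auto)

lemma theta_num_holomorphic:
  assumes "Im \<tau> > 0"
  shows "theta_num \<tau> holomorphic_on UNIV"
  unfolding theta_num_def
proof (rule holomorphic_infsum)
  fix z :: complex
  show "\<exists>d>0. \<exists>M. cball z d \<subseteq> UNIV \<and> M summable_on UNIV \<and> (\<forall>m. \<forall>w\<in>cball z d.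
     norm ((- 1) powi m * exp (pi * \<i> * \<tau> * (of_int m + 1/2)\<^sup>2) * exp ((of_int m + 1/2) * w)) \<le> M m)"
  proof (intro exI[of _ 1] conjI exI[of _ "\<lambda>m. exp (- (pi * Im \<tau>) * (of_int m + 1/2)\<^sup>2 + (norm z + 1) * \<bar>of_int m + 1/2\<bar>)"] allI ballI)
    show "(\<lambda>m::int. exp (- (pi * Im \<tau>) * (of_int m + 1/2)\<^sup>2 + (norm z + 1) * \<bar>of_int m + 1/2\<bar>)) summable_on UNIV"
      using gauss_summable[of "pi * Im \<tau>" "1/2"] assms by simp
    fix m and w :: complex assume "w \<in> cball z 1"
    hence "norm w \<le> norm z + 1" using norm_triangle_ineq2[of w z] by (simp add: dist_norm norm_minus_commute)
    thus "norm ((- 1) powi m * exp (pi * \<i> * \<tau> * (of_int m + 1/2)\<^sup>2) * exp ((of_int m + 1/2) * w))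
      \<le> exp (- (pi * Im \<tau>) * (of_int m + 1/2)\<^sup>2 + (norm z + 1) * \<bar>of_int m + 1/2\<bar>)"
      by (rule theta_term_le)
  qed auto
qed (auto intro!: holomorphic_intros)

lemma theta_num_minus: "theta_num \<tau> (- z) = - theta_num \<tau> z"
proof -
  have "theta_num \<tau> (- z) = (\<Sum>\<^sub>\<infinity>m::int. - ((- 1) powi m * exp (pi * \<i> * \<tau> * (of_int m + 1/2)\<^sup>2) * exp ((of_int m + 1/2) * z)))"
    unfolding theta_num_def
  proof (rule infsum_reindex_bij_witness[of _ "\<lambda>m. - m - 1" "\<lambda>m. - m - 1"])
    fix m :: int
    have 1: "((- 1) powi (- m - 1) :: complex) = - ((- 1) powi m)"
      by (simp add: power_int_minus_left)
    have 2: "(of_int (- m - 1) + 1/2 :: complex) = - (of_int m + 1/2)" by simp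
    show "- ((- 1) powi (- m - 1) * exp (pi * \<i> * \<tau> * (of_int (- m - 1) + 1/2)\<^sup>2) * exp ((of_int (- m - 1) + 1/2) * z))
      = (- 1) powi m * exp (pi * \<i> * \<tau> * (of_int m + 1/2)\<^sup>2) * exp ((of_int m + 1/2) * - z)"
      unfolding 1 2 power2_minus by (simp only: mult_minus_left mult_minus_right minus_minus)
  qed auto
  thus ?thesis by (simp add: infsum_uminus theta_num_def)
qed

section \<open>Addition formula for the theta series\<close>

definition gauss_term :: "complex \<Rightarrow> complex \<Rightarrow> int \<Rightarrow> complex" where
  "gauss_term \<tau> x r = exp ((pi/2) * \<i> * \<tau> * (of_int r)\<^sup>2) * exp (of_int r * x)"

lemma gauss_term_summable:
  assumes "Im \<tau> > 0"
  shows "(\<lambda>r. norm (gauss_term \<tau> x r)) summable_on UNIV"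
proof (rule summable_on_comparison_test[OF gauss_summable[of "(pi/2) * Im \<tau>" 0 "norm x"]])
  fix r :: int
  show "norm (gauss_term \<tau> x r) \<le> exp (- ((pi/2) * Im \<tau>) * (of_int r + 0)\<^sup>2 + norm x * \<bar>of_int r + 0\<bar>)"
    unfolding gauss_term_def using norm_gauss_term_le[of x "norm x" "pi/2" \<tau> "of_int r"] by simp
qed (use assms in auto)

lemma has_sum_mult_abs:
  fixes f :: "'a \<Rightarrow> complex" and g :: "'b \<Rightarrow> complex"
  assumes "(\<lambda>x. norm (f x)) summable_on A" "(\<lambda>x. norm (g x)) summable_on B"
  shows "((\<lambda>(x, y). f x * g y) has_sum (infsum f A * infsum g B)) (A \<times> B)"
proof -
  have s: "(\<lambda>p. norm ((\<lambda>(x, y). f x * g y) p)) summable_on A \<times> B"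
    unfolding Infinite_Sum.abs_summable_on_Sigma_iff
    by (auto simp: norm_mult infsum_cmult_right' infsum_nonneg intro!: summable_on_cmult_right summable_on_cmult_left assms)
  hence s': "(\<lambda>(x, y). f x * g y) summable_on A \<times> B" by (rule abs_summable_summable)
  have "infsum (\<lambda>(x, y). f x * g y) (A \<times> B) = (\<Sum>\<^sub>\<infinity>x\<in>A. \<Sum>\<^sub>\<infinity>y\<in>B. f x * g y)"
    using infsum_Sigma_banach[OF s'] by simp
  also have "\<dots> = infsum f A * infsum g B"
    by (simp add: infsum_cmult_right' infsum_cmult_left')
  finally show ?thesis using s' by (simp add: has_sum_iff)
qed

text \<open>
  The theta series of index one pairs into theta series of index two: with \<open>r = m + n + 1\<close> and
  \<open>d = m - n\<close> one has $(m+\frac12)^2 + (n+\frac12)^2 = (r^2 + d^2)/2$, and \<open>r\<close>, \<open>d\<close> have opposite parity.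
\<close>

lemma theta_num_mult:
  assumes "Im \<tau> > 0"
  shows "theta_num \<tau> (x + y) * theta_num \<tau> (x - y) =
     infsum (gauss_term \<tau> x) {r. odd r} * infsum (gauss_term \<tau> y) {d. even d} -
     infsum (gauss_term \<tau> x) {r. even r} * infsum (gauss_term \<tau> y) {d. odd d}"
proof -
  define t where "t = (\<lambda>z (m::int). (- 1) powi m * exp (pi * \<i> * \<tau> * (of_int m + 1/2)\<^sup>2) * exp ((of_int m + 1/2) * z))"
  define G where "G = (\<lambda>(r::int, d::int). (if odd r then 1 else - 1) * (gauss_term \<tau> x r * gauss_term \<tau> y d))"
  let ?h = "\<lambda>(m::int, n::int). (m + n + 1, m - n)"
  let ?OE = "{r::int. odd r} \<times> {d::int. even d}" and ?EO = "{r::int. even r} \<times> {d::int. odd d}"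
  have st: "(\<lambda>m. norm (t z m)) summable_on UNIV" for z
    unfolding t_def using theta_terms_summable[OF assms] .
  have lhs: "((\<lambda>(m, n). t (x + y) m * t (x - y) n) has_sum (theta_num \<tau> (x + y) * theta_num \<tau> (x - y))) (UNIV \<times> UNIV)"
    using has_sum_mult_abs[OF st[of "x + y"] st[of "x - y"]] unfolding theta_num_def t_def .
  have sg: "(\<lambda>r. norm (gauss_term \<tau> z r)) summable_on A" for z A
    using gauss_term_summable[OF assms] by (rule summable_on_subset) auto
  have "((\<lambda>(r, d). gauss_term \<tau> x r * gauss_term \<tau> y d) has_sum
      (infsum (gauss_term \<tau> x) {r. odd r} * infsum (gauss_term \<tau> y) {d. even d})) ?OE"
    by (rule has_sum_mult_abs[OF sg sg])
  hence 1: "(G has_sum (infsum (gauss_term \<tau> x) {r. odd r} * infsum (gauss_term \<tau> y) {d. even d})) ?OE"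
    by (subst has_sum_cong[where g = "\<lambda>(r, d). gauss_term \<tau> x r * gauss_term \<tau> y d"]) (auto simp: G_def)
  have "((\<lambda>(r, d). gauss_term \<tau> x r * gauss_term \<tau> y d) has_sum
      (infsum (gauss_term \<tau> x) {r. even r} * infsum (gauss_term \<tau> y) {d. odd d})) ?EO"
    by (rule has_sum_mult_abs[OF sg sg])
  hence "((\<lambda>p. - (case p of (r, d) \<Rightarrow> gauss_term \<tau> x r * gauss_term \<tau> y d)) has_sum
      - (infsum (gauss_term \<tau> x) {r. even r} * infsum (gauss_term \<tau> y) {d. odd d})) ?EO"
    by (simp only: has_sum_uminus minus_minus)
  hence 2: "(G has_sum - (infsum (gauss_term \<tau> x) {r. even r} * infsum (gauss_term \<tau> y) {d. odd d})) ?EO"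
    by (subst has_sum_cong[where g = "\<lambda>p. - (case p of (r, d) \<Rightarrow> gauss_term \<tau> x r * gauss_term \<tau> y d)"]) (auto simp: G_def)
  have G: "(G has_sum (infsum (gauss_term \<tau> x) {r. odd r} * infsum (gauss_term \<tau> y) {d. even d} +
      - (infsum (gauss_term \<tau> x) {r. even r} * infsum (gauss_term \<tau> y) {d. odd d}))) (?OE \<union> ?EO)"
    by (rule has_sum_Un_disjoint[OF 1 2]) auto
  have bij: "bij_betw ?h (UNIV \<times> UNIV) (?OE \<union> ?EO)"
    by (rule bij_betwI[of _ _ _ "\<lambda>(r, d). ((r + d - 1) div 2, (r - d - 1) div 2)"]) (auto elim!: oddE evenE, presburger+)
  have eq: "G (?h p) = (case p of (m, n) \<Rightarrow> t (x + y) m * t (x - y) n)" for p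
  proof -
    obtain m n where p: "p = (m, n)" by force
    \<comment> \<open>The sign (-1)^(m + n) is positive exactly when r = m + n + 1 is odd, so the
      two parity classes enter with opposite signs.\<close>
    have sgn: "(if odd (m + n + 1) then 1 else - 1 :: complex) = (- 1) powi m * (- 1) powi n"
      by (auto simp: power_int_minus_one_minus power_int_add[symmetric] power_int_minus_left)
    have e: "pi * \<i> * \<tau> * (of_int m + 1/2)\<^sup>2 + (of_int m + 1/2) * (x + y) + (pi * \<i> * \<tau> * (of_int n + 1/2)\<^sup>2 + (of_int n + 1/2) * (x - y))
      = (pi/2) * \<i> * \<tau> * (of_int (m + n + 1))\<^sup>2 + of_int (m + n + 1) * x + ((pi/2) * \<i> * \<tau> * (of_int (m - n))\<^sup>2 + of_int (m - n) * y)"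
      by (simp add: power2_eq_square field_simps)
    have "t (x + y) m * t (x - y) n = (- 1) powi m * (- 1) powi n *
       exp (pi * \<i> * \<tau> * (of_int m + 1/2)\<^sup>2 + (of_int m + 1/2) * (x + y) + (pi * \<i> * \<tau> * (of_int n + 1/2)\<^sup>2 + (of_int n + 1/2) * (x - y)))"
      by (simp only: t_def exp_add mult_ac)
    also have "\<dots> = G (?h p)"
      unfolding e sgn[symmetric] p by (simp only: G_def gauss_term_def exp_add mult_ac prod.case)
    finally show ?thesis by (simp add: p)
  qed
  have "((\<lambda>p. G (?h p)) has_sum (infsum (gauss_term \<tau> x) {r. odd r} * infsum (gauss_term \<tau> y) {d. even d} +
      - (infsum (gauss_term \<tau> x) {r. even r} * infsum (gauss_term \<tau> y) {d. odd d}))) (UNIV \<times> UNIV)"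
    using has_sum_reindex_bij_betw[OF bij, of G] G by simp
  with lhs show ?thesis unfolding eq using has_sum_unique by fastforce
qed


section \<open>Determinants\<close>

lemma det_lower_triangular:
  fixes A :: "'a::comm_ring_1 ^ 'n::{finite,linorder} ^ 'n::{finite,linorder}"
  assumes "\<And>i j. i < j \<Longrightarrow> A $ i $ j = 0"
  shows "det A = (\<Prod>i\<in>UNIV. A $ i $ i)"
proof -
  \<comment> \<open>The least moved point \<open>m\<close> would be sent below itself, to a point
    that \<open>p\<close> fixes, against injectivity.\<close>
  have *: "p = id" if p: "p permutes UNIV" and le: "\<And>i. p i \<le> i" for p :: "'n \<Rightarrow> 'n"
  proof (rule ccontr)
    assume "p \<noteq> id"
    hence ne: "{i. p i \<noteq> i} \<noteq> {}" by (auto simp: fun_eq_iff)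
    define m where "m = Min {i. p i \<noteq> i}"
    have m: "p m \<noteq> m" using Min_in[OF _ ne] by (simp add: m_def)
    have "p m < m" using le[of m] m by simp
    hence "p (p m) = p m" using Min_le[of "{i. p i \<noteq> i}" "p m"] by (fastforce simp: m_def)
    thus False using m permutes_inj[OF p] by (simp add: inj_eq)
  qed
  have "of_int (sign p) * (\<Prod>i\<in>UNIV. A $ i $ p i) = 0" if "p permutes UNIV" "p \<noteq> id" for p
  proof -
    have "\<not> (\<forall>i. p i \<le> i)" using *[OF that(1)] that(2) by blast
    then obtain i where "i < p i" by (auto simp: not_le)
    hence "(\<Prod>i\<in>UNIV. A $ i $ p i) = 0" using assms by (intro prod_zero) auto
    thus ?thesis by simp
  qed
  hence "det A = (\<Sum>p\<in>{id}. of_int (sign p) * (\<Prod>i\<in>UNIV. A $ i $ p i))"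
    unfolding det_def by (intro sum.mono_neutral_right) (auto simp: permutes_id finite_permutations)
  thus ?thesis by (simp add: sign_id)
qed

text \<open>
  The rows of the level matrix that are not last in their level become unit vectors when the next
  row of the same level is subtracted, so that only the last rows contribute.
\<close>

lemma det_levels:
  fixes m :: "'n::{finite,linorder} \<Rightarrow> 'k" and p :: "'k \<Rightarrow> complex"
  shows "det (\<chi> i j::'n. if m i = m j then if i \<le> j then p (m i) else p (m i) - 1 else 0) = (\<Prod>s\<in>range m. p s)"
proof -
  define B :: "((complex, 'n) vec, 'n) vec" where "B = (\<chi> i j::'n. if m i = m j then if i \<le> j then p (m i) else p (m i) - 1 else 0)"
  \<comment> \<open>\<open>S i\<close> collects the later indices of the level of \<open>i\<close>,
    and \<open>nx i\<close> is the first of them; \<open>U\<close> subtracts from each row the next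
    row of its level.\<close>
  define S where "S = (\<lambda>i. {j. i < j \<and> m j = m i})"
  define nx where "nx = (\<lambda>i. Min (S i))"
  define U :: "((complex, 'n) vec, 'n) vec" where "U = (\<chi> i j::'n. if j = i then 1 else if S i \<noteq> {} \<and> j = nx i then - 1 else 0)"
  have nx: "i < nx i" "m (nx i) = m i" "\<And>j. i < j \<Longrightarrow> m j = m i \<Longrightarrow> nx i \<le> j" if "S i \<noteq> {}" for i
    using Min_in[OF _ that] Min_le[of "S i"] by (auto simp: nx_def S_def)
  have detU: "det U = 1"
  proof -
    have "det (transpose U) = (\<Prod>i\<in>UNIV. transpose U $ i $ i)"
      by (rule det_lower_triangular) (use nx(1) in \<open>force simp: transpose_def U_def\<close>)
    also have "\<dots> = 1" by (simp add: transpose_def U_def)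
    finally show ?thesis by (simp only: det_transpose)
  qed
  define R :: "((complex, 'n) vec, 'n) vec" where "R = U ** B"
  have R: "R $ i $ j = (if S i = {} then B $ i $ j else if i = j then 1 else 0)" for i j
  proof (cases "S i = {}")
    case True
    thus ?thesis by (simp add: R_def matrix_matrix_mult_def U_def if_distrib[where f = "\<lambda>x. x * _"] sum.delta cong: if_cong)
  next
    case False
    have "R $ i $ j = (\<Sum>k\<in>{i, nx i}. U $ i $ k * B $ k $ j)"
      unfolding R_def matrix_matrix_mult_def vec_lambda_beta
      by (rule sum.mono_neutral_right) (auto simp: U_def)
    also have "\<dots> = B $ i $ j - B $ nx i $ j"
      using nx[OF False] False by (simp add: U_def)
    \<comment> \<open>Within a level, row \<open>i\<close> switches from p - 1 to p at column
      \<open>i\<close>, and the next row switches at the next index of the level. The difference is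
      therefore 1 at \<open>i\<close> and 0 elsewhere.\<close>
    also have "\<dots> = (if i = j then 1 else 0)"
    proof (cases "m i = m j")
      case True
      thus ?thesis using nx(1,2)[OF False] nx(3)[OF False, of j]
        by (cases i j rule: linorder_cases) (auto simp: B_def not_le)
    qed (use nx(1,2)[OF False] in \<open>auto simp: B_def\<close>)
    finally show ?thesis using False by simp
  qed
  have "det R = (\<Prod>i\<in>UNIV. R $ i $ i)"
  proof (rule det_lower_triangular)
    fix i j :: 'n assume "i < j"
    thus "R $ i $ j = 0" by (auto simp: R B_def S_def)
  qed
  also have "\<dots> = (\<Prod>i\<in>UNIV. if S i = {} then p (m i) else 1)"
    by (rule prod.cong) (auto simp: R B_def)
  also have "\<dots> = (\<Prod>i\<in>{i. S i = {}}. p (m i))"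
    by (rule prod.mono_neutral_cong_right) auto
  also have "\<dots> = (\<Prod>s\<in>range m. p s)"
  proof (rule prod.reindex_bij_betw)
    show "bij_betw m {i. S i = {}} (range m)"
    proof (intro bij_betw_imageI inj_onI subset_antisym)
      show "i = j" if "i \<in> {i. S i = {}}" "j \<in> {i. S i = {}}" "m i = m j" for i j
        using that by (auto simp: S_def) (metis linorder_neqE)
      show "range m \<subseteq> m ` {i. S i = {}}"
      proof safe
        fix x
        define y where "y = Max {j. m j = m x}"
        have "y \<in> {j. m j = m x}" unfolding y_def by (rule Max_in) auto
        moreover have "j \<le> y" if "m j = m x" for j unfolding y_def using that by (intro Max_ge) auto
        ultimately show "m x \<in> m ` {i. S i = {}}" by (intro image_eqI[of _ _ y]) (auto simp: S_def not_less[symmetric])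
      qed
    qed auto
  qed
  finally have "det R = (\<Prod>s\<in>range m. p s)" .
  moreover have "det R = det B" by (simp add: R_def det_mul detU)
  ultimately show ?thesis by (simp add: B_def)
qed

text \<open>Padding by an identity block keeps all minors in one matrix type, which permits induction on \<open>S\<close>.\<close>

definition block_det :: "'n set \<Rightarrow> ('n::finite \<Rightarrow> 'n \<Rightarrow> complex) \<Rightarrow> complex" where
  "block_det S M = det (\<chi> i j. if i \<in> S \<and> j \<in> S then M i j else if i = j then 1 else 0)"

text \<open>These are the elimination matrices of \<open>block_det_insert\<close>. A nonidentity
  permutation always picks a zero entry: at \<open>k\<close> if it moves \<open>k\<close>, at any
  other moved point otherwise. The diagonal entries are 1 because \<open>v k = 0\<close>.\<close>

lemma det_column_shear:
  fixes v :: "'n::finite \<Rightarrow> complex"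
  assumes "v k = 0"
  shows "det (\<chi> i j. (if i = j then 1 else 0) + (if j = k then v i else 0)) = 1"
proof -
  define A :: "((complex, 'n) vec, 'n) vec" where "A = (\<chi> i j. (if i = j then 1 else 0) + (if j = k then v i else 0))"
  have "of_int (sign p) * (\<Prod>i\<in>UNIV. A $ i $ p i) = 0" if p: "p permutes UNIV" "p \<noteq> id" for p
  proof (cases "p k = k")
    case True
    obtain i where i: "p i \<noteq> i" using p by (auto simp: fun_eq_iff)
    have "p i \<noteq> k" using True i permutes_inj[OF p(1)] by (metis injD)
    hence "A $ i $ p i = 0" using i by (simp add: A_def)
    hence "(\<Prod>i\<in>UNIV. A $ i $ p i) = 0" by (intro prod_zero) auto
    thus ?thesis by simp
  next
    case False
    hence "A $ k $ p k = 0" using assms by (simp add: A_def)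
    hence "(\<Prod>i\<in>UNIV. A $ i $ p i) = 0" by (intro prod_zero) auto
    thus ?thesis by simp
  qed
  hence "det A = (\<Sum>p\<in>{id}. of_int (sign p) * (\<Prod>i\<in>UNIV. A $ i $ p i))"
    unfolding det_def by (intro sum.mono_neutral_right) (auto simp: permutes_id finite_permutations)
  thus ?thesis using assms by (auto simp: sign_id A_def intro!: prod.neutral)
qed

text \<open>Gaussian elimination at the pivot \<open>k\<close>: the matrix factors through two
  shears \<open>L\<close> and \<open>transpose T\<close> of determinant 1, and the middle factor
  \<open>D'\<close> is the Schur complement with the pivot in row \<open>k\<close>.\<close>

lemma block_det_insert:
  fixes M :: "'n::finite \<Rightarrow> 'n \<Rightarrow> complex"
  assumes k: "k \<notin> S" and nz: "M k k \<noteq> 0"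
  shows "block_det (insert k S) M = M k k * block_det S (\<lambda>i j. M i j - M i k * M k j / M k k)"
proof -
  define A :: "((complex, 'n) vec, 'n) vec" where "A = (\<chi> i j. if i \<in> insert k S \<and> j \<in> insert k S then M i j else if i = j then 1 else 0)"
  define D :: "((complex, 'n) vec, 'n) vec" where "D = (\<chi> i j. if i \<in> S \<and> j \<in> S then M i j - M i k * M k j / M k k else if i = j then 1 else 0)"
  define D' :: "((complex, 'n) vec, 'n) vec" where "D' = (\<chi> i. if i = k then M k k *s D $ k else D $ i)"
  define v where "v = (\<lambda>i. if i \<in> S then M i k / M k k else 0)"
  define w where "w = (\<lambda>i. if i \<in> S then M k i / M k k else 0)"
  define L :: "((complex, 'n) vec, 'n) vec" where "L = (\<chi> i j. (if i = j then 1 else 0) + (if j = k then v i else 0))"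
  define T :: "((complex, 'n) vec, 'n) vec" where "T = (\<chi> i j. (if i = j then 1 else 0) + (if j = k then w i else 0))"
  have "det L = 1" "det T = 1" unfolding L_def T_def using k by (auto intro!: det_column_shear simp: v_def w_def)
  have LD: "(L ** D') $ i $ j = D' $ i $ j + v i * D' $ k $ j" for i j
    by (simp add: matrix_matrix_mult_def L_def algebra_simps sum.distrib if_distrib[where f = "\<lambda>x. _ * x"] if_distrib[where f = "\<lambda>x. x * _"] sum.delta sum.delta' cong: if_cong)
  have "((L ** D') ** transpose T) $ i $ j = (L ** D') $ i $ j + (L ** D') $ i $ k * w j" for i j
    by (simp add: matrix_matrix_mult_def[of "L ** D'"] transpose_def T_def algebra_simps sum.distrib if_distrib[where f = "\<lambda>x. _ * x"] if_distrib[where f = "\<lambda>x. x * _"] sum.delta sum.delta' cong: if_cong)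
  hence LDT: "((L ** D') ** transpose T) $ i $ j = D' $ i $ j + v i * D' $ k $ j + (D' $ i $ k + v i * D' $ k $ k) * w j" for i j
    by (simp add: LD)
  have Dk: "D' $ k $ j = (if j = k then M k k else 0)" "D' $ j $ k = (if j = k then M k k else 0)" for j
    using k by (auto simp: D'_def D_def)
  have "((L ** D') ** transpose T) $ i $ j = A $ i $ j" for i j
    unfolding LDT Dk using k nz by (auto simp: D'_def D_def v_def w_def A_def)
  hence "A = (L ** D') ** transpose T" by (simp add: vec_eq_iff)
  hence "det A = det D'" by (simp add: det_mul \<open>det L = 1\<close> \<open>det T = 1\<close>)
  also have "\<dots> = M k k * det (\<chi> i. if i = k then D $ k else D $ i)"
    unfolding D'_def by (rule det_row_mul)
  also have "(\<chi> i. if i = k then D $ k else D $ i) = D" by (simp add: vec_eq_iff)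
  finally show ?thesis by (simp add: block_det_def A_def D_def)
qed

text \<open>Every permutation meets each row and each column once, so row and column factors leave
  the Leibniz sum; outside \<open>S\<close> they are set to 1.\<close>

lemma block_det_scale:
  fixes M :: "'n::finite \<Rightarrow> 'n \<Rightarrow> complex"
  shows "block_det S (\<lambda>i j. \<alpha> i * \<beta> j * M i j) = (\<Prod>i\<in>S. \<alpha> i * \<beta> i) * block_det S M"
proof -
  define A :: "((complex, 'n) vec, 'n) vec" where "A = (\<chi> i j. if i \<in> S \<and> j \<in> S then M i j else if i = j then 1 else 0)"
  define a where "a = (\<lambda>i. if i \<in> S then \<alpha> i else 1)"
  define b where "b = (\<lambda>i. if i \<in> S then \<beta> i else 1)"
  have 1: "(if i \<in> S \<and> j \<in> S then \<alpha> i * \<beta> j * M i j else if i = j then 1 else 0) = a i * b j * A $ i $ j" for i j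
    by (auto simp: a_def b_def A_def)
  have "(\<Prod>i\<in>UNIV. b (p i)) = (\<Prod>i\<in>UNIV. b i)" if "p permutes UNIV" for p
    using prod.permute[OF that, of b] by (simp add: o_def)
  hence "block_det S (\<lambda>i j. \<alpha> i * \<beta> j * M i j) = ((\<Prod>i\<in>UNIV. a i) * (\<Prod>i\<in>UNIV. b i)) * det A"
    unfolding block_det_def 1 det_def sum_distrib_left
    by (intro sum.cong) (auto simp: prod.distrib)
  also have "(\<Prod>i\<in>UNIV. a i) = (\<Prod>i\<in>S. \<alpha> i)" unfolding a_def by (rule prod.mono_neutral_cong_right) auto
  also have "(\<Prod>i\<in>UNIV. b i) = (\<Prod>i\<in>S. \<beta> i)" unfolding b_def by (rule prod.mono_neutral_cong_right) auto
  finally show ?thesis by (simp add: block_det_def A_def prod.distrib)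
qed

text \<open>By \<open>mult\<close>, the product \<open>f (x + y) * f (x - y)\<close> is the 2-by-2
  minor of the columns (B, A) at \<open>x\<close> and \<open>y\<close>. In the variables
  \<open>X\<close>, \<open>Y\<close>, \<open>Z\<close>, \<open>W\<close> all six products are such
  minors, and the claim is the Pluecker relation for four columns.\<close>

lemma frobenius_two_by_two:
  fixes f A B :: "complex \<Rightarrow> complex"
  assumes mult: "\<And>x y. f (x + y) * f (x - y) = B x * A y - A x * B y"
  shows "f (c + a1 - b1) * f (c + a2 - b2) * f (a1 - b2) * f (a2 - b1) -
         f (c + a1 - b2) * f (c + a2 - b1) * f (a1 - b1) * f (a2 - b2) =
         f c * f (c + a1 - b1 + a2 - b2) * f (a1 - a2) * f (b2 - b1)"
proof -
  define X where "X = c + (a1 + a2 - b1 - b2) / 2"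
  define Y where "Y = (a1 + a2 - b1 - b2) / 2"
  define Z where "Z = (a1 - a2 + b2 - b1) / 2"
  define W where "W = (a1 - a2 - b2 + b1) / 2"
  note d = X_def Y_def Z_def W_def
  have e: "X + Y = c + a1 - b1 + a2 - b2" "X - Y = c" "Z + W = a1 - a2" "Z - W = b2 - b1"
    "X + Z = c + a1 - b1" "X - Z = c + a2 - b2" "Y + W = a1 - b2" "Y - W = a2 - b1"
    "X + W = c + a1 - b2" "X - W = c + a2 - b1" "Y + Z = a1 - b1" "Y - Z = a2 - b2"
    by (simp_all add: d field_simps)
  note m = mult[of X Y] mult[of Z W] mult[of X Z] mult[of Y W] mult[of X W] mult[of Y Z]
  have "f (c + a1 - b1) * f (c + a2 - b2) * f (a1 - b2) * f (a2 - b1) -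
         f (c + a1 - b2) * f (c + a2 - b1) * f (a1 - b1) * f (a2 - b2) =
      (f (X + Z) * f (X - Z)) * (f (Y + W) * f (Y - W)) - (f (X + W) * f (X - W)) * (f (Y + Z) * f (Y - Z))"
    unfolding e by (simp only: mult.assoc)
  also have "\<dots> = (f (X + Y) * f (X - Y)) * (f (Z + W) * f (Z - W))"
    unfolding m by algebra
  also have "\<dots> = f c * f (c + a1 - b1 + a2 - b2) * f (a1 - a2) * f (b2 - b1)"
    unfolding e by (simp only: mult_ac)
  finally show ?thesis .
qed

text \<open>
  Frobenius' determinant: the Schur complement of an entry is again of the same form, with the
  parameter \<open>c\<close> shifted.
\<close>

lemma frobenius_det:
  fixes f A B :: "complex \<Rightarrow> complex" and a b :: "'n::{finite,linorder} \<Rightarrow> complex"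
  assumes mult: "\<And>x y. f (x + y) * f (x - y) = B x * A y - A x * B y"
    and nz: "\<And>i j. f (a i - b j) \<noteq> 0"
  shows "(\<And>T. T \<subseteq> S \<Longrightarrow> f (c + (\<Sum>i\<in>T. a i - b i)) \<noteq> 0) \<Longrightarrow>
     block_det S (\<lambda>i j. f (c + a i - b j) / (f c * f (a i - b j))) =
     f (c + (\<Sum>i\<in>S. a i - b i)) / f c *
     ((\<Prod>(i,j)\<in>{(i,j). i \<in> S \<and> j \<in> S \<and> i < j}. f (a i - a j) * f (b j - b i)) /
      ((\<Prod>i\<in>S. f (a i - b i)) * (\<Prod>(i,j)\<in>{(i,j). i \<in> S \<and> j \<in> S \<and> i < j}. f (a i - b j) * f (a j - b i))))"
proof -
  have "finite S" by simp
  thus "(\<And>T. T \<subseteq> S \<Longrightarrow> f (c + (\<Sum>i\<in>T. a i - b i)) \<noteq> 0) \<Longrightarrow> ?thesis"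
  proof (induction S arbitrary: c rule: finite_linorder_max_induct)
    case empty
    have "det (\<chi> (i::'n) (j::'n). if i = j then (1 :: complex) else 0) = det (mat 1 :: ((complex, 'n) vec, 'n) vec)"
      by (simp add: mat_def)
    thus ?case using empty[of "{}"] by (simp add: block_det_def)
  next
    case (insert k S)
    have k: "k \<notin> S" using insert.hyps by auto
    \<comment> \<open>Eliminating the pivot \<open>k\<close> shifts the parameter by
      \<open>a k - b k\<close>. This is why the induction varies \<open>c\<close> and why
      nonvanishing is assumed at all partial sums.\<close>
    define c' where "c' = c + a k - b k"
    have c: "f c \<noteq> 0" using insert.prems[of "{}"] by simp
    have c'nz: "f c' \<noteq> 0" using insert.prems[of "{k}"] by (simp add: c'_def algebra_simps)
    have prem: "f (c' + (\<Sum>i\<in>T. a i - b i)) \<noteq> 0" if "T \<subseteq> S" for T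
    proof -
      have "finite T" "k \<notin> T" using that k finite_subset insert.hyps by auto
      thus ?thesis using insert.prems[of "insert k T"] that by (auto simp: c'_def algebra_simps)
    qed
    let ?M = "\<lambda>c i j. f (c + a i - b j) / (f c * f (a i - b j))"
    define \<alpha> where "\<alpha> = (\<lambda>i. f (a i - a k) / f (a i - b k))"
    define \<beta> where "\<beta> = (\<lambda>j. f (b k - b j) / f (a k - b j))"
    have schur: "?M c i j - ?M c i k * ?M c k j / ?M c k k = \<alpha> i * \<beta> j * ?M c' i j" for i j
    proof -
      have "f (c + a i - b j) * f (c + a k - b k) * f (a i - b k) * f (a k - b j) -
         f (c + a i - b k) * f (c + a k - b j) * f (a i - b j) * f (a k - b k) =
         f c * f (c' + a i - b j) * f (a i - a k) * f (b k - b j)"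
        using frobenius_two_by_two[of f B A c "a i" "b j" "a k" "b k", OF mult] by (simp add: c'_def algebra_simps)
      thus ?thesis using c c'nz nz unfolding \<alpha>_def \<beta>_def c'_def[symmetric]
        by (simp add: divide_simps) (simp add: c'_def algebra_simps)?
    qed
    have Mkk: "?M c k k \<noteq> 0" using c c'nz nz by (simp add: c'_def)
    have "block_det (insert k S) (?M c) = ?M c k k * block_det S (\<lambda>i j. \<alpha> i * \<beta> j * ?M c' i j)"
      by (simp only: block_det_insert[OF k, of "?M c", OF Mkk] schur)
    also have "\<dots> = ?M c k k * ((\<Prod>i\<in>S. \<alpha> i * \<beta> i) * block_det S (?M c'))"
      by (simp only: block_det_scale)
    also have "block_det S (?M c') = f (c' + (\<Sum>i\<in>S. a i - b i)) / f c' *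
     ((\<Prod>(i,j)\<in>{(i,j). i \<in> S \<and> j \<in> S \<and> i < j}. f (a i - a j) * f (b j - b i)) /
      ((\<Prod>i\<in>S. f (a i - b i)) * (\<Prod>(i,j)\<in>{(i,j). i \<in> S \<and> j \<in> S \<and> i < j}. f (a i - b j) * f (a j - b i))))"
      by (rule insert.IH) (rule prem)
    also have "?M c k k = f c' / (f c * f (a k - b k))" by (simp add: c'_def)
    also have "c' + (\<Sum>i\<in>S. a i - b i) = c + (\<Sum>i\<in>insert k S. a i - b i)" using k insert.hyps by (simp add: c'_def)
    finally have main: "block_det (insert k S) (?M c) = f c' / (f c * f (a k - b k)) * ((\<Prod>i\<in>S. \<alpha> i * \<beta> i) *
      (f (c + (\<Sum>i\<in>insert k S. a i - b i)) / f c' *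
     ((\<Prod>(i,j)\<in>{(i,j). i \<in> S \<and> j \<in> S \<and> i < j}. f (a i - a j) * f (b j - b i)) /
      ((\<Prod>i\<in>S. f (a i - b i)) * (\<Prod>(i,j)\<in>{(i,j). i \<in> S \<and> j \<in> S \<and> i < j}. f (a i - b j) * f (a j - b i))))))" .
    have "{(i,j). i \<in> insert k S \<and> j \<in> insert k S \<and> i < j} = {(i,j). i \<in> S \<and> j \<in> S \<and> i < j} \<union> (\<lambda>i. (i, k)) ` S"
      using insert.hyps k by auto
    note set = this
    have pairs: "(\<Prod>(i,j)\<in>{(i,j). i \<in> insert k S \<and> j \<in> insert k S \<and> i < j}. g i j) =
        (\<Prod>(i,j)\<in>{(i,j). i \<in> S \<and> j \<in> S \<and> i < j}. g i j) * (\<Prod>i\<in>S. g i k)" for g :: "'n \<Rightarrow> 'n \<Rightarrow> complex"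
    proof -
      let ?P = "{(i,j). i \<in> S \<and> j \<in> S \<and> i < j}"
      have "finite ?P" by simp
      hence "(\<Prod>(i,j)\<in>?P \<union> (\<lambda>i. (i, k)) ` S. g i j) = (\<Prod>(i,j)\<in>?P. g i j) * (\<Prod>(i,j)\<in>(\<lambda>i. (i, k)) ` S. g i j)"
        using k by (intro prod.union_disjoint) auto
      also have "(\<Prod>(i,j)\<in>(\<lambda>i. (i, k)) ` S. g i j) = (\<Prod>i\<in>S. g i k)"
        by (simp add: prod.reindex inj_on_def)
      finally show ?thesis using set by simp
    qed
    \<comment> \<open>The elimination factors supply exactly the pairs containing \<open>k\<close>,
      which is the largest index of \<open>insert k S\<close>.\<close>
    have ab: "(\<Prod>i\<in>S. \<alpha> i * \<beta> i) = (\<Prod>i\<in>S. f (a i - a k) * f (b k - b i)) / (\<Prod>i\<in>S. f (a i - b k) * f (a k - b i))"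
      by (simp add: \<alpha>_def \<beta>_def prod_dividef prod.distrib)
    show ?case unfolding main pairs ab using c'nz k insert.hyps by (simp add: mult_ac)
  qed
qed


section \<open>Sums over Maya diagrams\<close>

text \<open>The expanded form of the infinite product of \<open>1 + r s\<close> over all
  \<open>s\<close> outside \<open>A\<close>; in this form it is literally a sum over
  diagrams.\<close>

definition subset_sum :: "(int \<Rightarrow> 'a::{banach,real_normed_field}) \<Rightarrow> int set \<Rightarrow> 'a" where
  "subset_sum r A = (\<Sum>\<^sub>\<infinity>X | finite X \<and> X \<inter> A = {}. \<Prod>s\<in>X. r s)"

text \<open>Finite partial sums are bounded by a finite product of \<open>1 + norm (r s)\<close>,
  which is at most the exponential of the sum of all norms.\<close>

lemma finite_subset_products_summable:
  fixes r :: "int \<Rightarrow> 'a::{banach,real_normed_field}"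
  assumes r: "(\<lambda>s. norm (r s)) summable_on UNIV"
  shows "(\<lambda>X. norm (\<Prod>s\<in>X. r s)) summable_on {X. finite X}"
proof (rule nonneg_bdd_above_summable_on)
  show "bdd_above (sum (\<lambda>X. norm (\<Prod>s\<in>X. r s)) ` {F. F \<subseteq> {X. finite X} \<and> finite F})"
  proof (rule bdd_aboveI2)
    fix F assume "F \<in> {F. F \<subseteq> {X::int set. finite X} \<and> finite F}"
    hence F: "F \<subseteq> Pow (\<Union>F)" "finite (\<Union>F)" by auto
    have "(\<Sum>X\<in>F. norm (\<Prod>s\<in>X. r s)) \<le> (\<Sum>X\<in>Pow (\<Union>F). \<Prod>s\<in>X. norm (r s))"
      using F by (auto simp: prod_norm intro!: sum_mono2 prod_nonneg)
    also have "\<dots> = (\<Prod>s\<in>\<Union>F. norm (r s) + 1)"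
      using prod_add[OF F(2), of "\<lambda>s. norm (r s)" "\<lambda>_. 1"] by simp
    also have "\<dots> \<le> (\<Prod>s\<in>\<Union>F. exp (norm (r s)))"
      by (intro prod_mono) (auto simp: add.commute intro: exp_ge_add_one_self)
    also have "\<dots> = exp (\<Sum>s\<in>\<Union>F. norm (r s))" using F(2) by (simp add: exp_sum)
    also have "\<dots> \<le> exp (\<Sum>\<^sub>\<infinity>s. norm (r s))"
      using finite_sum_le_infsum[OF r F(2)] by simp
    finally show "(\<Sum>X\<in>F. norm (\<Prod>s\<in>X. r s)) \<le> exp (\<Sum>\<^sub>\<infinity>s. norm (r s))" .
  qed
qed auto

text \<open>
  The Maya diagram of \<open>X\<close> is the symmetric difference of \<open>X\<close> with the negative integers; the vacuum
  \<open>X = {}\<close> is the set of all negative integers.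
\<close>

definition maya_set :: "int set \<Rightarrow> int set" where
  "maya_set X = {s. s \<in> X \<longleftrightarrow> s \<ge> 0}"

text \<open>A nonnegative element of \<open>X\<close> is a particle and a negative one is a hole, so
  this is the number of particles minus that of holes.\<close>

definition charge :: "int set \<Rightarrow> int" where
  "charge X = (\<Sum>s\<in>X. if s \<ge> 0 then 1 else - 1)"

context
  fixes r :: "int \<Rightarrow> 'a::{banach,real_normed_field}"
  assumes r: "(\<lambda>s. norm (r s)) summable_on UNIV"
begin

lemma subset_products_summable:
  assumes "F \<subseteq> {X. finite X}"
  shows "(\<lambda>X. norm (\<Prod>s\<in>X. r s)) summable_on F" "(\<lambda>X. \<Prod>s\<in>X. r s) summable_on F"
  using summable_on_subset_banach[OF finite_subset_products_summable[OF r] assms]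
  by (auto intro: abs_summable_summable)

lemma subset_sum_insert:
  assumes "s \<notin> A"
  shows "subset_sum r A = (1 + r s) * subset_sum r (insert s A)"
proof -
  let ?F = "\<lambda>A. {X. finite X \<and> X \<inter> A = {}}"
  have eq: "?F A = ?F (insert s A) \<union> insert s ` ?F (insert s A)"
  proof (intro equalityI subsetI)
    fix X assume X: "X \<in> ?F A"
    show "X \<in> ?F (insert s A) \<union> insert s ` ?F (insert s A)"
    proof (cases "s \<in> X")
      case True
      hence "X = insert s (X - {s})" "X - {s} \<in> ?F (insert s A)" using X by auto
      thus ?thesis by blast
    qed (use X in auto)
  qed (use assms in auto)
  have inj: "inj_on (insert s) (?F (insert s A))"
    by (auto simp: inj_on_def)
  have "subset_sum r A = subset_sum r (insert s A) + (\<Sum>\<^sub>\<infinity>X\<in>insert s ` ?F (insert s A). \<Prod>s\<in>X. r s)"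
    unfolding subset_sum_def eq
    by (rule infsum_Un_disjoint) (auto intro!: subset_products_summable)
  also have "(\<Sum>\<^sub>\<infinity>X\<in>insert s ` ?F (insert s A). \<Prod>s\<in>X. r s) = (\<Sum>\<^sub>\<infinity>X\<in>?F (insert s A). r s * (\<Prod>s\<in>X. r s))"
    unfolding infsum_reindex[OF inj] o_def by (intro infsum_cong) auto
  also have "\<dots> = r s * subset_sum r (insert s A)"
    by (simp add: subset_sum_def infsum_cmult_right')
  finally show ?thesis by (simp add: algebra_simps)
qed

lemma subset_sum_union:
  assumes "finite B" "A \<inter> B = {}"
  shows "subset_sum r A = (\<Prod>s\<in>B. 1 + r s) * subset_sum r (A \<union> B)"
  using assms
proof (induction B rule: finite_induct)
  case (insert s B)
  hence "subset_sum r (A \<union> B) = (1 + r s) * subset_sum r (insert s (A \<union> B))"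
    by (intro subset_sum_insert) auto
  thus ?case using insert by (simp add: mult_ac)
qed simp

text \<open>Occupying all of \<open>J\<close> puts its nonnegative sites into \<open>X\<close> and
  keeps its negative sites out; the rest of \<open>X\<close> is an arbitrary finite set avoiding
  \<open>J\<close>.\<close>

lemma subset_sum_maya:
  assumes "finite J"
  shows "(\<Sum>\<^sub>\<infinity>X | finite X \<and> J \<subseteq> maya_set X. \<Prod>s\<in>X. r s) = (\<Prod>s\<in>{s\<in>J. s \<ge> 0}. r s) * subset_sum r J"
proof -
  let ?J = "{s\<in>J. s \<ge> 0}"
  let ?F = "{Y. finite Y \<and> Y \<inter> J = {}}"
  have fin: "finite ?J" using assms by simp
  have eq: "{X. finite X \<and> J \<subseteq> maya_set X} = (\<lambda>Y. ?J \<union> Y) ` ?F"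
  proof (intro equalityI subsetI)
    fix X assume X: "X \<in> {X. finite X \<and> J \<subseteq> maya_set X}"
    hence "X = ?J \<union> (X - J)" by (auto simp: maya_set_def)
    thus "X \<in> (\<lambda>Y. ?J \<union> Y) ` ?F" using X by blast
  qed (use assms in \<open>auto simp: maya_set_def\<close>)
  have inj: "inj_on (\<lambda>Y. ?J \<union> Y) ?F" by (auto simp: inj_on_def)
  have "(\<Sum>\<^sub>\<infinity>X | finite X \<and> J \<subseteq> maya_set X. \<Prod>s\<in>X. r s) = (\<Sum>\<^sub>\<infinity>Y\<in>?F. \<Prod>s\<in>?J \<union> Y. r s)"
    unfolding eq infsum_reindex[OF inj] o_def ..
  also have "\<dots> = (\<Sum>\<^sub>\<infinity>Y\<in>?F. (\<Prod>s\<in>?J. r s) * (\<Prod>s\<in>Y. r s))"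
    using fin by (intro infsum_cong prod.union_disjoint) auto
  also have "\<dots> = (\<Prod>s\<in>?J. r s) * subset_sum r J"
    unfolding subset_sum_def by (rule infsum_cmult_right')
  finally show ?thesis .
qed

text \<open>A finite set \<open>B\<close> of nonzero factors is split off so that the nonempty sets
  avoiding \<open>A\<close> and \<open>B\<close> contribute less than 1 in norm. The remaining sum
  is then at distance less than 1 from its term for the empty set, which is 1.\<close>

lemma subset_sum_nonzero:
  assumes A: "finite A" and nz: "\<And>s. s \<notin> A \<Longrightarrow> 1 + r s \<noteq> 0"
  shows "subset_sum r A \<noteq> 0"
proof -
  let ?f = "\<lambda>X. \<Prod>s\<in>X. r s"
  have s: "(\<lambda>X. norm (?f X)) summable_on {X. finite X}" by (rule finite_subset_products_summable[OF r])
  define S where "S = (\<Sum>\<^sub>\<infinity>X | finite X. norm (?f X))"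
  have "((\<lambda>F. \<Sum>X\<in>F. norm (?f X)) \<longlongrightarrow> S) (finite_subsets_at_top {X. finite X})"
    using has_sum_infsum[OF s] by (simp add: has_sum_def S_def)
  hence "\<forall>\<^sub>F F in finite_subsets_at_top {X. finite X}. S - 1 < (\<Sum>X\<in>F. norm (?f X))"
    by (rule order_tendstoD(1)) simp
  then obtain F where F': "finite F \<and> F \<subseteq> {X. finite X} \<and>
      (\<forall>F'. finite F' \<and> F \<subseteq> F' \<and> F' \<subseteq> {X. finite X} \<longrightarrow> S - 1 < (\<Sum>X\<in>F'. norm (?f X)))"
    unfolding eventually_finite_subsets_at_top ..
  note F = F'[THEN conjunct1] F'[THEN conjunct2, THEN conjunct1]
    F'[THEN conjunct2, THEN conjunct2, rule_format, OF conjI, OF _ conjI]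
  define F' where "F' = insert {} F"
  define B where "B = \<Union>F' - A"
  have F': "finite F'" "F \<subseteq> F'" "F' \<subseteq> {X. finite X}" "{} \<in> F'" using F by (auto simp: F'_def)
  have B: "finite B" using F' by (auto simp: B_def)
  let ?E = "{X. finite X \<and> X \<inter> (A \<union> B) = {}}"
  \<comment> \<open>A member of \<open>F'\<close> lies inside the union of \<open>A\<close> and
    \<open>B\<close>, so only the empty set can also avoid both.\<close>
  have "X \<notin> F'" if "X \<in> ?E - {{}}" for X
    using that by (auto simp: B_def)
  hence disj: "(?E - {{}}) \<inter> F' = {}" by blast
  have "(\<Sum>\<^sub>\<infinity>X\<in>?E - {{}}. norm (?f X)) + (\<Sum>X\<in>F'. norm (?f X)) = (\<Sum>\<^sub>\<infinity>X\<in>(?E - {{}}) \<union> F'. norm (?f X))"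
    using infsum_Un_disjoint[OF _ _ disj, of "\<lambda>X. norm (?f X)"] F'(1,3)
    by (simp add: subset_products_summable subset_iff)
  also have "\<dots> \<le> S"
    unfolding S_def using F'(3) by (intro infsum_mono2 subset_products_summable(1) s) auto
  finally have lt: "(\<Sum>\<^sub>\<infinity>X\<in>?E - {{}}. norm (?f X)) < 1" using F(3)[OF F'(1-3)] by simp
  have "subset_sum r (A \<union> B) = (\<Sum>\<^sub>\<infinity>X\<in>{{}} \<union> (?E - {{}}). ?f X)"
    unfolding subset_sum_def by (rule arg_cong[where f = "infsum _"]) auto
  also have "\<dots> = 1 + (\<Sum>\<^sub>\<infinity>X\<in>?E - {{}}. ?f X)"
    by (subst infsum_Un_disjoint) (auto intro!: subset_products_summable)
  finally have "subset_sum r (A \<union> B) = 1 + (\<Sum>\<^sub>\<infinity>X\<in>?E - {{}}. ?f X)" .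
  moreover have "norm (\<Sum>\<^sub>\<infinity>X\<in>?E - {{}}. ?f X) < 1"
  proof (rule order_le_less_trans[OF norm_infsum_bound lt])
    show "(\<lambda>X. norm (?f X)) summable_on ?E - {{}}" by (rule subset_products_summable(1)) auto
  qed
  ultimately have "subset_sum r (A \<union> B) \<noteq> 0"
    using add_eq_0_iff[of 1 "\<Sum>\<^sub>\<infinity>X\<in>?E - {{}}. ?f X"] by auto
  moreover have "(\<Prod>s\<in>B. 1 + r s) \<noteq> 0"
    unfolding prod_zero_iff[OF B] using nz by (auto simp: B_def)
  ultimately show ?thesis using subset_sum_union[OF B, of A] by (auto simp: B_def)
qed

lemma subset_sum_eq_zero:
  assumes "r 0 = - 1" "s \<noteq> 0"
  shows "subset_sum r {s} = 0"
  using subset_sum_insert[of 0 "{s}"] assms by simp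

text \<open>The charge is a sum of signs over the elements \<open>s\<close> of \<open>X\<close>.
  After exchanging the sums, the sets containing \<open>s\<close> contribute the sign times
  \<open>r s * subset_sum r {s}\<close>, which vanishes unless \<open>s = 0\<close> because the
  factor \<open>1 + r 0\<close> is zero. This plays the part of differentiating the product at a
  simple zero.\<close>

lemma subset_sum_charge:
  assumes r0: "r 0 = - 1"
  shows "((\<lambda>X. of_int (charge X) * (\<Prod>s\<in>X. r s)) has_sum - subset_sum r {0}) {X. finite X}"
proof -
  let ?sg = "\<lambda>s::int. if s \<ge> 0 then 1 else - 1 :: 'a"
  define g where "g = (\<lambda>(s::int, X). ?sg s * (\<Prod>s\<in>X. r s))"
  let ?B = "\<lambda>s. {X. finite X \<and> s \<in> X}"
  have B: "?B s = insert s ` {X. finite X \<and> X \<inter> {s} = {}}" for s :: int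
  proof (intro equalityI subsetI)
    fix X assume X: "X \<in> ?B s"
    hence "X = insert s (X - {s})" "X - {s} \<in> {X. finite X \<and> X \<inter> {s} = {}}" by auto
    thus "X \<in> insert s ` {X. finite X \<and> X \<inter> {s} = {}}" by blast
  qed auto
  have inj: "inj_on (insert s) {X. finite X \<and> X \<inter> {s} = {}}" for s :: int by (auto simp: inj_on_def)
  have B1: "(\<Sum>\<^sub>\<infinity>X\<in>?B s. h (\<Prod>s\<in>X. r s)) = (\<Sum>\<^sub>\<infinity>X | finite X \<and> X \<inter> {s} = {}. h (r s * (\<Prod>s\<in>X. r s)))" for s and h :: "'a \<Rightarrow> 'b :: {t2_space, comm_monoid_add}"
    unfolding B infsum_reindex[OF inj] o_def by (intro infsum_cong arg_cong[where f = h]) auto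
  define N where "N = (\<Sum>\<^sub>\<infinity>X | finite X. norm (\<Prod>s\<in>X. r s))"
  have "g summable_on (SIGMA s:UNIV. ?B s)"
  proof (rule abs_summable_summable, subst Infinite_Sum.abs_summable_on_Sigma_iff, intro conjI ballI)
    show "(\<lambda>y. norm (g (s, y))) summable_on ?B s" for s
      using subset_products_summable(1)[of "?B s"] by (auto simp: g_def norm_mult)
    show "(\<lambda>x. norm (\<Sum>\<^sub>\<infinity>y\<in>?B x. norm (g (x, y)))) summable_on UNIV"
    proof (rule summable_on_comparison_test)
      show "(\<lambda>s. norm (r s) * N) summable_on UNIV" using r by (rule summable_on_cmult_left)
      fix s :: int
      have "(\<Sum>\<^sub>\<infinity>y\<in>?B s. norm (g (s, y))) = (\<Sum>\<^sub>\<infinity>X\<in>?B s. norm (\<Prod>s\<in>X. r s))"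
        by (intro infsum_cong) (auto simp: g_def norm_mult)
      also have "\<dots> = norm (r s) * (\<Sum>\<^sub>\<infinity>X | finite X \<and> X \<inter> {s} = {}. norm (\<Prod>s\<in>X. r s))"
        unfolding B1[of norm] norm_mult by (rule infsum_cmult_right')
      also have "\<dots> \<le> norm (r s) * N"
        unfolding N_def by (intro mult_left_mono infsum_mono2 subset_products_summable) auto
      finally show "norm (\<Sum>\<^sub>\<infinity>y\<in>?B s. norm (g (s, y))) \<le> norm (r s) * N"
        by (simp add: infsum_nonneg)
    qed auto
  qed
  note sg = this
  have gs: "(g has_sum (\<Sum>\<^sub>\<infinity>s. \<Sum>\<^sub>\<infinity>X\<in>?B s. g (s, X))) (SIGMA s:UNIV. ?B s)"
    unfolding infsum_Sigma_banach[OF sg] by (rule has_sum_infsum[OF sg])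
  have inner: "(\<Sum>\<^sub>\<infinity>X\<in>?B s. g (s, X)) = (if s = 0 then - subset_sum r {0} else 0)" for s
  proof -
    have "(\<Sum>\<^sub>\<infinity>X\<in>?B s. g (s, X)) = (\<Sum>\<^sub>\<infinity>X | finite X \<and> X \<inter> {s} = {}. ?sg s * (r s * (\<Prod>s\<in>X. r s)))"
      using B1[of "\<lambda>x. ?sg s * x" s] by (simp only: g_def prod.case)
    also have "\<dots> = ?sg s * (r s * subset_sum r {s})" by (simp add: infsum_cmult_right' subset_sum_def del: Int_insert_right)
    finally show ?thesis using subset_sum_eq_zero[OF r0] r0 by auto
  qed
  have "(\<Sum>\<^sub>\<infinity>s. \<Sum>\<^sub>\<infinity>X\<in>?B s. g (s, X)) = (\<Sum>\<^sub>\<infinity>s\<in>{0::int}. - subset_sum r {0})"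
    unfolding inner by (rule infsum_cong_neutral) auto
  with gs have g: "(g has_sum - subset_sum r {0}) (SIGMA s:UNIV. ?B s)" by simp
  have bij: "bij_betw (\<lambda>(X, s). (s, X)) (SIGMA X:{X. finite X}. X) (SIGMA s:UNIV. ?B s)"
    by (rule bij_betwI[of _ _ _ "\<lambda>(s, X). (X, s)"]) auto
  have "((\<lambda>(X, s). g (s, X)) has_sum - subset_sum r {0}) (SIGMA X:{X. finite X}. X)"
    using has_sum_reindex_bij_betw[OF bij, of g] g by (simp add: case_prod_unfold)
  from this show ?thesis
  proof (rule has_sum_SigmaD)
    fix X :: "int set" assume X: "X \<in> {X. finite X}"
    have "((\<lambda>s. g (s, X)) has_sum (\<Sum>s\<in>X. g (s, X))) X" using X by (intro has_sum_finite) auto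
    also have "(\<Sum>s\<in>X. g (s, X)) = of_int (charge X) * (\<Prod>s\<in>X. r s)"
      by (simp add: g_def charge_def sum_distrib_right if_distrib cong: if_cong)
    finally show "((\<lambda>y. case (X, y) of (X, s) \<Rightarrow> g (s, X)) has_sum of_int (charge X) * (\<Prod>s\<in>X. r s)) X" by simp
  qed
qed

end


section \<open>Maya diagrams and partitions\<close>

text \<open>Site \<open>s\<close> stands for the half-integer s + 1/2, so at charge 0 the exponents
  in \<open>partition_exp\<close> are these sites shifted by 1/2. Charge \<open>N\<close> translates
  all sites by \<open>N\<close>.\<close>

definition maya_seq :: "int \<Rightarrow> (nat \<Rightarrow> nat) \<Rightarrow> nat \<Rightarrow> int" where
  "maya_seq N lam k = int (lam k) - int k - 1 + N"

definition maya_code :: "int \<times> (nat \<Rightarrow> nat) \<Rightarrow> int set" where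
  "maya_code = (\<lambda>(N, lam). maya_set (range (maya_seq N lam)))"

lemma maya_set_involution [simp]: "maya_set (maya_set X) = X"
  by (auto simp: maya_set_def)

lemma maya_seq_less:
  assumes "lam \<in> int_partitions" "i < j"
  shows "maya_seq N lam j < maya_seq N lam i"
proof -
  have "lam j \<le> lam i" using assms by (auto simp: int_partitions_def antimono_def)
  thus ?thesis using assms by (simp add: maya_seq_def)
qed

lemma maya_seq_inj:
  assumes "lam \<in> int_partitions"
  shows "inj (maya_seq N lam)"
  by (rule injI) (metis assms less_irrefl linorder_neqE_nat maya_seq_less)

lemma int_partition_bound:
  assumes "lam \<in> int_partitions"
  obtains K where "\<And>k. K \<le> k \<Longrightarrow> lam k = 0"
proof -
  from assms have "finite {k. lam k \<noteq> 0}" by (simp add: int_partitions_def)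
  then obtain K where "\<forall>k\<in>{k. lam k \<noteq> 0}. k < K" using finite_nat_set_iff_bounded by blast
  thus ?thesis using that[of K] by force
qed

text \<open>Both the charge and the energy of a diagram are signed sums over its code, computed here from a cutoff \<open>K\<close>.\<close>

lemma maya_code_sum:
  fixes g :: "int \<Rightarrow> int"
  assumes lam: "lam \<in> int_partitions" and K: "\<And>k. K \<le> k \<Longrightarrow> lam k = 0" "N \<le> int K"
  shows "finite (maya_code (N, lam))"
    and "(\<Sum>s\<in>maya_code (N, lam). if s \<ge> 0 then g s else - g s) =
      (\<Sum>k<K. g (maya_seq N lam k)) - (\<Sum>s\<in>{N - int K..<0}. g s)"
proof -
  define e where "e = maya_seq N lam"
  define S where "S = range e"
  define A where "A = e ` {..<K}"
  define B where "B = {N - int K..<0}"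
  define X where "X = maya_code (N, lam)"
  have X: "X = maya_set S" by (simp add: X_def maya_code_def S_def e_def)
  have eK: "e k = N - int k - 1" if "K \<le> k" for k using K(1)[OF that] by (simp add: e_def maya_seq_def)
  have ge: "e k \<ge> N - int K" if "k < K" for k using that by (simp add: e_def maya_seq_def)
  \<comment> \<open>Beyond the cutoff the parts vanish, and the sequence runs through every integer
    below \<open>N - int K\<close>.\<close>
  have S: "S = A \<union> {..<N - int K}"
  proof (intro equalityI subsetI)
    fix s assume "s \<in> S"
    then obtain k where "s = e k" by (auto simp: S_def)
    thus "s \<in> A \<union> {..<N - int K}" by (cases "k < K") (auto simp: A_def eK)
  next
    fix s assume "s \<in> A \<union> {..<N - int K}"
    thus "s \<in> S"
    proof
      assume "s \<in> {..<N - int K}"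
      hence "s = e (nat (N - 1 - s))" by (subst eK) auto
      thus ?thesis by (auto simp: S_def)
    qed (auto simp: A_def S_def)
  qed
  have A: "finite A" "A \<subseteq> {N - int K..}" using ge by (auto simp: A_def)
  \<comment> \<open>Particles are the nonnegative values; holes are the missing negative sites, all
    of them at or above the cutoff.\<close>
  have X': "X = {s\<in>A. s \<ge> 0} \<union> (B - A)"
    unfolding X maya_set_def S B_def using K(2) A(2) by auto
  show "finite (maya_code (N, lam))" using A(1) by (simp add: X_def[symmetric] X' B_def)
  have inj: "inj_on e {..<K}" using maya_seq_inj[OF lam] by (auto simp: e_def inj_on_def)
  have "(\<Sum>s\<in>X. if s \<ge> 0 then g s else - g s) = (\<Sum>s\<in>{s\<in>A. s \<ge> 0}. g s) + (\<Sum>s\<in>B - A. - g s)"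
    unfolding X' using A(1) by (subst sum.union_disjoint) (auto simp: B_def intro!: arg_cong2[where f = "(+)"] sum.cong)
  also have "(\<Sum>s\<in>B - A. - g s) = (\<Sum>s\<in>A \<inter> B. g s) - (\<Sum>s\<in>B. g s)"
    using sum.Int_Diff[of B g A] by (simp add: sum_negf B_def Int_commute)
  also have "(\<Sum>s\<in>{s\<in>A. s \<ge> 0}. g s) + ((\<Sum>s\<in>A \<inter> B. g s) - (\<Sum>s\<in>B. g s)) = (\<Sum>s\<in>A. g s) - (\<Sum>s\<in>B. g s)"
  proof -
    have A': "A = {s\<in>A. s \<ge> 0} \<union> (A \<inter> B)" using A(2) by (auto simp: B_def)
    have "(\<Sum>s\<in>{s\<in>A. s \<ge> 0} \<union> (A \<inter> B). g s) = (\<Sum>s\<in>{s\<in>A. s \<ge> 0}. g s) + (\<Sum>s\<in>A \<inter> B. g s)"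
      using A(1) by (intro sum.union_disjoint) (auto simp: B_def)
    hence "(\<Sum>s\<in>A. g s) = (\<Sum>s\<in>{s\<in>A. s \<ge> 0}. g s) + (\<Sum>s\<in>A \<inter> B. g s)"
      unfolding A'[symmetric] .
    thus ?thesis by simp
  qed
  also have "(\<Sum>s\<in>A. g s) = (\<Sum>k<K. g (e k))"
    unfolding A_def by (simp add: sum.reindex[OF inj])
  finally show "(\<Sum>s\<in>maya_code (N, lam). if s \<ge> 0 then g s else - g s) =
      (\<Sum>k<K. g (maya_seq N lam k)) - (\<Sum>s\<in>{N - int K..<0}. g s)"
    by (simp add: X_def B_def e_def)
qed

lemma maya_code_charge:
  assumes "lam \<in> int_partitions"
  shows "charge (maya_code (N, lam)) = N"
proof -
  obtain K where K: "\<And>k. K \<le> k \<Longrightarrow> lam k = 0" using int_partition_bound[OF assms] by blast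
  define K' where "K' = max K (nat N)"
  have "nat N \<le> K'" by (simp add: K'_def)
  hence N: "N \<le> int K'" by linarith
  have "charge (maya_code (N, lam)) = (\<Sum>k<K'. 1) - (\<Sum>s\<in>{N - int K'..<0}. 1)"
    unfolding charge_def using maya_code_sum(2)[OF assms, of K' N "\<lambda>_. 1"] K N by (simp add: K'_def)
  thus ?thesis using N by simp
qed

text \<open>A site has energy \<open>s\<close> rather than s + 1/2; hence the ground state of charge
  \<open>N\<close> has energy N (N - 1) / 2 and not N^2 / 2.\<close>

definition energy :: "int set \<Rightarrow> int" where
  "energy X = (\<Sum>s\<in>X. if s \<ge> 0 then s else - s)"

lemma sum_negative_ints: "2 * (\<Sum>s\<in>{- int M..<0}. s) = - (int M * (int M + 1))"
proof (induction M)
  case (Suc M)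
  have "{- int (Suc M)..<0} = insert (- int (Suc M)) {- int M..<0}" by auto
  thus ?case using Suc by (simp add: algebra_simps)
qed simp

lemma maya_code_energy:
  assumes "lam \<in> int_partitions"
  shows "energy (maya_code (N, lam)) = int (partition_size lam) + N * (N - 1) div 2"
proof -
  obtain K0 where K0: "\<And>k. K0 \<le> k \<Longrightarrow> lam k = 0" using int_partition_bound[OF assms] by blast
  define K where "K = max K0 (nat N)"
  have "nat N \<le> K" by (simp add: K_def)
  hence K: "\<And>k. K \<le> k \<Longrightarrow> lam k = 0" "N \<le> int K" using K0 by (auto simp: K_def)
  define M where "M = nat (int K - N)"
  have M: "int K - N = int M" using K(2) by (simp add: M_def)
  have size: "int (partition_size lam) = (\<Sum>k<K. int (lam k))"
  proof -
    have "k < K" if "lam k \<noteq> 0" for k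
      by (rule ccontr) (use K(1)[of k] that in simp)
    hence "partition_size lam = (\<Sum>k<K. lam k)"
      unfolding partition_size_def by (intro sum.mono_neutral_left) auto
    thus ?thesis by simp
  qed
  have gauss: "2 * (\<Sum>k<K. int k) = int K * (int K - 1)"
    by (induction K) (auto simp: algebra_simps)
  have "energy (maya_code (N, lam)) = (\<Sum>k<K. maya_seq N lam k) - (\<Sum>s\<in>{N - int K..<0}. s)"
    unfolding energy_def by (rule maya_code_sum(2)[OF assms K, of "\<lambda>s. s"])
  also have "(\<Sum>k<K. maya_seq N lam k) = int (partition_size lam) - (\<Sum>k<K. int k) + int K * (N - 1)"
    by (simp add: maya_seq_def sum.distrib sum_subtractf size algebra_simps)
  finally have "2 * energy (maya_code (N, lam)) =
      2 * int (partition_size lam) - 2 * (\<Sum>k<K. int k) + 2 * int K * (N - 1) - 2 * (\<Sum>s\<in>{N - int K..<0}. s)"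
    by (simp add: algebra_simps)
  also have "N - int K = - int M" using M by simp
  also have "2 * (\<Sum>s\<in>{- int M..<0}. s) = - (int M * (int M + 1))" by (rule sum_negative_ints)
  also have "2 * int (partition_size lam) - 2 * (\<Sum>k<K. int k) + 2 * int K * (N - 1) - - (int M * (int M + 1)) =
      2 * int (partition_size lam) + N * (N - 1)"
    unfolding gauss M[symmetric] by algebra
  finally show ?thesis by presburger
qed

text \<open>By induction \<open>e k\<close> cannot equal an earlier value of \<open>e'\<close>, so
  it is attained there at or after \<open>k\<close>, and conversely.\<close>

lemma strict_dec_range_unique:
  fixes e e' :: "nat \<Rightarrow> int"
  assumes "\<And>i j. i < j \<Longrightarrow> e j < e i" "\<And>i j. i < j \<Longrightarrow> e' j < e' i" "range e = range e'"
  shows "e k = e' k"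
proof (induction k rule: less_induct)
  case (less k)
  obtain j where j: "e k = e' j" using assms(3) by (metis rangeE rangeI)
  obtain l where l: "e' k = e l" using assms(3) by (metis rangeE rangeI)
  have "\<not> j < k" using less j assms(1) by (metis less_irrefl)
  moreover have "\<not> l < k" using less l assms(2) by (metis less_irrefl)
  ultimately have "e k \<le> e' k" "e' k \<le> e k"
    using j l assms(1,2) by (metis less_le_not_le linorder_neqE_nat order.refl)+
  thus ?case by simp
qed

lemma maya_code_inj: "inj_on maya_code (UNIV \<times> int_partitions)"
proof (rule inj_onI, clarify)
  fix N lam N' lam' assume l: "lam \<in> int_partitions" "lam' \<in> int_partitions"
    and eq: "maya_code (N, lam) = maya_code (N', lam')"
  have N: "N = N'" using maya_code_charge[OF l(1), of N] maya_code_charge[OF l(2), of N'] eq by simp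
  from eq have "range (maya_seq N lam) = range (maya_seq N' lam')"
    unfolding maya_code_def prod.case by (metis maya_set_involution)
  hence "maya_seq N lam k = maya_seq N' lam' k" for k
    using maya_seq_less l by (intro strict_dec_range_unique) auto
  hence "lam k = lam' k" for k using N by (simp add: maya_seq_def)
  thus "N = N' \<and> lam = lam'" using N by auto
qed

lemma maya_code_surj:
  assumes "finite X"
  obtains N lam where "lam \<in> int_partitions" "maya_code (N, lam) = X"
proof -
  define S where "S = maya_set X"
  obtain b where b: "\<And>s. s \<in> X \<Longrightarrow> \<bar>s\<bar> < int b"
  proof -
    define b where "b = nat (\<Sum>s\<in>X. \<bar>s\<bar>) + 1"
    have "\<bar>s\<bar> < int b" if "s \<in> X" for s
      using member_le_sum[OF that, of "\<lambda>s. \<bar>s\<bar>"] assms by (simp add: b_def)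
    thus ?thesis using that by blast
  qed
  have Sb: "s < int b" if "s \<in> S" for s using that b[of s] by (cases "s \<in> X") (auto simp: S_def maya_set_def)
  have Sl: "s \<in> S" if "s < - int b" for s using that b[of s] by (cases "s \<in> X") (auto simp: S_def maya_set_def)
  \<comment> \<open>Reflection at the upper bound turns the decreasing enumeration of the diagram
    into the increasing \<open>enumerate\<close> of a set of naturals.\<close>
  define T where "T = {n. int b - 1 - int n \<in> S}"
  have Tl: "n \<in> T" if "n > 2 * b" for n using that by (auto simp: T_def intro!: Sl)
  have T: "infinite T"
    unfolding infinite_nat_iff_unbounded using Tl by (meson less_max_iff_disj max.strict_coboundedI1 lessI max.strict_coboundedI2)
  define en where "en = enumerate T"
  define e where "e = (\<lambda>k. int b - 1 - int (en k))"
  have en_less: "en i < en j" if "i < j" for i j unfolding en_def using enumerate_mono[OF that T] .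
  have range_e: "range e = S"
  proof (intro equalityI subsetI)
    fix s assume "s \<in> range e"
    thus "s \<in> S" using enumerate_in_set[OF T] by (auto simp: e_def en_def T_def)
  next
    fix s assume s: "s \<in> S"
    hence "nat (int b - 1 - s) \<in> T" using Sb[OF s] by (simp add: T_def)
    then obtain k where "en k = nat (int b - 1 - s)" using enumerate_Ex[OF T] unfolding en_def by blast
    hence "e k = s" using Sb[OF s] by (simp add: e_def)
    thus "s \<in> range e" by blast
  qed
  have step: "en (Suc k) = Suc (en k)" if "en k > 2 * b" for k
  proof -
    have "Suc (en k) \<in> T" using that by (intro Tl) simp
    then obtain j where j: "en j = Suc (en k)" using enumerate_Ex[OF T] unfolding en_def by blast
    have "k < j" using j en_less[of j k] by (metis lessI less_asym linorder_neqE_nat n_not_Suc_n)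
    hence "en (Suc k) \<le> en j" using en_less[of "Suc k" j] by (cases "Suc k = j") auto
    thus ?thesis using j en_less[of k "Suc k"] by simp
  qed
  define k0 where "k0 = Suc (2 * b)"
  have k0: "en k > 2 * b" if "k \<ge> k0" for k
    using le_enumerate[OF T, of k] that by (simp add: en_def k0_def)
  \<comment> \<open>This sequence is weakly decreasing and eventually constant: its final value is
    the charge, and its excess over that value is the partition.\<close>
  define d where "d = (\<lambda>k. e k + int k + 1)"
  have d_mono: "d (Suc k) \<le> d k" for k using en_less[of k "Suc k"] by (simp add: d_def e_def)
  have d_const: "d k = d k0" if "k \<ge> k0" for k
    using that by (induction k rule: dec_induct) (auto simp: d_def e_def step k0)
  have d_anti: "d j \<le> d i" if "i \<le> j" for i j
    using lift_Suc_antimono_le[of d, OF d_mono that] .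
  have d_ge: "d k \<ge> d k0" for k
    using d_const[of k] d_anti[of k k0] by (cases "k \<ge> k0") auto
  define lam where "lam = (\<lambda>k. nat (d k - d k0))"
  have "lam \<in> int_partitions"
  proof -
    have "antimono lam" by (intro antimonoI) (auto simp: lam_def d_anti intro!: nat_mono)
    moreover have "{k. lam k \<noteq> 0} \<subseteq> {..<k0}"
    proof
      fix k assume "k \<in> {k. lam k \<noteq> 0}"
      thus "k \<in> {..<k0}" using d_const[of k] by (cases "k \<ge> k0") (auto simp: lam_def)
    qed
    ultimately show ?thesis by (auto simp: int_partitions_def intro: finite_subset)
  qed
  moreover have "maya_seq (d k0) lam = e"
    using d_ge by (auto simp: fun_eq_iff maya_seq_def lam_def d_def)
  hence "maya_code (d k0, lam) = X" by (simp add: maya_code_def range_e S_def)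
  ultimately show ?thesis by (rule that)
qed

lemma bij_betw_maya_code: "bij_betw maya_code (UNIV \<times> int_partitions) {X. finite X}"
  unfolding bij_betw_def
proof (intro conjI maya_code_inj equalityI subsetI)
  fix X assume "X \<in> maya_code ` (UNIV \<times> int_partitions)"
  then obtain N lam where l: "lam \<in> int_partitions" "X = maya_code (N, lam)" by auto
  obtain K0 where K0: "\<And>k. K0 \<le> k \<Longrightarrow> lam k = 0" using int_partition_bound[OF l(1)] by blast
  have "finite (maya_code (N, lam))"
    by (rule maya_code_sum(1)[OF l(1), of "max K0 (nat N)"]) (use K0 in \<open>auto simp: of_nat_max\<close>)
  thus "X \<in> {X. finite X}" using l by simp
next
  fix X :: "int set" assume "X \<in> {X. finite X}"
  hence "finite X" by simp
  then obtain N lam where "lam \<in> int_partitions" "maya_code (N, lam) = X" by (rule maya_code_surj)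
  thus "X \<in> maya_code ` (UNIV \<times> int_partitions)" by force
qed


section \<open>Cycle expansions\<close>

lemma abs_summable_prod_PiE:
  fixes f :: "'a \<Rightarrow> 'b \<Rightarrow> complex"
  assumes "finite A" "\<And>x. x \<in> A \<Longrightarrow> (\<lambda>y. norm (f x y)) summable_on B x"
  shows "(\<lambda>g. norm (\<Prod>x\<in>A. f x (g x))) summable_on (PiE A B)"
  using assms
proof (induction A rule: finite_induct)
    case empty
    show ?case by simp
  next
    case (insert x A)
    have 1: "(\<lambda>g. norm (\<Prod>x\<in>A. f x (g x))) summable_on PiE A B" using insert by auto
    have 2: "(\<lambda>y. norm (f x y)) summable_on B x" using insert by auto
    have "(\<lambda>p. norm (f x (fst p) * (\<Prod>x\<in>A. f x (snd p x)))) summable_on (B x \<times> PiE A B)"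
      unfolding Infinite_Sum.abs_summable_on_Sigma_iff
      using 1 2 by (auto simp: norm_mult infsum_cmult_right' infsum_nonneg intro!: summable_on_cmult_right summable_on_cmult_left)
    moreover have "bij_betw (\<lambda>(y, g). g(x := y)) (B x \<times> PiE A B) (PiE (insert x A) B)"
      unfolding bij_betw_def using insert.hyps by (auto simp: inj_combinator PiE_insert_eq)
    moreover have "norm (\<Prod>i\<in>insert x A. f i (((\<lambda>(y, g). g(x := y)) p) i)) = norm (f x (fst p) * (\<Prod>x\<in>A. f x (snd p x)))" for p
      using insert.hyps by (cases p) (auto intro!: arg_cong[where f = norm] arg_cong2[where f = "(*)"] prod.cong)
    ultimately show ?case
      using summable_on_reindex_bij_betw[of "\<lambda>(y, g). g(x := y)" "B x \<times> PiE A B" "PiE (insert x A) B" "\<lambda>g. norm (\<Prod>i\<in>insert x A. f i (g i))"] by simp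
qed

lemma has_sum_finite_sum:
  fixes f :: "'i \<Rightarrow> 'a \<Rightarrow> 'b :: topological_comm_monoid_add"
  assumes "\<And>i. i \<in> I \<Longrightarrow> (f i has_sum S i) A"
  shows "((\<lambda>x. \<Sum>i\<in>I. f i x) has_sum (\<Sum>i\<in>I. S i)) A"
  using assms
  by (induction I rule: infinite_finite_induct) (auto intro: has_sum_add)

section \<open>Sums over functions constant on the cycles of a permutation\<close>

definition cycles_of :: "('n \<Rightarrow> 'n) \<Rightarrow> 'n set set" where
  "cycles_of \<sigma> = range (orbit \<sigma>)"

text \<open>An orbit is generated from \<open>\<sigma> i\<close>; the point \<open>i\<close> itself
  returns because the index type is finite.\<close>

lemma orbit_refl:
  fixes \<sigma> :: "'n::finite \<Rightarrow> 'n"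
  assumes "\<sigma> permutes UNIV"
  shows "i \<in> orbit \<sigma> i"
  by (rule permutation_self_in_orbit) (use assms in \<open>auto simp: permutation_permutes\<close>)

lemma orbit_eq_of_mem:
  fixes \<sigma> :: "'n::finite \<Rightarrow> 'n"
  assumes "\<sigma> permutes UNIV" "j \<in> orbit \<sigma> i"
  shows "orbit \<sigma> j = orbit \<sigma> i"
  using orbit_cyclic_eq3 assms orbit_refl[OF assms(1)] cyclic_on_orbit
  by (metis permutation_permutes finite)

lemma cycles_of_partition:
  fixes \<sigma> :: "'n::finite \<Rightarrow> 'n"
  assumes "\<sigma> permutes UNIV"
  shows "(\<Prod>i\<in>UNIV. g i) = (\<Prod>C\<in>cycles_of \<sigma>. \<Prod>i\<in>C. g i :: 'a::comm_monoid_mult)"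
proof -
  have "\<Union>(cycles_of \<sigma>) = UNIV" using orbit_refl[OF assms] by (auto simp: cycles_of_def)
  moreover have "C \<inter> D = {}" if "C \<in> cycles_of \<sigma>" "D \<in> cycles_of \<sigma>" "C \<noteq> D" for C D
    using that orbit_eq_of_mem[OF assms] unfolding cycles_of_def by blast
  ultimately show ?thesis using prod.Union_disjoint[of "cycles_of \<sigma>" g] by (simp add: cycles_of_def)
qed

lemma constant_on_orbit:
  assumes "m \<circ> \<sigma> = m" "j \<in> orbit \<sigma> i"
  shows "m j = m i"
  using assms(2)
proof induction
  case base
  show ?case using assms(1) by (metis comp_apply)
next
  case (step b)
  thus ?case using assms(1) by (metis comp_apply)
qed

text \<open>Functions invariant under \<open>\<sigma>\<close> are the functions on its set of cycles.\<close>

lemma invariant_functions_sum: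
  fixes f :: "'n::finite \<Rightarrow> 'k \<Rightarrow> complex"
  assumes \<sigma>: "\<sigma> permutes UNIV"
    and s: "\<And>C. C \<in> cycles_of \<sigma> \<Longrightarrow> (\<lambda>k. norm (\<Prod>i\<in>C. f i k)) summable_on UNIV"
  shows "(\<lambda>m. norm (\<Prod>i\<in>UNIV. f i (m i))) summable_on {m. m \<circ> \<sigma> = m}"
    and "(\<Sum>\<^sub>\<infinity>m | m \<circ> \<sigma> = m. \<Prod>i\<in>UNIV. f i (m i)) = (\<Prod>C\<in>cycles_of \<sigma>. \<Sum>\<^sub>\<infinity>k. \<Prod>i\<in>C. f i k)"
proof -
  let ?P = "PiE (cycles_of \<sigma>) (\<lambda>_. UNIV :: 'k set)"
  let ?h = "\<lambda>(g :: 'n set \<Rightarrow> 'k) i. g (orbit \<sigma> i)"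
  have fin: "finite (cycles_of \<sigma>)" by (simp add: cycles_of_def)
  have orb: "orbit \<sigma> i \<in> cycles_of \<sigma>" for i by (simp add: cycles_of_def)
  have rep: "\<exists>i. C = orbit \<sigma> i" if "C \<in> cycles_of \<sigma>" for C using that by (auto simp: cycles_of_def)
  have orb\<sigma>: "orbit \<sigma> (\<sigma> i) = orbit \<sigma> i" for i
    using orbit_eq_of_mem[OF \<sigma>] orbit.base by metis
  have bij: "bij_betw ?h ?P {m. m \<circ> \<sigma> = m}"
  proof (rule bij_betw_imageI)
    show "inj_on ?h ?P"
    proof (rule inj_onI)
      fix g g' assume g: "g \<in> ?P" "g' \<in> ?P" and eq: "?h g = ?h g'"
      show "g = g'"
      proof (rule PiE_ext[OF g])
        fix C assume "C \<in> cycles_of \<sigma>"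
        then obtain i where "C = orbit \<sigma> i" using rep by blast
        thus "g C = g' C" using fun_cong[OF eq, of i] by simp
      qed
    qed
    show "?h ` ?P = {m. m \<circ> \<sigma> = m}"
    proof (intro equalityI subsetI)
      fix m assume "m \<in> ?h ` ?P"
      thus "m \<in> {m. m \<circ> \<sigma> = m}" by (auto simp: fun_eq_iff orb\<sigma>)
    next
      fix m :: "'n \<Rightarrow> 'k" assume m: "m \<in> {m. m \<circ> \<sigma> = m}"
      \<comment> \<open>Any representative of the cycle may be chosen, as \<open>m\<close> is
        constant on it.\<close>
      define g where "g = (\<lambda>C\<in>cycles_of \<sigma>. m (SOME i. i \<in> C))"
      have "?h g = m"
      proof
        fix i
        have "(SOME j. j \<in> orbit \<sigma> i) \<in> orbit \<sigma> i" using orbit_refl[OF \<sigma>] by (rule someI)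
        hence "m (SOME j. j \<in> orbit \<sigma> i) = m i" using m by (intro constant_on_orbit) auto
        thus "?h g i = m i" using orb by (simp add: g_def)
      qed
      moreover have "g \<in> ?P" by (auto simp: g_def)
      ultimately show "m \<in> ?h ` ?P" by (metis imageI)
    qed
  qed
  have eq: "(\<Prod>i\<in>UNIV. f i (?h g i)) = (\<Prod>C\<in>cycles_of \<sigma>. \<Prod>i\<in>C. f i (g C))" for g
    unfolding cycles_of_partition[OF \<sigma>]
  proof (intro prod.cong refl)
    fix C i assume C: "C \<in> cycles_of \<sigma>" "i \<in> C"
    then obtain j where j: "C = orbit \<sigma> j" using rep by blast
    hence "orbit \<sigma> i = C" using orbit_eq_of_mem[OF \<sigma>, of i j] C by simp
    thus "f i (?h g i) = f i (g C)" by simp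
  qed
  have "(\<lambda>g. norm (\<Prod>i\<in>UNIV. f i (?h g i))) summable_on ?P"
    unfolding eq by (rule abs_summable_prod_PiE[OF fin s])
  thus "(\<lambda>m. norm (\<Prod>i\<in>UNIV. f i (m i))) summable_on {m. m \<circ> \<sigma> = m}"
    using summable_on_reindex_bij_betw[OF bij, of "\<lambda>m. norm (\<Prod>i\<in>UNIV. f i (m i))"] by simp
  have "(\<Sum>\<^sub>\<infinity>m | m \<circ> \<sigma> = m. \<Prod>i\<in>UNIV. f i (m i)) = (\<Sum>\<^sub>\<infinity>g\<in>?P. \<Prod>C\<in>cycles_of \<sigma>. \<Prod>i\<in>C. f i (g C))"
    using infsum_reindex_bij_betw[OF bij, of "\<lambda>m. \<Prod>i\<in>UNIV. f i (m i)"] unfolding eq by simp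
  also have "\<dots> = (\<Prod>C\<in>cycles_of \<sigma>. \<Sum>\<^sub>\<infinity>k. \<Prod>i\<in>C. f i k)"
    by (rule infsum_prod_PiE_abs[OF fin s])
  finally show "(\<Sum>\<^sub>\<infinity>m | m \<circ> \<sigma> = m. \<Prod>i\<in>UNIV. f i (m i)) = (\<Prod>C\<in>cycles_of \<sigma>. \<Sum>\<^sub>\<infinity>k. \<Prod>i\<in>C. f i k)" .
qed

text \<open>At \<open>p = occupation \<tau> c\<close> the two cases are the Laurent coefficients of
  the Kronecker function in the two strips; the diagonal is counted with the upper triangle.\<close>

definition order_weight :: "(int \<Rightarrow> complex) \<Rightarrow> 'n::linorder \<Rightarrow> 'n \<Rightarrow> int \<Rightarrow> complex" where
  "order_weight p i j k = (if i \<le> j then p k else p k - 1)"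

lemma order_weight_levels:
  fixes m :: "'n::{finite,linorder} \<Rightarrow> int"
  shows "(\<Sum>\<sigma> | \<sigma> permutes UNIV \<and> m \<circ> \<sigma> = m. of_int (sign \<sigma>) * (\<Prod>i\<in>UNIV. order_weight p i (\<sigma> i) (m i)))
    = (\<Prod>s\<in>range m. p s)"
proof -
  define B :: "((complex, 'n) vec, 'n) vec" where
    "B = (\<chi> i j::'n. if m i = m j then if i \<le> j then p (m i) else p (m i) - 1 else 0)"
  have "det B = (\<Sum>\<sigma> | \<sigma> permutes UNIV. of_int (sign \<sigma>) * (\<Prod>i\<in>UNIV. B $ i $ \<sigma> i))" by (simp add: det_def)
  also have "\<dots> = (\<Sum>\<sigma> | \<sigma> permutes UNIV \<and> m \<circ> \<sigma> = m. of_int (sign \<sigma>) * (\<Prod>i\<in>UNIV. order_weight p i (\<sigma> i) (m i)))"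
  proof (rule sum.mono_neutral_cong_right)
    show "\<forall>\<sigma>\<in>{\<sigma>. \<sigma> permutes UNIV} - {\<sigma>. \<sigma> permutes UNIV \<and> m \<circ> \<sigma> = m}. of_int (sign \<sigma>) * (\<Prod>i\<in>UNIV. B $ i $ \<sigma> i) = 0"
    proof
      fix \<sigma> assume "\<sigma> \<in> {\<sigma>. \<sigma> permutes UNIV} - {\<sigma>. \<sigma> permutes UNIV \<and> m \<circ> \<sigma> = m}"
      then obtain i where "m (\<sigma> i) \<noteq> m i" by (auto simp: fun_eq_iff)
      hence "B $ i $ \<sigma> i = 0" by (simp add: B_def)
      hence "(\<Prod>i\<in>UNIV. B $ i $ \<sigma> i) = 0" by (intro prod_zero) (simp_all, rule exI)
      thus "of_int (sign \<sigma>) * (\<Prod>i\<in>UNIV. B $ i $ \<sigma> i) = 0" by simp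
    qed
    show "of_int (sign \<sigma>) * (\<Prod>i\<in>UNIV. B $ i $ \<sigma> i) = of_int (sign \<sigma>) * (\<Prod>i\<in>UNIV. order_weight p i (\<sigma> i) (m i))"
      if "\<sigma> \<in> {\<sigma>. \<sigma> permutes UNIV \<and> m \<circ> \<sigma> = m}" for \<sigma>
      using that by (auto simp: B_def order_weight_def fun_eq_iff intro!: arg_cong2[where f = "(*)"] prod.cong)
  qed (auto simp: finite_permutations)
  finally show ?thesis using det_levels[of m p] by (simp add: B_def)
qed

text \<open>The weight of the distinct values of \<open>m\<close> is not a product over the indices.
  The level determinant writes it as a signed sum over the permutations preserving \<open>m\<close>;
  exchanging this finite sum with the sum over \<open>m\<close> leaves one free integer per
  cycle.\<close>

lemma level_sum_cycles:
  fixes f :: "'n::{finite,linorder} \<Rightarrow> int \<Rightarrow> complex" and p :: "int \<Rightarrow> complex"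
  assumes s: "\<And>\<sigma> C. \<sigma> permutes UNIV \<Longrightarrow> C \<in> cycles_of \<sigma> \<Longrightarrow>
      (\<lambda>k. norm (\<Prod>i\<in>C. f i k * order_weight p i (\<sigma> i) k)) summable_on UNIV"
  shows "(\<lambda>m. norm ((\<Prod>i\<in>UNIV. f i (m i)) * (\<Prod>s\<in>range m. p s))) summable_on UNIV"
    and "(\<Sum>\<^sub>\<infinity>m. (\<Prod>i\<in>UNIV. f i (m i)) * (\<Prod>s\<in>range m. p s)) =
      (\<Sum>\<sigma> | \<sigma> permutes UNIV. of_int (sign \<sigma>) * (\<Prod>C\<in>cycles_of \<sigma>. \<Sum>\<^sub>\<infinity>k. \<Prod>i\<in>C. f i k * order_weight p i (\<sigma> i) k))"
proof -
  define t where "t = (\<lambda>\<sigma> m. if m \<circ> \<sigma> = m then of_int (sign \<sigma>) * (\<Prod>i\<in>UNIV. f i (m i) * order_weight p i (\<sigma> i) (m i)) else 0)"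
  have t: "(\<Prod>i\<in>UNIV. f i (m i)) * (\<Prod>s\<in>range m. p s) = (\<Sum>\<sigma> | \<sigma> permutes UNIV. t \<sigma> m)" for m
  proof -
    have "(\<Prod>i\<in>UNIV. f i (m i)) * (\<Prod>s\<in>range m. p s) = (\<Sum>\<sigma> | \<sigma> permutes UNIV \<and> m \<circ> \<sigma> = m. t \<sigma> m)"
      unfolding order_weight_levels[symmetric] sum_distrib_left
      by (intro sum.cong) (auto simp: t_def prod.distrib)
    also have "\<dots> = (\<Sum>\<sigma> | \<sigma> permutes UNIV. t \<sigma> m)"
      by (rule sum.mono_neutral_left) (auto simp: t_def finite_permutations)
    finally show ?thesis .
  qed
  have ts: "((t \<sigma>) has_sum (of_int (sign \<sigma>) * (\<Prod>C\<in>cycles_of \<sigma>. \<Sum>\<^sub>\<infinity>k. \<Prod>i\<in>C. f i k * order_weight p i (\<sigma> i) k))) UNIV"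
    "(\<lambda>m. norm (t \<sigma> m)) summable_on UNIV" if \<sigma>: "\<sigma> permutes UNIV" for \<sigma>
  proof -
    have sC: "(\<lambda>k. norm (\<Prod>i\<in>C. f i k * order_weight p i (\<sigma> i) k)) summable_on UNIV" if "C \<in> cycles_of \<sigma>" for C
      by (rule s[OF \<sigma> that])
    note inv = invariant_functions_sum[OF \<sigma>, where f = "\<lambda>i k. f i k * order_weight p i (\<sigma> i) k", OF sC, simplified]
    let ?g = "\<lambda>m. \<Prod>i\<in>UNIV. f i (m i) * order_weight p i (\<sigma> i) (m i)"
    have "(?g has_sum (\<Prod>C\<in>cycles_of \<sigma>. \<Sum>\<^sub>\<infinity>k. \<Prod>i\<in>C. f i k * order_weight p i (\<sigma> i) k)) {m. m \<circ> \<sigma> = m}"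
      using has_sum_infsum[OF abs_summable_summable[OF inv(1)]] unfolding inv(2) .
    from has_sum_cmult_right[OF this, of "of_int (sign \<sigma>)"]
    show "((t \<sigma>) has_sum (of_int (sign \<sigma>) * (\<Prod>C\<in>cycles_of \<sigma>. \<Sum>\<^sub>\<infinity>k. \<Prod>i\<in>C. f i k * order_weight p i (\<sigma> i) k))) UNIV"
      by (subst has_sum_cong_neutral[where S = "{m. m \<circ> \<sigma> = m}" and g = "t \<sigma>", symmetric]) (auto simp: t_def)
    have "norm (of_int (sign \<sigma>) :: complex) = 1" by (simp add: sign_def)
    hence "(\<lambda>m. norm (t \<sigma> m)) summable_on {m. m \<circ> \<sigma> = m}"
      by (subst summable_on_cong[OF _, of _ _ "\<lambda>m. norm (?g m)"]) (auto simp: t_def norm_mult inv(1))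
    thus "(\<lambda>m. norm (t \<sigma> m)) summable_on UNIV"
      by (subst summable_on_cong_neutral[where S = "{m. m \<circ> \<sigma> = m}" and g = "\<lambda>m. norm (t \<sigma> m)", symmetric]) (auto simp: t_def)
  qed
  show "(\<lambda>m. norm ((\<Prod>i\<in>UNIV. f i (m i)) * (\<Prod>s\<in>range m. p s))) summable_on UNIV"
    unfolding t
  proof (rule summable_on_comparison_test)
    show "(\<lambda>m. \<Sum>\<sigma> | \<sigma> permutes UNIV. norm (t \<sigma> m)) summable_on UNIV"
      unfolding summable_on_def
      by (rule exI, rule has_sum_finite_sum, rule has_sum_infsum) (use ts(2) in auto)
  qed (auto intro: norm_sum)
  show "(\<Sum>\<^sub>\<infinity>m. (\<Prod>i\<in>UNIV. f i (m i)) * (\<Prod>s\<in>range m. p s)) =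
      (\<Sum>\<sigma> | \<sigma> permutes UNIV. of_int (sign \<sigma>) * (\<Prod>C\<in>cycles_of \<sigma>. \<Sum>\<^sub>\<infinity>k. \<Prod>i\<in>C. f i k * order_weight p i (\<sigma> i) k))"
    unfolding t by (rule infsumI, rule has_sum_finite_sum) (use ts(1) in auto)
qed


section \<open>The trace over Fock space\<close>

lemma norm_nome: "norm (nome \<tau>) = exp (- (2 * pi * Im \<tau>))"
  by (simp add: nome_def norm_exp_eq_Re)

lemma nome_nonzero [simp]: "nome \<tau> \<noteq> 0"
  by (simp add: nome_def)

lemma norm_nome_less_1: "Im \<tau> > 0 \<Longrightarrow> norm (nome \<tau>) < 1"
  by (simp add: norm_nome)

text \<open>A hole removes an occupied site of the vacuum, hence the inverse; the minus sign
  produces the alternating signs of theta.\<close>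

definition site_weight :: "complex \<Rightarrow> complex \<Rightarrow> int \<Rightarrow> complex" where
  "site_weight \<tau> c s =
     (if s \<ge> 0 then - exp c * nome \<tau> powi s else inverse (- exp c * nome \<tau> powi s))"

lemma site_weight_summable:
  assumes "Im \<tau> > 0"
  shows "(\<lambda>s. norm (site_weight \<tau> c s)) summable_on UNIV"
proof (rule summable_on_int_geometric)
  let ?a = "norm (nome \<tau>)"
  show "0 \<le> ?a" "?a < 1" "0 \<le> ?a" "?a < 1" using norm_nome_less_1[OF assms] by auto
  fix n
  have "norm (exp c) \<le> exp \<bar>Re c\<bar>" by (simp add: norm_exp_eq_Re)
  hence "norm (exp c) * ?a ^ n \<le> exp \<bar>Re c\<bar> * ?a ^ n" by (intro mult_right_mono) auto
  thus "norm (site_weight \<tau> c (int n)) \<le> exp \<bar>Re c\<bar> * ?a ^ n"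
    by (simp add: site_weight_def norm_mult norm_power)
  have eq: "inverse (- exp c * nome \<tau> powi (- int n - 1)) = - exp (- c) * nome \<tau> ^ Suc n"
    by (simp add: power_int_diff power_int_minus exp_minus field_simps)
  have "norm (exp (- c)) * ?a ^ Suc n \<le> exp \<bar>Re c\<bar> * ?a ^ n"
    using norm_nome_less_1[OF assms] by (intro mult_mono power_decreasing) (auto simp: norm_exp_eq_Re)
  thus "norm (site_weight \<tau> c (- int n - 1)) \<le> exp \<bar>Re c\<bar> * ?a ^ n"
    using arg_cong[OF eq, of norm] by (simp add: site_weight_def norm_mult norm_power)
qed

lemma prod_site_weight:
  assumes "finite X"
  shows "(\<Prod>s\<in>X. site_weight \<tau> c s) = (- exp c) powi charge X * nome \<tau> powi energy X"
  using assms
proof (induction X rule: finite_induct)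
  case (insert s X)
  have *: "- exp c \<noteq> 0" "nome \<tau> \<noteq> 0" by auto
  have "site_weight \<tau> c s = (- exp c) powi (if s \<ge> 0 then 1 else - 1) * nome \<tau> powi (if s \<ge> 0 then s else - s)"
    by (simp add: site_weight_def power_int_minus)
  thus ?case
    using insert by (simp add: charge_def energy_def power_int_add[OF disjI1[OF *(1)]] power_int_add[OF disjI1[OF *(2)]] mult_ac)
qed (simp add: charge_def energy_def)

definition charge_term :: "complex \<Rightarrow> complex \<Rightarrow> int \<Rightarrow> complex" where
  "charge_term \<tau> x N = (- 1) powi N * nome \<tau> powi (N * (N - 1) div 2) * exp (of_int N * x)"

lemma prod_site_weight_maya:
  assumes "lam \<in> int_partitions"
  shows "(\<Prod>s\<in>maya_code (N, lam). site_weight \<tau> c s) = charge_term \<tau> c N * nome \<tau> ^ partition_size lam"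
proof -
  have "maya_code (N, lam) \<in> {X. finite X}"
    using bij_betw_maya_code assms unfolding bij_betw_def by blast
  hence "(\<Prod>s\<in>maya_code (N, lam). site_weight \<tau> c s) =
      (- exp c) powi N * nome \<tau> powi (int (partition_size lam) + N * (N - 1) div 2)"
    by (simp add: prod_site_weight maya_code_charge[OF assms] maya_code_energy[OF assms])
  also have "(- exp c) powi N = (- 1) powi N * exp (of_int N * c)"
    using power_int_mult_distrib[of "- 1" "exp c" N] by (simp add: exp_power_int)
  finally show ?thesis by (simp add: charge_term_def power_int_add mult_ac)
qed

text \<open>With N = m + 1 one has N (N - 1) / 2 = (m + 1/2)^2 / 2 - 1/8. The constant is minus
  q^(-1/8), its sign coming from (-1)^(m + 1).\<close>

definition theta_scale :: "complex \<Rightarrow> complex" where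
  "theta_scale \<tau> = - exp (- (pi * \<i> * \<tau> / 4))"

lemma theta_scale_nonzero [simp]: "theta_scale \<tau> \<noteq> 0"
  by (simp add: theta_scale_def)

lemma charge_term_Suc:
  "charge_term \<tau> x (m + 1) = theta_scale \<tau> * exp (x / 2) *
     ((- 1) powi m * exp (pi * \<i> * \<tau> * (of_int m + 1/2)\<^sup>2) * exp ((of_int m + 1/2) * x))"
proof -
  have "even ((m + 1) * m)" by simp
  then obtain j where j: "(m + 1) * m = 2 * j" by (elim evenE)
  have "(of_int ((m + 1) * m) :: complex) = 2 * of_int j" unfolding j by simp
  hence j': "2 * (of_int j :: complex) = (of_int m + 1) * of_int m" by simp
  have "nome \<tau> powi j = exp (pi * \<i> * \<tau> * (2 * of_int j))"
    by (simp add: nome_def exp_power_int mult_ac)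
  also have "pi * \<i> * \<tau> * (2 * of_int j) = - (pi * \<i> * \<tau> / 4) + pi * \<i> * \<tau> * (of_int m + 1/2)\<^sup>2"
    unfolding j' by (simp add: power2_eq_square field_simps)
  finally have q: "nome \<tau> powi j = exp (- (pi * \<i> * \<tau> / 4)) * exp (pi * \<i> * \<tau> * (of_int m + 1/2)\<^sup>2)"
    by (simp only: exp_add)
  have e: "exp (of_int (m + 1) * x) = exp (x / 2) * exp ((of_int m + 1/2) * x)"
    unfolding exp_add[symmetric] by (rule arg_cong[where f = exp]) (simp add: field_simps)
  have s: "(- 1) powi (m + 1) = - ((- 1 :: complex) powi m)" by (simp add: power_int_add)
  show ?thesis
    unfolding charge_term_def e s theta_scale_def using j q by (simp add: mult_ac)
qed

lemma has_sum_int_shift: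
  fixes f :: "int \<Rightarrow> 'a :: {comm_monoid_add, topological_space}"
  shows "((\<lambda>m. f (m + 1)) has_sum S) UNIV \<longleftrightarrow> (f has_sum S) UNIV"
  by (rule has_sum_reindex_bij_witness[of _ "\<lambda>m. m - 1" "\<lambda>m. m + 1"]) auto

lemma charge_term_has_sum:
  assumes "Im \<tau> > 0"
  shows "(charge_term \<tau> x has_sum (theta_scale \<tau> * exp (x / 2) * theta_num \<tau> x)) UNIV"
proof (subst has_sum_int_shift[symmetric], unfold charge_term_Suc theta_num_def, rule has_sum_cmult_right, rule has_sum_infsum)
qed (rule abs_summable_summable[OF theta_terms_summable[OF assms]])

text \<open>Summability of either factor is read off from one slice on which the other is a nonzero
  constant. In this way the partition series inherits convergence from the sum over
  diagrams.\<close>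

lemma product_sum:
  fixes a :: "'i \<Rightarrow> complex" and b :: "'j \<Rightarrow> complex"
  assumes "((\<lambda>(i, j). a i * b j) has_sum S) (A \<times> B)"
  shows "S = infsum a A * infsum b B"
    and "\<And>i. i \<in> A \<Longrightarrow> a i \<noteq> 0 \<Longrightarrow> b summable_on B"
    and "\<And>j. j \<in> B \<Longrightarrow> b j \<noteq> 0 \<Longrightarrow> a summable_on A"
proof -
  have s: "(\<lambda>(i, j). a i * b j) summable_on A \<times> B" using assms by (rule has_sum_imp_summable)
  have "S = (\<Sum>\<^sub>\<infinity>i\<in>A. \<Sum>\<^sub>\<infinity>j\<in>B. a i * b j)"
    using infsum_Sigma_banach[OF s] infsumI[OF assms] by simp
  thus "S = infsum a A * infsum b B" by (simp add: infsum_cmult_right' infsum_cmult_left')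
  show "b summable_on B" if "i \<in> A" "a i \<noteq> 0" for i
  proof -
    have "(\<lambda>(i, j). a i * b j) summable_on ({i} \<times> B)"
      by (rule summable_on_subset_banach[OF s]) (use that in auto)
    hence "(\<lambda>j. a i * b j) summable_on B"
      using summable_on_reindex_bij_betw[of "Pair i" B "{i} \<times> B" "\<lambda>(i, j). a i * b j"]
      by (force simp: bij_betw_def inj_on_def)
    thus ?thesis using summable_on_cmult_right'[OF that(2)] by blast
  qed
  show "a summable_on A" if "j \<in> B" "b j \<noteq> 0" for j
  proof -
    have "(\<lambda>(i, j). a i * b j) summable_on (A \<times> {j})"
      by (rule summable_on_subset_banach[OF s]) (use that in auto)
    hence "(\<lambda>i. a i * b j) summable_on A"
      using summable_on_reindex_bij_betw[of "\<lambda>i. (i, j)" A "A \<times> {j}" "\<lambda>(i, j). a i * b j"]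
      by (force simp: bij_betw_def inj_on_def)
    thus ?thesis using summable_on_cmult_left'[OF that(2)] by blast
  qed
qed

definition partition_gf :: "complex \<Rightarrow> complex" where
  "partition_gf q = (\<Sum>\<^sub>\<infinity>lam\<in>int_partitions. q ^ partition_size lam)"

lemma zero_partition: "(\<lambda>_. 0) \<in> int_partitions" "partition_size (\<lambda>_. 0) = 0"
  by (auto simp: int_partitions_def partition_size_def antimono_def)

lemma charge_term_0 [simp]: "charge_term \<tau> x 0 = 1"
  by (simp add: charge_term_def)

text \<open>The Jacobi triple product: the same sum over diagrams is the infinite product over sites
  and, sorted by charge and partition, theta times the partition series.\<close>

lemma vacuum_sum:
  assumes "Im \<tau> > 0"
  shows "(\<lambda>lam. nome \<tau> ^ partition_size lam) summable_on int_partitions"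
    and "subset_sum (site_weight \<tau> c) {} = theta_scale \<tau> * exp (c / 2) * theta_num \<tau> c * partition_gf (nome \<tau>)"
proof -
  note sw = site_weight_summable[OF assms, of c]
  have "((\<lambda>X. \<Prod>s\<in>X. site_weight \<tau> c s) has_sum subset_sum (site_weight \<tau> c) {}) {X. finite X}"
    unfolding subset_sum_def using has_sum_infsum[OF subset_products_summable(2)[OF sw, of "{X. finite X}"]] by simp
  hence "((\<lambda>(N, lam). charge_term \<tau> c N * nome \<tau> ^ partition_size lam) has_sum subset_sum (site_weight \<tau> c) {}) (UNIV \<times> int_partitions)"
    unfolding has_sum_reindex_bij_betw[OF bij_betw_maya_code, symmetric]
    by (subst has_sum_cong) (auto simp: prod_site_weight_maya)
  note ps = product_sum[OF this]
  show "(\<lambda>lam. nome \<tau> ^ partition_size lam) summable_on int_partitions"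
    using ps(2)[of 0] by simp
  show "subset_sum (site_weight \<tau> c) {} = theta_scale \<tau> * exp (c / 2) * theta_num \<tau> c * partition_gf (nome \<tau>)"
    using ps(1) infsumI[OF charge_term_has_sum[OF assms]] by (simp add: partition_gf_def)
qed

lemma site_weight_0: "site_weight \<tau> 0 0 = - 1"
  by (simp add: site_weight_def)

lemma theta_num_0 [simp]: "theta_num \<tau> 0 = 0"
  using theta_num_minus[of \<tau> 0] by simp

text \<open>The triple product is differentiated at its zero \<open>c = 0\<close>, the derivative
  being taken by weighting with the charge.\<close>

lemma partition_gf_theta_den:
  assumes "Im \<tau> > 0"
  shows "partition_gf (nome \<tau>) * (theta_scale \<tau> * theta_den \<tau>) = - subset_sum (site_weight \<tau> 0) {0}"
proof -
  note sw = site_weight_summable[OF assms, of 0]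
  have "((\<lambda>X. of_int (charge X) * (\<Prod>s\<in>X. site_weight \<tau> 0 s)) has_sum - subset_sum (site_weight \<tau> 0) {0}) {X. finite X}"
    by (rule subset_sum_charge[OF sw site_weight_0])
  hence "((\<lambda>(N, lam). (of_int N * charge_term \<tau> 0 N) * nome \<tau> ^ partition_size lam) has_sum - subset_sum (site_weight \<tau> 0) {0}) (UNIV \<times> int_partitions)"
    unfolding has_sum_reindex_bij_betw[OF bij_betw_maya_code, symmetric]
    by (subst has_sum_cong) (auto simp: prod_site_weight_maya maya_code_charge)
  note ps = product_sum[OF this]
  define T where "T = infsum (\<lambda>N. of_int N * charge_term \<tau> 0 N) UNIV"
  have "((\<lambda>N. of_int N * charge_term \<tau> 0 N) has_sum T) UNIV"
    unfolding T_def using ps(3)[OF zero_partition(1)] by (intro has_sum_infsum) (simp add: zero_partition(2))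
  hence 1: "((\<lambda>m. of_int (m + 1) * charge_term \<tau> 0 (m + 1)) has_sum T) UNIV"
    using has_sum_int_shift[of "\<lambda>N. of_int N * charge_term \<tau> 0 N"] by simp
  \<comment> \<open>The charge is m + 1 while \<open>theta_den\<close> carries m + 1/2. The missing
    -1/2 costs nothing, since the unweighted sum is a multiple of \<open>theta_num \<tau> 0\<close>
    and hence zero.\<close>
  have "(charge_term \<tau> 0 has_sum 0) UNIV" using charge_term_has_sum[OF assms, of 0] by simp
  hence 2: "((\<lambda>m. - (1/2) * charge_term \<tau> 0 (m + 1)) has_sum (- (1/2)) * 0) UNIV"
    by (intro has_sum_cmult_right) (simp add: has_sum_int_shift)
  have "((\<lambda>m. theta_scale \<tau> * ((- 1) powi m * (of_int m + 1/2) * exp (pi * \<i> * \<tau> * (of_int m + 1/2)\<^sup>2))) has_sum (T + (- (1/2)) * 0)) UNIV"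
    using has_sum_add[OF 1 2] by (rule has_sum_cong[THEN iffD1, rotated]) (simp add: charge_term_Suc field_simps)
  hence "theta_scale \<tau> * theta_den \<tau> = T"
    unfolding theta_den_def infsum_cmult_right'[symmetric] by (simp add: infsumI)
  thus ?thesis using ps(1) by (simp add: T_def partition_gf_def mult.commute)
qed

lemma site_weight_ne_minus_1:
  assumes "Im \<tau> > 0" "s \<noteq> 0"
  shows "1 + site_weight \<tau> 0 s \<noteq> 0"
proof
  assume "1 + site_weight \<tau> 0 s = 0"
  hence "site_weight \<tau> 0 s = - 1" by (simp add: eq_neg_iff_add_eq_0 add.commute)
  hence n: "norm (nome \<tau> powi s) = 1"
    by (auto simp: site_weight_def split: if_splits)
  have "norm (nome \<tau> powi s) = exp (- (2 * pi * Im \<tau>) * of_int s)"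
    by (simp add: norm_power_int norm_nome exp_power_int mult.commute)
  with n assms show False by simp
qed

text \<open>At \<open>c = 0\<close> the factor of site 0 is the only vanishing one, so the product
  over the other sites is nonzero.\<close>

lemma theta_den_nonzero:
  assumes "Im \<tau> > 0"
  shows "theta_den \<tau> \<noteq> 0"
proof -
  have "subset_sum (site_weight \<tau> 0) {0} \<noteq> 0"
    by (rule subset_sum_nonzero[OF site_weight_summable[OF assms]])
      (use site_weight_ne_minus_1[OF assms] in auto)
  thus ?thesis using partition_gf_theta_den[OF assms] by auto
qed

lemma exp_maya_set_summable:
  assumes "Re z > 0" "finite X"
  shows "(\<lambda>s. norm (exp (z * of_int s))) summable_on maya_set X"
proof -
  define f where "f = (\<lambda>s::int. if s < 0 then exp (z * of_int s) else 0)"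
  have "(\<lambda>s. norm (f s)) summable_on UNIV"
  proof (rule summable_on_int_geometric[where a = 0 and b = "exp (- Re z)" and C = 1])
    show "norm (f (- int n - 1)) \<le> 1 * exp (- Re z) ^ n" for n
      using assms(1) by (simp add: f_def norm_exp_eq_Re flip: exp_of_nat_mult) (simp add: algebra_simps)
  qed (use assms in \<open>auto simp: f_def\<close>)
  hence "(\<lambda>s. norm (f s)) summable_on {..<0}" by (rule summable_on_subset_banach) auto
  hence "(\<lambda>s. norm (exp (z * of_int s))) summable_on {..<0}"
    by (rule summable_on_cong[THEN iffD1, rotated]) (auto simp: f_def)
  hence "(\<lambda>s. norm (exp (z * of_int s))) summable_on ({..<0} \<union> (X - {..<0}))"
    using assms by (intro summable_on_Un_disjoint) auto
  thus ?thesis by (rule summable_on_subset_banach) (auto simp: maya_set_def)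
qed

text \<open>
  The trace over the whole Fock space, summed over all diagrams, factors into the sum over charges and
  the trace over the charge-zero subspace.
\<close>

lemma fock_trace:
  fixes z :: "complex ^ 'n"
  defines "Z \<equiv> \<Sum>i\<in>UNIV. z $ i"
  assumes \<tau>: "Im \<tau> > 0" and z: "\<And>i. Re (z $ i) > 0"
    and summ: "(\<lambda>m::'n \<Rightarrow> int. norm (\<Prod>i\<in>UNIV. exp (z $ i * of_int (m i))) *
      (\<Prod>s\<in>{s\<in>range m. s \<ge> 0}. norm (site_weight \<tau> c s))) summable_on UNIV"
  shows "trace_term \<tau> z summable_on int_partitions"
    and "theta_scale \<tau> * exp (c / 2) * theta_num \<tau> (c + Z) * (\<Sum>\<^sub>\<infinity>lam\<in>int_partitions. trace_term \<tau> z lam) =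
      (\<Sum>\<^sub>\<infinity>m. (\<Prod>i\<in>UNIV. exp (z $ i * of_int (m i))) *
        ((\<Prod>s\<in>{s\<in>range m. s \<ge> 0}. site_weight \<tau> c s) * subset_sum (site_weight \<tau> c) (range m)))"
proof -
  define r where "r = site_weight \<tau> c"
  define \<rho> where "\<rho> = (\<lambda>s. norm (r s))"
  have r: "(\<lambda>s. norm (r s)) summable_on UNIV" unfolding r_def by (rule site_weight_summable[OF \<tau>])
  have \<rho>: "(\<lambda>s. norm (\<rho> s)) summable_on UNIV" using r by (simp add: \<rho>_def)
  let ?e = "\<lambda>m::'n \<Rightarrow> int. \<Prod>i\<in>UNIV. exp (z $ i * of_int (m i))"
  let ?B = "\<lambda>m::'n \<Rightarrow> int. {X. finite X \<and> range m \<subseteq> maya_set X}"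
  define g where "g = (\<lambda>(m, X). ?e m * (\<Prod>s\<in>X. r s))"
  define W where "W = subset_sum \<rho> {}"
  \<comment> \<open>The diagrams containing the sites of \<open>m\<close> contribute at most the
    weights of its nonnegative sites times the full sum \<open>W\<close>.\<close>
  have inner_norm: "(\<Sum>\<^sub>\<infinity>X\<in>?B m. norm (g (m, X))) \<le> norm (?e m) * (\<Prod>s\<in>{s\<in>range m. s \<ge> 0}. \<rho> s) * W" for m
  proof -
    have "(\<Sum>\<^sub>\<infinity>X\<in>?B m. norm (g (m, X))) = norm (?e m) * (\<Sum>\<^sub>\<infinity>X\<in>?B m. \<Prod>s\<in>X. \<rho> s)"
      unfolding infsum_cmult_right'[symmetric] by (simp add: g_def norm_mult prod_norm \<rho>_def)
    also have "(\<Sum>\<^sub>\<infinity>X\<in>?B m. \<Prod>s\<in>X. \<rho> s) = (\<Prod>s\<in>{s\<in>range m. s \<ge> 0}. \<rho> s) * subset_sum \<rho> (range m)"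
      by (rule subset_sum_maya[OF \<rho>]) simp
    also have "norm (?e m) * \<dots> \<le> norm (?e m) * ((\<Prod>s\<in>{s\<in>range m. s \<ge> 0}. \<rho> s) * W)"
    proof (intro mult_left_mono)
      show "subset_sum \<rho> (range m) \<le> W"
        unfolding W_def subset_sum_def
        by (intro infsum_mono2 subset_products_summable[OF \<rho>]) (auto intro!: prod_nonneg simp: \<rho>_def)
    qed (auto intro!: prod_nonneg simp: \<rho>_def)
    finally show ?thesis by (simp add: mult_ac)
  qed
  have "(\<lambda>p. norm (g p)) summable_on (SIGMA m:UNIV. ?B m)"
  proof (subst Infinite_Sum.abs_summable_on_Sigma_iff, intro conjI ballI)
    show "(\<lambda>X. norm (g (m, X))) summable_on ?B m" for m
      unfolding g_def prod.case norm_mult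
      by (intro summable_on_cmult_right subset_products_summable[OF r]) auto
    have "(\<lambda>m. norm (?e m) * (\<Prod>s\<in>{s\<in>range m. s \<ge> 0}. \<rho> s) * W) summable_on UNIV"
      unfolding \<rho>_def r_def by (intro summable_on_cmult_left summ)
    thus "(\<lambda>m. norm (\<Sum>\<^sub>\<infinity>X\<in>?B m. norm (g (m, X)))) summable_on UNIV"
      by (rule summable_on_comparison_test) (auto simp: infsum_nonneg inner_norm)
  qed
  hence gs: "g summable_on (SIGMA m:UNIV. ?B m)" by (rule abs_summable_summable)
  define T where "T = (\<Sum>\<^sub>\<infinity>m. \<Sum>\<^sub>\<infinity>X\<in>?B m. g (m, X))"
  have T: "(g has_sum T) (SIGMA m:UNIV. ?B m)"
    unfolding T_def infsum_Sigma_banach[OF gs] by (rule has_sum_infsum[OF gs])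
  have T_eq: "T = (\<Sum>\<^sub>\<infinity>m. ?e m * ((\<Prod>s\<in>{s\<in>range m. s \<ge> 0}. r s) * subset_sum r (range m)))"
    unfolding T_def
  proof (rule infsum_cong)
    fix m :: "'n \<Rightarrow> int"
    have "(\<Sum>\<^sub>\<infinity>X\<in>?B m. g (m, X)) = ?e m * (\<Sum>\<^sub>\<infinity>X\<in>?B m. \<Prod>s\<in>X. r s)"
      unfolding infsum_cmult_right'[symmetric] by (simp add: g_def)
    thus "(\<Sum>\<^sub>\<infinity>X\<in>?B m. g (m, X)) = ?e m * ((\<Prod>s\<in>{s\<in>range m. s \<ge> 0}. r s) * subset_sum r (range m))"
      by (simp add: subset_sum_maya[OF r])
  qed
  \<comment> \<open>In this order the tuple \<open>m\<close> is chosen inside a fixed diagram,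
    independently in each coordinate, which produces the product of one-body sums.\<close>
  have bij: "bij_betw (\<lambda>(X, m). (m, X)) (SIGMA X:{X. finite X}. PiE UNIV (\<lambda>_::'n. maya_set X)) (SIGMA m:UNIV. ?B m)"
    by (rule bij_betwI[of _ _ _ "\<lambda>(m, X). (X, m)"]) auto
  have "((\<lambda>(X, m). g (m, X)) has_sum T) (SIGMA X:{X. finite X}. PiE UNIV (\<lambda>_::'n. maya_set X))"
    using has_sum_reindex_bij_betw[OF bij, of g] T by (simp add: case_prod_unfold)
  hence G: "((\<lambda>X. (\<Prod>s\<in>X. r s) * (\<Prod>i\<in>UNIV. \<Sum>\<^sub>\<infinity>s\<in>maya_set X. exp (z $ i * of_int s))) has_sum T) {X. finite X}"
  proof (rule has_sum_SigmaD)
    fix X :: "int set" assume X: "X \<in> {X. finite X}"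
    have s: "(\<lambda>s. norm (exp (z $ i * of_int s))) summable_on maya_set X" for i
      using X z by (intro exp_maya_set_summable) auto
    have "((\<lambda>m. ?e m) has_sum (\<Prod>i\<in>UNIV. \<Sum>\<^sub>\<infinity>s\<in>maya_set X. exp (z $ i * of_int s))) (PiE UNIV (\<lambda>_::'n. maya_set X))"
      unfolding infsum_prod_PiE_abs[OF finite_class.finite_UNIV s, symmetric]
      by (rule has_sum_infsum, rule abs_summable_summable, rule abs_summable_prod_PiE) (use s in auto)
    from has_sum_cmult_right[OF this, of "\<Prod>s\<in>X. r s"]
    show "((\<lambda>m. case (X, m) of (X, m) \<Rightarrow> g (m, X)) has_sum
        (\<Prod>s\<in>X. r s) * (\<Prod>i\<in>UNIV. \<Sum>\<^sub>\<infinity>s\<in>maya_set X. exp (z $ i * of_int s))) (PiE UNIV (\<lambda>_::'n. maya_set X))"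
      by (simp add: g_def mult.commute)
  qed
  \<comment> \<open>Charge \<open>N\<close> translates the diagram and multiplies the one-body sums
    by \<open>exp (Z * (of_int N - 1/2))\<close> in total. The part in \<open>N\<close> moves
    \<open>c\<close> to \<open>c + Z\<close>; the 1/2 is the shift between sites and
    half-integers.\<close>
  let ?A = "\<lambda>N. exp (- Z / 2) * charge_term \<tau> (c + Z) N"
  have diagram: "(\<Prod>s\<in>maya_code (N, lam). r s) * (\<Prod>i\<in>UNIV. \<Sum>\<^sub>\<infinity>s\<in>maya_set (maya_code (N, lam)). exp (z $ i * of_int s)) =
      ?A N * trace_term \<tau> z lam" if lam: "lam \<in> int_partitions" for N lam
  proof -
    have "(\<Sum>\<^sub>\<infinity>s\<in>maya_set (maya_code (N, lam)). exp (w * of_int s)) =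
        exp (w * (of_int N - 1/2)) * (\<Sum>\<^sub>\<infinity>k. partition_exp w lam k)" for w
    proof -
      have "maya_set (maya_code (N, lam)) = range (maya_seq N lam)" by (simp add: maya_code_def)
      hence "(\<Sum>\<^sub>\<infinity>s\<in>maya_set (maya_code (N, lam)). exp (w * of_int s)) = (\<Sum>\<^sub>\<infinity>k. exp (w * of_int (maya_seq N lam k)))"
        using infsum_reindex[OF maya_seq_inj[OF lam, of N], of "\<lambda>s. exp (w * of_int s)"] by (simp add: o_def)
      also have "\<dots> = (\<Sum>\<^sub>\<infinity>k. exp (w * (of_int N - 1/2)) * partition_exp w lam k)"
        by (intro infsum_cong) (simp add: partition_exp_def maya_seq_def algebra_simps flip: exp_add)
      finally show ?thesis by (simp add: infsum_cmult_right')
    qed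
    hence "(\<Prod>i\<in>UNIV. \<Sum>\<^sub>\<infinity>s\<in>maya_set (maya_code (N, lam)). exp (z $ i * of_int s)) =
        exp (Z * (of_int N - 1/2)) * (\<Prod>i\<in>UNIV. \<Sum>\<^sub>\<infinity>k. partition_exp (z $ i) lam k)"
      by (simp add: prod.distrib Z_def sum_distrib_right exp_sum)
    moreover have "charge_term \<tau> c N * exp (Z * (of_int N - 1/2)) = ?A N"
      by (simp add: charge_term_def algebra_simps flip: exp_add)
    ultimately show ?thesis
      unfolding r_def prod_site_weight_maya[OF lam] trace_term_def by (simp add: mult_ac)
  qed
  have "((\<lambda>(N, lam). ?A N * trace_term \<tau> z lam) has_sum T) (UNIV \<times> int_partitions)"
    using G unfolding has_sum_reindex_bij_betw[OF bij_betw_maya_code, symmetric]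
    by (subst (asm) has_sum_cong[where g = "\<lambda>(N, lam). ?A N * trace_term \<tau> z lam"]) (auto simp: diagram)
  note ps = product_sum[OF this]
  show "trace_term \<tau> z summable_on int_partitions" using ps(2)[of 0] by simp
  have "(?A has_sum exp (- Z / 2) * (theta_scale \<tau> * exp ((c + Z) / 2) * theta_num \<tau> (c + Z))) UNIV"
    by (intro has_sum_cmult_right charge_term_has_sum[OF \<tau>])
  hence "infsum ?A UNIV = exp (- Z / 2) * (theta_scale \<tau> * exp ((c + Z) / 2) * theta_num \<tau> (c + Z))"
    by (rule infsumI)
  also have "\<dots> = theta_scale \<tau> * (exp (- Z / 2) * exp ((c + Z) / 2)) * theta_num \<tau> (c + Z)" by (simp add: mult_ac)
  also have "exp (- Z / 2) * exp ((c + Z) / 2) = exp (c / 2)"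
    unfolding exp_add[symmetric] by (rule arg_cong[where f = exp]) (simp add: field_simps)
  finally have A: "infsum ?A UNIV = theta_scale \<tau> * exp (c / 2) * theta_num \<tau> (c + Z)" .
  show "theta_scale \<tau> * exp (c / 2) * theta_num \<tau> (c + Z) * (\<Sum>\<^sub>\<infinity>lam\<in>int_partitions. trace_term \<tau> z lam) =
      (\<Sum>\<^sub>\<infinity>m. ?e m * ((\<Prod>s\<in>{s\<in>range m. s \<ge> 0}. site_weight \<tau> c s) * subset_sum (site_weight \<tau> c) (range m)))"
    using ps(1) T_eq A by (simp add: r_def)
qed


section \<open>Occupation numbers\<close>

lemma partition_size_cons:
  assumes "lam \<in> int_partitions" "lam 0 \<le> m"
  shows "case_nat m lam \<in> int_partitions" "partition_size (case_nat m lam) = m + partition_size lam"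
proof -
  have a: "antimono (case_nat m lam)"
  proof (rule antimonoI)
    fix i j :: nat assume "i \<le> j"
    thus "case_nat m lam j \<le> case_nat m lam i"
      using assms by (auto simp: int_partitions_def antimono_def split: nat.splits intro: order_trans[of _ "lam 0"])
  qed
  have sub: "{k. case_nat m lam k \<noteq> 0} \<subseteq> insert 0 (Suc ` {k. lam k \<noteq> 0})"
  proof
    fix k assume "k \<in> {k. case_nat m lam k \<noteq> 0}"
    thus "k \<in> insert 0 (Suc ` {k. lam k \<noteq> 0})" by (cases k) auto
  qed
  have fin: "finite {k. lam k \<noteq> 0}" using assms by (simp add: int_partitions_def)
  show "case_nat m lam \<in> int_partitions" using a finite_subset[OF sub] fin by (simp add: int_partitions_def)
  have "partition_size (case_nat m lam) = (\<Sum>k\<in>insert 0 (Suc ` {k. lam k \<noteq> 0}). case_nat m lam k)"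
    unfolding partition_size_def using sub fin by (intro sum.mono_neutral_left) auto
  also have "\<dots> = m + partition_size lam"
    using fin by (simp add: partition_size_def sum.reindex)
  finally show "partition_size (case_nat m lam) = m + partition_size lam" .
qed

lemma partition_tail:
  assumes "lam \<in> int_partitions"
  shows "(\<lambda>k. lam (Suc k)) \<in> int_partitions" "lam (Suc 0) \<le> lam 0"
proof -
  have "Suc ` {k. lam (Suc k) \<noteq> 0} \<subseteq> {k. lam k \<noteq> 0}" by auto
  hence "finite {k. lam (Suc k) \<noteq> 0}"
    using assms by (auto simp: int_partitions_def dest: finite_subset intro: finite_imageD)
  thus "(\<lambda>k. lam (Suc k)) \<in> int_partitions" using assms by (auto simp: int_partitions_def antimono_def)
  show "lam (Suc 0) \<le> lam 0" using assms by (auto simp: int_partitions_def antimono_def)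
qed

text \<open>Partitions are sorted by their largest part. Prepending \<open>m\<close> to a partition
  with parts at most \<open>m\<close> gives \<open>d m = q ^ m * (\<Sum>k\<le>m. d k)\<close>, so
  for positive \<open>m\<close> the truncated sum times \<open>1 - q ^ m\<close> is the preceding
  one.\<close>

lemma partition_gf_euler:
  fixes q :: complex
  assumes q: "norm q < 1" and summ: "(\<lambda>lam. q ^ partition_size lam) summable_on int_partitions"
  shows "partition_gf q * euler_prod q = 1"
proof -
  let ?f = "\<lambda>lam. q ^ partition_size lam"
  define A where "A = (\<lambda>m. {lam \<in> int_partitions. lam 0 = m})"
  define B where "B = (\<lambda>m. {lam \<in> int_partitions. lam 0 \<le> m})"
  define d where "d = (\<lambda>m. infsum ?f (A m))"
  have sA: "?f summable_on A m" and sB: "?f summable_on B m" for m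
    using summ by (auto simp: A_def B_def intro: summable_on_subset_banach)
  have bij: "bij_betw (\<lambda>lam. (lam 0, lam)) int_partitions (SIGMA m:UNIV. A m)"
    by (rule bij_betwI[of _ _ _ snd]) (auto simp: A_def)
  have "((\<lambda>(m, lam). ?f lam) has_sum partition_gf q) (SIGMA m:UNIV. A m)"
    unfolding has_sum_reindex_bij_betw[OF bij, symmetric] partition_gf_def
    using has_sum_infsum[OF summ] by simp
  hence "(d has_sum partition_gf q) UNIV"
    by (rule has_sum_SigmaD) (use sA in \<open>auto simp: d_def intro: has_sum_infsum\<close>)
  hence "d sums partition_gf q" by (rule has_sum_imp_sums)
  hence lim: "(\<lambda>m. \<Sum>k\<le>m. d k) \<longlonglongrightarrow> partition_gf q" by (simp add: sums_def_le)
  have B_sum: "infsum ?f (B m) = (\<Sum>k\<le>m. d k)" for m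
  proof (induction m)
    case 0
    have "B 0 = A 0" by (auto simp: A_def B_def)
    thus ?case by (simp add: d_def)
  next
    case (Suc m)
    have "B (Suc m) = B m \<union> A (Suc m)" by (auto simp: A_def B_def)
    moreover have "B m \<inter> A (Suc m) = {}" by (auto simp: A_def B_def)
    ultimately have "infsum ?f (B (Suc m)) = infsum ?f (B m) + d (Suc m)"
      using infsum_Un_disjoint[OF sB[of m] sA[of "Suc m"]] by (simp add: d_def)
    thus ?case using Suc by simp
  qed
  have bij_cons: "bij_betw (case_nat m) (B m) (A m)" for m
  proof (rule bij_betwI[of _ _ _ "\<lambda>lam k. lam (Suc k)"])
    show "case_nat m \<in> B m \<rightarrow> A m" using partition_size_cons(1) by (auto simp: A_def B_def)
    show "(\<lambda>lam k. lam (Suc k)) \<in> A m \<rightarrow> B m" using partition_tail by (auto simp: A_def B_def)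
    show "case_nat m (\<lambda>k. y (Suc k)) = y" if "y \<in> A m" for y
      using that by (auto simp: A_def fun_eq_iff split: nat.splits)
  qed auto
  have d_eq: "d m = q ^ m * (\<Sum>k\<le>m. d k)" for m
  proof -
    have "d m = (\<Sum>\<^sub>\<infinity>lam\<in>B m. ?f (case_nat m lam))"
      unfolding d_def by (rule infsum_reindex_bij_betw[OF bij_cons, symmetric])
    also have "\<dots> = (\<Sum>\<^sub>\<infinity>lam\<in>B m. q ^ m * ?f lam)"
      by (intro infsum_cong) (auto simp: B_def partition_size_cons power_add)
    finally show ?thesis by (simp add: infsum_cmult_right' B_sum)
  qed
  have "lam k = 0" if "lam \<in> A 0" for lam k
    using that antimonoD[of lam 0 k] by (simp add: A_def int_partitions_def)
  hence "A 0 = {\<lambda>_. 0}"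
    using zero_partition(1) by (auto simp: A_def)
  hence d0: "d 0 = 1" by (simp add: d_def zero_partition)
  have p: "(\<Sum>k\<le>m. d k) * (\<Prod>k<m. 1 - q ^ Suc k) = 1" for m
  proof (induction m)
    case (Suc m)
    have "(\<Sum>k\<le>Suc m. d k) * (1 - q ^ Suc m) = (\<Sum>k\<le>m. d k)"
      using d_eq[of "Suc m"] by (simp add: algebra_simps)
    thus ?case using Suc by (simp add: mult_ac) (metis mult.assoc mult.commute)
  qed (simp add: d0)
  have "convergent_prod (\<lambda>k. 1 + (- (q ^ Suc k)))"
  proof (rule summable_imp_convergent_prod_complex)
    show "summable (\<lambda>k. norm (- (q ^ Suc k)))"
      using q by (simp add: norm_mult norm_power summable_mult)
    show "- (q ^ Suc k) \<noteq> - 1" for k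
    proof
      assume "- (q ^ Suc k) = - 1"
      hence "norm q ^ Suc k = 1" by (metis neg_equal_iff_equal norm_one norm_power)
      thus False using q power_Suc_less_one[of "norm q" k] by (cases "norm q = 0") auto
    qed
  qed
  hence "(\<lambda>n. \<Prod>k\<le>n. 1 - q ^ Suc k) \<longlonglongrightarrow> euler_prod q"
    unfolding euler_prod_def using convergent_prod_LIMSEQ by force
  hence "(\<lambda>n. (\<Sum>k\<le>Suc n. d k) * (\<Prod>k\<le>n. 1 - q ^ Suc k)) \<longlonglongrightarrow> partition_gf q * euler_prod q"
    using lim LIMSEQ_Suc tendsto_mult by blast
  moreover have "(\<Sum>k\<le>Suc n. d k) * (\<Prod>k\<le>n. 1 - q ^ Suc k) = 1" for n
    using p[of "Suc n"] by (simp only: lessThan_Suc_atMost)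
  ultimately show ?thesis by (simp add: LIMSEQ_const_iff)
qed

lemma partition_gf_nome:
  assumes "Im \<tau> > 0"
  shows "partition_gf (nome \<tau>) * euler_prod (nome \<tau>) = 1"
  using partition_gf_euler norm_nome_less_1[OF assms] vacuum_sum(1)[OF assms] by blast

text \<open>With w the weight of a particle this is w / (1 + w), for both signs of \<open>s\<close>:
  at a negative site a vacancy has weight 1 / w relative to an occupied site.\<close>

definition occupation :: "complex \<Rightarrow> complex \<Rightarrow> int \<Rightarrow> complex" where
  "occupation \<tau> c s = - exp c * nome \<tau> powi s / (1 - exp c * nome \<tau> powi s)"

text \<open>By the triple product \<open>theta_num \<tau> c\<close> is, up to nonzero factors, the
  product of all \<open>1 + site_weight \<tau> c s\<close>, and a nonzero product has no zero
  factor.\<close>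

lemma one_plus_site_weight:
  assumes "Im \<tau> > 0" "theta_num \<tau> c \<noteq> 0"
  shows "subset_sum (site_weight \<tau> c) {} \<noteq> 0" "1 + site_weight \<tau> c s \<noteq> 0"
proof -
  show *: "subset_sum (site_weight \<tau> c) {} \<noteq> 0"
    using vacuum_sum(2)[OF assms(1), of c] assms partition_gf_nome[OF assms(1)] by auto
  show "1 + site_weight \<tau> c s \<noteq> 0"
    using subset_sum_insert[OF site_weight_summable[OF assms(1)], of s "{}" c] * by auto
qed

lemma occupation_denominator:
  assumes "Im \<tau> > 0" "theta_num \<tau> c \<noteq> 0"
  shows "1 - exp c * nome \<tau> powi s \<noteq> 0"
proof (cases "s \<ge> 0")
  case True
  thus ?thesis using one_plus_site_weight(2)[OF assms, of s] by (simp add: site_weight_def)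
next
  case False
  hence sw: "site_weight \<tau> c s = inverse (- (exp c * nome \<tau> powi s))" by (simp add: site_weight_def)
  show ?thesis
  proof
    assume "1 - exp c * nome \<tau> powi s = 0"
    hence "exp c * nome \<tau> powi s = 1" by simp
    hence "1 + site_weight \<tau> c s = 0" unfolding sw by simp
    thus False using one_plus_site_weight(2)[OF assms] by simp
  qed
qed

text \<open>Sites are independent, so demanding that all of \<open>J\<close> be occupied multiplies
  the full sum by one occupation number per site.\<close>

lemma site_weight_occupation:
  assumes "Im \<tau> > 0" "theta_num \<tau> c \<noteq> 0" "finite J"
  shows "(\<Prod>s\<in>{s\<in>J. s \<ge> 0}. site_weight \<tau> c s) * subset_sum (site_weight \<tau> c) J =
    (\<Prod>s\<in>J. occupation \<tau> c s) * subset_sum (site_weight \<tau> c) {}"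
proof -
  let ?r = "site_weight \<tau> c"
  have occ: "occupation \<tau> c s * (1 + ?r s) = (if s \<ge> 0 then ?r s else 1)" for s
    using occupation_denominator[OF assms(1,2), of s] by (auto simp: occupation_def site_weight_def field_simps)
  have "(\<Prod>s\<in>{s\<in>J. s \<ge> 0}. ?r s) = (\<Prod>s\<in>J. if s \<ge> 0 then ?r s else 1)"
    using assms(3) by (simp add: prod.inter_filter)
  also have "\<dots> = (\<Prod>s\<in>J. occupation \<tau> c s) * (\<Prod>s\<in>J. 1 + ?r s)"
    by (simp only: occ[symmetric] prod.distrib)
  finally show ?thesis
    using subset_sum_union[OF site_weight_summable[OF assms(1)] assms(3), of "{}" c] by simp
qed

section \<open>Strips of absolute convergence of the cycle sums\<close>

definition width :: "complex \<Rightarrow> real" where "width \<tau> = 2 * pi * Im \<tau>"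

text \<open>The minimum of a cycle is an ascent, and the maximum is a descent unless it is fixed.
  Thus every cycle carries a factor p, and every nontrivial one also a factor p - 1.\<close>

lemma card_ascents:
  fixes \<sigma> :: "'n::{finite,linorder} \<Rightarrow> 'n"
  assumes \<sigma>: "\<sigma> permutes UNIV" and C: "C \<in> cycles_of \<sigma>"
  shows "card {i\<in>C. i \<le> \<sigma> i} \<ge> 1"
    and "(\<exists>i. C = {i} \<and> \<sigma> i = i) \<or> (\<forall>i\<in>C. \<sigma> i \<noteq> i) \<and> card {i\<in>C. \<sigma> i < i} \<ge> 1"
proof -
  obtain j where j: "C = orbit \<sigma> j" using C by (auto simp: cycles_of_def)
  have ne: "C \<noteq> {}" using orbit_refl[OF \<sigma>, of j] j by auto
  have cl: "\<sigma> i \<in> C" if "i \<in> C" for i using that j by (auto intro: orbit.step)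
  have "Min C \<le> \<sigma> (Min C)" using Min_in[OF _ ne] cl by (intro Min_le) auto
  hence "Min C \<in> {i\<in>C. i \<le> \<sigma> i}" using Min_in[OF _ ne] by auto
  thus "card {i\<in>C. i \<le> \<sigma> i} \<ge> 1" by (metis One_nat_def Suc_leI card_gt_0_iff empty_iff finite)
  show "(\<exists>i. C = {i} \<and> \<sigma> i = i) \<or> (\<forall>i\<in>C. \<sigma> i \<noteq> i) \<and> card {i\<in>C. \<sigma> i < i} \<ge> 1"
  proof (cases "\<exists>i\<in>C. \<sigma> i = i")
    case True
    then obtain i where i: "i \<in> C" "\<sigma> i = i" by blast
    hence "C = {i}" using orbit_eq_of_mem[OF \<sigma>] orbit_eq_singleton_iff j by metis
    thus ?thesis using i by blast
  next
    case False
    have "\<sigma> (Max C) \<le> Max C" using Max_in[OF _ ne] cl by (intro Max_ge) auto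
    hence "Max C \<in> {i\<in>C. \<sigma> i < i}" using Max_in[OF _ ne] False by (auto simp: less_le)
    hence "card {i\<in>C. \<sigma> i < i} \<ge> 1" by (metis One_nat_def Suc_leI card_gt_0_iff empty_iff finite)
    thus ?thesis using False by blast
  qed
qed

lemma cycle_product:
  fixes \<sigma> :: "'n::{finite,linorder} \<Rightarrow> 'n" and z :: "'n \<Rightarrow> complex"
  shows "(\<Prod>i\<in>C. exp (z i * of_int k) * order_weight p i (\<sigma> i) k) =
    exp ((\<Sum>i\<in>C. z i) * of_int k) * p k ^ card {i\<in>C. i \<le> \<sigma> i} * (p k - 1) ^ card {i\<in>C. \<sigma> i < i}"
proof -
  have "C = {i\<in>C. i \<le> \<sigma> i} \<union> {i\<in>C. \<sigma> i < i}" by auto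
  hence "(\<Prod>i\<in>C. order_weight p i (\<sigma> i) k) =
      (\<Prod>i\<in>{i\<in>C. i \<le> \<sigma> i} \<union> {i\<in>C. \<sigma> i < i}. order_weight p i (\<sigma> i) k)" by simp
  also have "\<dots> = (\<Prod>i\<in>{i\<in>C. i \<le> \<sigma> i}. order_weight p i (\<sigma> i) k) * (\<Prod>i\<in>{i\<in>C. \<sigma> i < i}. order_weight p i (\<sigma> i) k)"
    by (rule prod.union_disjoint) auto
  also have "(\<Prod>i\<in>{i\<in>C. i \<le> \<sigma> i}. order_weight p i (\<sigma> i) k) = (\<Prod>i\<in>{i\<in>C. i \<le> \<sigma> i}. p k)"
    by (rule prod.cong) (auto simp: order_weight_def)
  also have "(\<Prod>i\<in>{i\<in>C. \<sigma> i < i}. order_weight p i (\<sigma> i) k) = (\<Prod>i\<in>{i\<in>C. \<sigma> i < i}. p k - 1)"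
    by (rule prod.cong) (auto simp: order_weight_def)
  finally show ?thesis
    by (simp add: prod.distrib exp_sum sum_distrib_right)
qed

text \<open>p decays like |q|^k to the right and p - 1 like |q|^|k| to the left, so the powers
  extend the strip to \<open>a\<close> widths on the right and \<open>b\<close> widths on the
  left.\<close>

lemma exp_power_summable:
  fixes p :: "int \<Rightarrow> complex" and x :: complex and C :: real
  assumes \<tau>: "Im \<tau> > 0" and C: "\<And>k. norm (p k) \<le> C" "\<And>k. norm (p k - 1) \<le> C"
    "\<And>k. k \<ge> 0 \<Longrightarrow> norm (p k) \<le> C * norm (nome \<tau>) ^ nat k"
    "\<And>k. k < 0 \<Longrightarrow> b > 0 \<Longrightarrow> norm (p k - 1) \<le> C * norm (nome \<tau>) ^ nat (- k)"
    and x: "- (real b * width \<tau>) < Re x" "Re x < real a * width \<tau>"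
  shows "(\<lambda>k. norm (exp (x * of_int k) * p k ^ a * (p k - 1) ^ b)) summable_on UNIV"
proof (rule summable_on_int_geometric)
  define \<alpha> where "\<alpha> = exp (Re x - real a * width \<tau>)"
  define \<beta> where "\<beta> = exp (- Re x - real b * width \<tau>)"
  show "0 \<le> \<alpha>" "\<alpha> < 1" "0 \<le> \<beta>" "\<beta> < 1" using x by (auto simp: \<alpha>_def \<beta>_def)
  have C0: "C \<ge> 0" using C(1)[of 0] norm_ge_zero order_trans by blast
  have q: "norm (nome \<tau>) = exp (- width \<tau>)" by (simp add: norm_nome width_def)
  fix n
  have "norm (exp (x * of_int (int n)) * p (int n) ^ a * (p (int n) - 1) ^ b) \<le>
      exp (Re x * n) * (C * norm (nome \<tau>) ^ n) ^ a * C ^ b"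
    unfolding norm_mult norm_power using C(2,3)[of "int n"] C0
    by (intro mult_mono power_mono) (auto simp: norm_exp_eq_Re)
  also have "\<dots> = C ^ (a + b) * \<alpha> ^ n"
    by (simp add: q \<alpha>_def power_mult_distrib power_add mult_ac flip: exp_of_nat_mult exp_add) (simp add: algebra_simps flip: exp_add)
  finally show "norm (exp (x * of_int (int n)) * p (int n) ^ a * (p (int n) - 1) ^ b) \<le> C ^ (a + b) * \<alpha> ^ n" .
  define k where "k = - int n - 1"
  have k: "k < 0" "nat (- k) = Suc n" by (auto simp: k_def)
  have 1: "norm ((p k - 1) ^ b) \<le> (C * exp (- width \<tau>) ^ Suc n) ^ b"
  proof (cases "b = 0")
    case False
    thus ?thesis using C(4)[of k] k by (simp add: norm_power q power_mono del: power_Suc)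
  qed simp
  have "norm (exp (x * of_int k) * p k ^ a * (p k - 1) ^ b) \<le>
      exp (Re x * of_int k) * C ^ a * (C * exp (- width \<tau>) ^ Suc n) ^ b"
    unfolding norm_mult using C(1)[of k] 1 C0
    by (intro mult_mono) (auto simp: norm_exp_eq_Re norm_power power_mono)
  also have "\<dots> = C ^ (a + b) * \<beta> ^ Suc n"
    by (simp add: \<beta>_def k_def power_mult_distrib power_add mult_ac del: power_Suc flip: exp_of_nat_mult exp_add) (simp add: algebra_simps flip: exp_add)
  also have "\<dots> \<le> C ^ (a + b) * \<beta> ^ n"
    using \<open>0 \<le> \<beta>\<close> \<open>\<beta> < 1\<close> C0 by (intro mult_left_mono power_decreasing) auto
  finally show "norm (exp (x * of_int (- int n - 1)) * p (- int n - 1) ^ a * (p (- int n - 1) - 1) ^ b) \<le> C ^ (a + b) * \<beta> ^ n"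
    by (simp add: k_def)
qed

text \<open>\<open>level_sum_cycles\<close> is applied with absolute values in place of occupation
  numbers; \<open>b\<close> is 1 on negative sites, where the product of weights has no
  factor.\<close>

lemma site_weight_levels_summable:
  fixes z :: "complex ^ 'n::{finite,linorder}"
  assumes \<tau>: "Im \<tau> > 0" and z: "\<And>i. Re (z $ i) > 0" "Re (\<Sum>i\<in>UNIV. z $ i) < width \<tau>"
  shows "(\<lambda>m::'n \<Rightarrow> int. norm (\<Prod>i\<in>UNIV. exp (z $ i * of_int (m i))) *
      (\<Prod>s\<in>{s\<in>range m. s \<ge> 0}. norm (site_weight \<tau> c s))) summable_on UNIV"
proof -
  define b where "b = (\<lambda>s. if s \<ge> 0 then complex_of_real (norm (site_weight \<tau> c s)) else 1)"
  define C where "C = norm (exp c) + 1"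
  have bC: "norm (b k) \<le> norm (exp c) * norm (nome \<tau>) ^ nat k" if "k \<ge> 0" for k
    using that by (simp add: b_def site_weight_def norm_mult norm_power power_int_def)
  have b1: "norm (b k) \<le> C" for k
  proof (cases "k \<ge> 0")
    case True
    have "norm (exp c) * norm (nome \<tau>) ^ nat k \<le> norm (exp c) * 1"
      using norm_nome_less_1[OF \<tau>] by (intro mult_left_mono power_le_one) auto
    thus ?thesis using bC[OF True] unfolding C_def by linarith
  qed (simp add: b_def C_def)
  have cyc: "(\<lambda>k. norm (\<Prod>i\<in>D. exp (z $ i * of_int k) * order_weight b i (\<sigma> i) k)) summable_on UNIV"
    if \<sigma>: "\<sigma> permutes UNIV" "D \<in> cycles_of \<sigma>" for \<sigma> D
  proof -
    have "D \<noteq> {}" using that orbit_refl[OF that(1)] by (auto simp: cycles_of_def)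
    have "Re (\<Sum>i\<in>D. z $ i) > 0" using z \<open>D \<noteq> {}\<close> by (auto intro!: sum_pos)
    moreover have "Re (\<Sum>i\<in>D. z $ i) \<le> Re (\<Sum>i\<in>UNIV. z $ i)"
      unfolding Re_sum using z by (intro sum_mono2) (auto intro: less_imp_le)
    moreover note z(2)
    moreover have a: "card {i\<in>D. i \<le> \<sigma> i} \<ge> 1" by (rule card_ascents[OF \<sigma>])
    moreover have "1 * width \<tau> \<le> real (card {i\<in>D. i \<le> \<sigma> i}) * width \<tau>" using \<tau> a
      by (intro mult_right_mono) (auto simp: width_def)
    ultimately have x: "Re (\<Sum>i\<in>D. z $ i) > 0" "Re (\<Sum>i\<in>D. z $ i) < real (card {i\<in>D. i \<le> \<sigma> i}) * width \<tau>"
      by linarith+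
    let ?b = "card {i\<in>D. \<sigma> i < i}"
    \<comment> \<open>The powers of \<open>b k - 1\<close> are bounded and put back afterwards;
      positivity of the real part already gives decay to the left.\<close>
    have s: "(\<lambda>k. norm (exp ((\<Sum>i\<in>D. z $ i) * of_int k) * b k ^ card {i\<in>D. i \<le> \<sigma> i} * (b k - 1) ^ 0)) summable_on UNIV"
    proof (rule exp_power_summable[OF \<tau>, where C = "C + 1"])
      fix k show "norm (b k) \<le> C + 1" using b1[of k] by simp
      show "norm (b k - 1) \<le> C + 1" using b1[of k] norm_triangle_ineq4[of "b k" 1] by simp
      assume "k \<ge> 0"
      have "norm (exp c) * norm (nome \<tau>) ^ nat k \<le> (C + 1) * norm (nome \<tau>) ^ nat k"
        by (intro mult_right_mono) (auto simp: C_def)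
      thus "norm (b k) \<le> (C + 1) * norm (nome \<tau>) ^ nat k" using bC[OF \<open>k \<ge> 0\<close>] by linarith
    qed (use x in auto)
    show ?thesis unfolding cycle_product
    proof (rule summable_on_comparison_test[OF summable_on_cmult_left[OF s, of "(C + 1) ^ ?b"]])
      fix k
      have "norm (b k - 1) \<le> C + 1" using b1[of k] norm_triangle_ineq4[of "b k" 1] by simp
      hence "norm ((b k - 1) ^ ?b) \<le> (C + 1) ^ ?b" unfolding norm_power by (intro power_mono) auto
      thus "norm (exp ((\<Sum>i\<in>D. z $ i) * of_int k) * b k ^ card {i\<in>D. i \<le> \<sigma> i} * (b k - 1) ^ ?b) \<le>
          norm (exp ((\<Sum>i\<in>D. z $ i) * of_int k) * b k ^ card {i\<in>D. i \<le> \<sigma> i} * (b k - 1) ^ 0) * (C + 1) ^ ?b"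
        by (auto simp: norm_mult intro!: mult_left_mono)
    qed auto
  qed
  have "(\<lambda>m::'n \<Rightarrow> int. norm ((\<Prod>i\<in>UNIV. exp (z $ i * of_int (m i))) * (\<Prod>s\<in>range m. b s))) summable_on UNIV"
    by (rule level_sum_cycles(1)) (rule cyc)
  moreover have "norm (\<Prod>s\<in>range m. b s) = (\<Prod>s\<in>{s\<in>range m. s \<ge> 0}. norm (site_weight \<tau> c s))" for m :: "'n \<Rightarrow> int"
  proof -
    have "norm (\<Prod>s\<in>range m. b s) = (\<Prod>s\<in>range m. if s \<ge> 0 then norm (site_weight \<tau> c s) else 1)"
      unfolding prod_norm[symmetric] by (intro prod.cong) (auto simp: b_def)
    thus ?thesis by (simp add: prod.inter_filter)
  qed
  ultimately show ?thesis by (simp add: norm_mult)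
qed


section \<open>The Kronecker function\<close>

lemma trace_formula:
  fixes z :: "complex ^ 'n::{finite,linorder}"
  assumes \<tau>: "Im \<tau> > 0" and z: "\<And>i. Re (z $ i) > 0" "Re (\<Sum>i\<in>UNIV. z $ i) < width \<tau>"
    and c: "theta_num \<tau> c \<noteq> 0"
  shows "theta_num \<tau> (c + (\<Sum>i\<in>UNIV. z $ i)) * (\<Sum>\<^sub>\<infinity>lam\<in>int_partitions. trace_term \<tau> z lam) =
    theta_num \<tau> c * partition_gf (nome \<tau>) *
      (\<Sum>\<^sub>\<infinity>m. (\<Prod>i\<in>UNIV. exp (z $ i * of_int (m i))) * (\<Prod>s\<in>range m. occupation \<tau> c s))"
proof -
  let ?W = "subset_sum (site_weight \<tau> c) {}"
  let ?S = "\<Sum>\<^sub>\<infinity>m. (\<Prod>i\<in>UNIV. exp (z $ i * of_int (m i))) * (\<Prod>s\<in>range m. occupation \<tau> c s)"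
  have "theta_scale \<tau> * exp (c / 2) * theta_num \<tau> (c + (\<Sum>i\<in>UNIV. z $ i)) * (\<Sum>\<^sub>\<infinity>lam\<in>int_partitions. trace_term \<tau> z lam) =
      (\<Sum>\<^sub>\<infinity>m. ((\<Prod>i\<in>UNIV. exp (z $ i * of_int (m i))) * (\<Prod>s\<in>range m. occupation \<tau> c s)) * ?W)"
    using fock_trace(2)[OF \<tau> z(1) site_weight_levels_summable[OF \<tau> z, of c]]
    by (simp add: site_weight_occupation[OF \<tau> c] mult.assoc)
  also have "\<dots> = ?S * ?W" by (rule infsum_cmult_left')
  also have "?W = theta_scale \<tau> * exp (c / 2) * (theta_num \<tau> c * partition_gf (nome \<tau>))"
    by (simp add: vacuum_sum(2)[OF \<tau>])
  finally have "(theta_scale \<tau> * exp (c / 2)) * (theta_num \<tau> (c + (\<Sum>i\<in>UNIV. z $ i)) * (\<Sum>\<^sub>\<infinity>lam\<in>int_partitions. trace_term \<tau> z lam)) =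
      (theta_scale \<tau> * exp (c / 2)) * (theta_num \<tau> c * partition_gf (nome \<tau>) * ?S)"
    by (simp only: mult_ac)
  thus ?thesis by simp
qed

lemma bij_unit_functions: "bij_betw (\<lambda>k _. k) UNIV (UNIV :: (unit \<Rightarrow> 'k) set)"
  by (rule bij_betwI[of _ _ _ "\<lambda>m. m ()"]) auto

text \<open>At \<open>c = 0\<close> only the site 0 survives in the sum over sites: if another site
  is singled out, the vanishing factor of site 0 remains. This makes the one-point function a
  constant over theta.\<close>

lemma one_point_trace:
  assumes \<tau>: "Im \<tau> > 0" and x: "0 < Re x" "Re x < width \<tau>"
  shows "theta_num \<tau> x * (\<Sum>\<^sub>\<infinity>lam\<in>int_partitions. trace_term \<tau> (\<chi> _::unit. x) lam) = partition_gf (nome \<tau>) * theta_den \<tau>"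
proof -
  let ?r = "site_weight \<tau> 0"
  let ?F = "\<Sum>\<^sub>\<infinity>lam\<in>int_partitions. trace_term \<tau> (\<chi> _::unit. x) lam"
  have z: "\<And>i::unit. Re ((\<chi> _::unit. x) $ i) > 0" "Re (\<Sum>i\<in>UNIV. (\<chi> _::unit. x) $ i) < width \<tau>"
    using x by (simp_all add: UNIV_unit)
  have "theta_scale \<tau> * theta_num \<tau> x * ?F =
      (\<Sum>\<^sub>\<infinity>m::unit \<Rightarrow> int. exp (x * of_int (m ())) * ((\<Prod>s\<in>{s\<in>range m. s \<ge> 0}. ?r s) * subset_sum ?r (range m)))"
    using fock_trace(2)[OF \<tau> z(1) site_weight_levels_summable[OF \<tau> z, of 0]] by (simp add: UNIV_unit)
  also have "\<dots> = (\<Sum>\<^sub>\<infinity>k. exp (x * of_int k) * ((\<Prod>s\<in>{s\<in>{k}. s \<ge> 0}. ?r s) * subset_sum ?r {k}))"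
    using infsum_reindex_bij_betw[OF bij_unit_functions, of "\<lambda>m. exp (x * of_int (m ())) *
      ((\<Prod>s\<in>{s\<in>range m. s \<ge> 0}. ?r s) * subset_sum ?r (range m))"] by (simp add: UNIV_unit)
  also have "\<dots> = (\<Sum>\<^sub>\<infinity>k\<in>{0}. exp (x * of_int k) * ((\<Prod>s\<in>{s\<in>{k}. s \<ge> 0}. ?r s) * subset_sum ?r {k}))"
    using subset_sum_eq_zero[OF site_weight_summable[OF \<tau>] site_weight_0]
    by (intro infsum_cong_neutral) auto
  also have "\<dots> = - subset_sum ?r {0}"
    by (simp add: site_weight_0 Collect_conv_if)
  finally have "theta_scale \<tau> * (theta_num \<tau> x * ?F) = theta_scale \<tau> * (partition_gf (nome \<tau>) * theta_den \<tau>)"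
    using partition_gf_theta_den[OF \<tau>] by (simp add: mult_ac)
  thus ?thesis by simp
qed

lemma theta_num_nonzero_strip:
  assumes "Im \<tau> > 0" "0 < Re x" "Re x < width \<tau>"
  shows "theta_num \<tau> x \<noteq> 0"
  using one_point_trace[OF assms] theta_den_nonzero[OF assms(1)] partition_gf_nome[OF assms(1)] by auto

text \<open>Particle-hole symmetry: a vacancy at \<open>s\<close> for \<open>c\<close> is a particle
  at \<open>- s\<close> for \<open>- c\<close>.\<close>

lemma occupation_reflect:
  assumes "1 - exp c * nome \<tau> powi s \<noteq> 0"
  shows "occupation \<tau> c s - 1 = - occupation \<tau> (- c) (- s)"
proof -
  define w where "w = exp c * nome \<tau> powi s"
  have w: "w \<noteq> 0" "1 - w \<noteq> 0" "exp (- c) * nome \<tau> powi (- s) = inverse w"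
    using assms by (auto simp: w_def exp_minus power_int_minus)
  have "1 - inverse w \<noteq> 0" using w by (auto simp: field_simps)
  hence "- inverse w / (1 - inverse w) = 1 / (1 - w)" using w(1,2) by (simp add: field_simps)
  moreover have "occupation \<tau> c s = - w / (1 - w)" "occupation \<tau> (- c) (- s) = - inverse w / (1 - inverse w)"
    unfolding occupation_def mult_minus_left w(3) w_def by simp_all
  moreover have "- w / (1 - w) - 1 = - (1 / (1 - w))" using w(2) by (simp add: field_simps)
  ultimately show ?thesis by simp
qed

text \<open>For large \<open>n\<close> the term \<open>exp c * nome \<tau> ^ n\<close> has norm at
  most 1/2 on \<open>K\<close>; the finitely many remaining \<open>n\<close> are handled by
  compactness.\<close>

lemma occupation_denominator_bound:
  assumes \<tau>: "Im \<tau> > 0" and K: "compact K" "\<And>c. c \<in> K \<Longrightarrow> theta_num \<tau> c \<noteq> 0"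
  shows "\<exists>\<delta>>0. \<forall>c\<in>K. \<forall>n. \<delta> \<le> norm (1 - exp c * nome \<tau> ^ n)"
proof -
  obtain R where R: "\<And>c. c \<in> K \<Longrightarrow> norm c \<le> R" using compact_imp_bounded[OF K(1)] by (auto simp: bounded_iff)
  have qlt: "norm (nome \<tau>) < 1" by (rule norm_nome_less_1[OF \<tau>])
  obtain N where N: "norm (nome \<tau>) ^ N < exp (- R) / 2" using real_arch_pow_inv[OF _ qlt, of "exp (- R) / 2"] by auto
  have large: "1/2 \<le> norm (1 - exp c * nome \<tau> ^ n)" if "c \<in> K" "N \<le> n" for c n
  proof -
    have "norm (exp c * nome \<tau> ^ n) \<le> exp R * (exp (- R) / 2)"
      unfolding norm_mult norm_power
    proof (intro mult_mono)
      show "norm (exp c) \<le> exp R" using R[OF that(1)] abs_Re_le_cmod[of c] by (simp add: norm_exp_eq_Re)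
      show "norm (nome \<tau>) ^ n \<le> exp (- R) / 2" using N power_decreasing[OF that(2), of "norm (nome \<tau>)"] qlt norm_ge_zero[of "nome \<tau>"] by linarith
    qed auto
    also have "\<dots> = 1/2" by (simp add: exp_minus)
    finally show ?thesis using norm_triangle_ineq2[of 1 "exp c * nome \<tau> ^ n"] by simp
  qed
  have "\<exists>\<delta>>0. \<forall>c\<in>K. \<delta> \<le> norm (1 - exp c * nome \<tau> ^ n)" for n
  proof (cases "K = {}")
    case False
    have "continuous_on K (\<lambda>c. norm (1 - exp c * nome \<tau> ^ n))" by (intro continuous_intros)
    then obtain c0 where c0: "c0 \<in> K" "\<forall>c\<in>K. norm (1 - exp c0 * nome \<tau> ^ n) \<le> norm (1 - exp c * nome \<tau> ^ n)"
      using continuous_attains_inf[OF K(1) False] by blast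
    have "norm (1 - exp c0 * nome \<tau> ^ n) > 0" using occupation_denominator[OF \<tau> K(2)[OF c0(1)], of "int n"] by simp
    thus ?thesis using c0 by (intro exI[of _ "norm (1 - exp c0 * nome \<tau> ^ n)"]) simp
  next
    case True
    thus ?thesis by (intro exI[of _ 1]) simp
  qed
  then obtain d where d: "\<And>n. d n > 0" "\<And>n c. c \<in> K \<Longrightarrow> d n \<le> norm (1 - exp c * nome \<tau> ^ n)" by metis
  define \<delta> where "\<delta> = Min (insert (1/2) (d ` {..<N}))"
  have "\<delta> > 0" unfolding \<delta>_def using d by (subst Min_gr_iff) auto
  moreover have "\<delta> \<le> norm (1 - exp c * nome \<tau> ^ n)" if c: "c \<in> K" for c n
  proof (cases "n < N")
    case True
    hence "\<delta> \<le> d n" unfolding \<delta>_def by (intro Min_le) auto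
    thus ?thesis using d(2)[OF c, of n] by simp
  next
    case False
    have "\<delta> \<le> 1/2" unfolding \<delta>_def by (intro Min_le) auto
    moreover have "1/2 \<le> norm (1 - exp c * nome \<tau> ^ n)" using False by (intro large[OF c]) simp
    ultimately show ?thesis by linarith
  qed
  ultimately show ?thesis by blast
qed

lemma occupation_bound_nonneg:
  assumes \<tau>: "Im \<tau> > 0" and K: "compact K" "\<And>c. c \<in> K \<Longrightarrow> theta_num \<tau> c \<noteq> 0"
  shows "\<exists>C\<ge>0. \<forall>c\<in>K. \<forall>n. norm (occupation \<tau> c (int n)) \<le> C * norm (nome \<tau>) ^ n"
proof -
  obtain R where R: "\<And>c. c \<in> K \<Longrightarrow> norm c \<le> R" using compact_imp_bounded[OF K(1)] by (auto simp: bounded_iff)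
  obtain \<delta> where \<delta>: "\<delta> > 0" "\<forall>c\<in>K. \<forall>n. \<delta> \<le> norm (1 - exp c * nome \<tau> ^ n)"
    using occupation_denominator_bound[OF assms] by blast
  have "norm (occupation \<tau> c (int n)) \<le> exp R / \<delta> * norm (nome \<tau>) ^ n" if c: "c \<in> K" for c n
  proof -
    have "norm (exp c) \<le> exp R" using R[OF c] abs_Re_le_cmod[of c] by (simp add: norm_exp_eq_Re)
    hence "norm (exp c) * norm (nome \<tau>) ^ n / norm (1 - exp c * nome \<tau> ^ n) \<le> exp R * norm (nome \<tau>) ^ n / \<delta>"
      using \<delta> c by (intro frac_le mult_right_mono) auto
    thus ?thesis by (simp add: occupation_def norm_divide norm_mult norm_power del: norm_exp_eq_Re)
  qed
  thus ?thesis using \<delta>(1) by (intro exI[of _ "exp R / \<delta>"]) auto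
qed

text \<open>The decay hypotheses of \<open>exp_power_summable\<close> with one constant, in a form
  that can be asked uniformly in \<open>c\<close>.\<close>

definition occ_bound :: "complex \<Rightarrow> complex \<Rightarrow> real \<Rightarrow> bool" where
  "occ_bound \<tau> c C \<longleftrightarrow> (\<forall>k. norm (occupation \<tau> c k) \<le> C \<and> norm (occupation \<tau> c k - 1) \<le> C \<and>
     (k \<ge> 0 \<longrightarrow> norm (occupation \<tau> c k) \<le> C * norm (nome \<tau>) ^ nat k) \<and>
     (k < 0 \<longrightarrow> norm (occupation \<tau> c k - 1) \<le> C * norm (nome \<tau>) ^ nat (- k)))"

lemma occ_bound_compact:
  assumes \<tau>: "Im \<tau> > 0" and K: "compact K" "\<And>c. c \<in> K \<Longrightarrow> theta_num \<tau> c \<noteq> 0"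
  shows "\<exists>C. \<forall>c\<in>K. occ_bound \<tau> c C"
proof -
  obtain C1 where C1: "C1 \<ge> 0" "\<forall>c\<in>K. \<forall>n. norm (occupation \<tau> c (int n)) \<le> C1 * norm (nome \<tau>) ^ n"
    using occupation_bound_nonneg[OF assms] by blast
  have "compact (uminus ` K)" by (intro compact_continuous_image K continuous_intros)
  moreover have "theta_num \<tau> c \<noteq> 0" if "c \<in> uminus ` K" for c using that K(2) by (auto simp: theta_num_minus)
  ultimately obtain C2 where C2: "C2 \<ge> 0" "\<forall>c\<in>uminus ` K. \<forall>n. norm (occupation \<tau> c (int n)) \<le> C2 * norm (nome \<tau>) ^ n"
    using occupation_bound_nonneg[OF \<tau>, of "uminus ` K"] by blast
  have q: "norm (nome \<tau>) ^ n \<le> 1" for n using norm_nome_less_1[OF \<tau>] by (intro power_le_one) auto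
  have "occ_bound \<tau> c (C1 + C2 + 1)" if c: "c \<in> K" for c
    unfolding occ_bound_def
  proof
    fix k
    show "norm (occupation \<tau> c k) \<le> C1 + C2 + 1 \<and> norm (occupation \<tau> c k - 1) \<le> C1 + C2 + 1 \<and>
     (k \<ge> 0 \<longrightarrow> norm (occupation \<tau> c k) \<le> (C1 + C2 + 1) * norm (nome \<tau>) ^ nat k) \<and>
     (k < 0 \<longrightarrow> norm (occupation \<tau> c k - 1) \<le> (C1 + C2 + 1) * norm (nome \<tau>) ^ nat (- k))"
    proof (cases "k \<ge> 0")
      case True
      hence 1: "norm (occupation \<tau> c k) \<le> C1 * norm (nome \<tau>) ^ nat k" using C1(2) c by (metis nat_0_le)
      moreover have "C1 * norm (nome \<tau>) ^ nat k \<le> C1 * 1" using C1(1) q by (intro mult_left_mono)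
      moreover have "C1 * norm (nome \<tau>) ^ nat k \<le> (C1 + C2 + 1) * norm (nome \<tau>) ^ nat k"
        using C2(1) by (intro mult_right_mono) auto
      ultimately show ?thesis using True C2(1) norm_triangle_ineq4[of "occupation \<tau> c k" 1, unfolded norm_one]
        by (intro conjI impI; linarith)
    next
      case False
      have "norm (occupation \<tau> c k - 1) = norm (occupation \<tau> (- c) (int (nat (- k))))"
        using occupation_reflect[OF occupation_denominator[OF \<tau> K(2)[OF c]], of k] False by simp
      also have "\<dots> \<le> C2 * norm (nome \<tau>) ^ nat (- k)" using C2(2) c by blast
      finally have 1: "norm (occupation \<tau> c k - 1) \<le> C2 * norm (nome \<tau>) ^ nat (- k)" .
      moreover have "C2 * norm (nome \<tau>) ^ nat (- k) \<le> C2 * 1" using C2(1) q by (intro mult_left_mono)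
      moreover have "C2 * norm (nome \<tau>) ^ nat (- k) \<le> (C1 + C2 + 1) * norm (nome \<tau>) ^ nat (- k)"
        using C1(1) by (intro mult_right_mono) auto
      ultimately show ?thesis using False C1(1) norm_triangle_ineq[of "occupation \<tau> c k - 1" 1, unfolded diff_add_cancel norm_one]
        by (intro conjI impI; linarith)
    qed
  qed
  thus ?thesis by blast
qed

lemma occ_bound_exists:
  assumes "Im \<tau> > 0" "theta_num \<tau> c \<noteq> 0"
  obtains C where "occ_bound \<tau> c C"
  using occ_bound_compact[OF assms(1), of "{c}"] assms(2) by auto

lemma exp_occupation_summable:
  assumes \<tau>: "Im \<tau> > 0" and c: "theta_num \<tau> c \<noteq> 0"
    and x: "- (real b * width \<tau>) < Re x" "Re x < real a * width \<tau>"
  shows "(\<lambda>k. norm (exp (x * of_int k) * occupation \<tau> c k ^ a * (occupation \<tau> c k - 1) ^ b)) summable_on UNIV"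
proof -
  obtain C where "occ_bound \<tau> c C" using occ_bound_exists[OF \<tau> c] .
  thus ?thesis using x by (intro exp_power_summable[OF \<tau>, where C = C]) (auto simp: occ_bound_def)
qed

definition kronecker :: "complex \<Rightarrow> complex \<Rightarrow> complex \<Rightarrow> complex" where
  "kronecker \<tau> c x = theta \<tau> (c + x) / (theta \<tau> c * theta \<tau> x)"

lemma kronecker_eq:
  assumes "Im \<tau> > 0"
  shows "kronecker \<tau> c x = theta_num \<tau> (c + x) * theta_den \<tau> / (theta_num \<tau> c * theta_num \<tau> x)"
  using theta_den_nonzero[OF assms] by (simp add: kronecker_def theta_eq field_simps)

text \<open>The one-point trace does not involve \<open>c\<close>. It is eliminated between
  \<open>trace_formula\<close> at \<open>c\<close> and \<open>one_point_trace\<close>, which was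
  evaluated at \<open>c = 0\<close>.\<close>

lemma kronecker_expansion:
  assumes \<tau>: "Im \<tau> > 0" and x: "0 < Re x" "Re x < width \<tau>" and c: "theta_num \<tau> c \<noteq> 0"
  shows "((\<lambda>k. exp (x * of_int k) * occupation \<tau> c k) has_sum kronecker \<tau> c x) UNIV"
proof -
  let ?F = "\<Sum>\<^sub>\<infinity>lam\<in>int_partitions. trace_term \<tau> (\<chi> _::unit. x) lam"
  let ?S = "\<Sum>\<^sub>\<infinity>k. exp (x * of_int k) * occupation \<tau> c k"
  have z: "\<And>i::unit. Re ((\<chi> _::unit. x) $ i) > 0" "Re (\<Sum>i\<in>UNIV. (\<chi> _::unit. x) $ i) < width \<tau>"
    using x by (simp_all add: UNIV_unit)
  have eq: "(\<Sum>\<^sub>\<infinity>m::unit \<Rightarrow> int. exp (x * of_int (m ())) * occupation \<tau> c (m ())) = ?S"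
    using infsum_reindex_bij_betw[OF bij_unit_functions, of "\<lambda>m. exp (x * of_int (m ())) * occupation \<tau> c (m ())"] by simp
  have 1: "theta_num \<tau> (c + x) * ?F = theta_num \<tau> c * partition_gf (nome \<tau>) * ?S"
    unfolding eq[symmetric] using trace_formula[OF \<tau> z c] by (simp add: UNIV_unit)
  have P: "partition_gf (nome \<tau>) \<noteq> 0" using partition_gf_nome[OF \<tau>] by auto
  have aux: "S = A * D / (T * B)"
    if "A * F = T * P * S" "B * F = P * D" "P \<noteq> 0" "B \<noteq> 0" "T \<noteq> 0" for A B D F P S T :: complex
  proof -
    have "P * (A * D) = P * (T * B * S)" using that(1,2) by (metis mult.assoc mult.commute)
    thus ?thesis using that(3-5) by (simp add: field_simps)
  qed
  have "?S = kronecker \<tau> c x"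
    unfolding kronecker_eq[OF \<tau>]
    by (rule aux[OF 1 one_point_trace[OF \<tau> x] P theta_num_nonzero_strip[OF \<tau> x] c])
  moreover have "(\<lambda>k. exp (x * of_int k) * occupation \<tau> c k) summable_on UNIV"
    using exp_occupation_summable[OF \<tau> c, of 0 x 1] x by - (rule abs_summable_summable, simp)
  ultimately show ?thesis by (simp add: has_sum_iff)
qed

lemma kronecker_expansion_neg:
  assumes \<tau>: "Im \<tau> > 0" and x: "- width \<tau> < Re x" "Re x < 0" and c: "theta_num \<tau> c \<noteq> 0"
  shows "((\<lambda>k. exp (x * of_int k) * (occupation \<tau> c k - 1)) has_sum kronecker \<tau> c x) UNIV"
proof -
  have "((\<lambda>k. exp ((- x) * of_int k) * occupation \<tau> (- c) k) has_sum kronecker \<tau> (- c) (- x)) UNIV"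
    using x c by (intro kronecker_expansion[OF \<tau>]) (auto simp: theta_num_minus)
  from has_sum_cmult_right[OF this, of "- 1"]
  have "((\<lambda>k. - (exp ((- x) * of_int k) * occupation \<tau> (- c) k)) has_sum - kronecker \<tau> (- c) (- x)) UNIV" by simp
  moreover have "bij_betw uminus (UNIV :: int set) UNIV" by (rule bij_betwI[of _ _ _ uminus]) auto
  ultimately have "((\<lambda>k. - (exp ((- x) * of_int (- k)) * occupation \<tau> (- c) (- k))) has_sum - kronecker \<tau> (- c) (- x)) UNIV"
    using has_sum_reindex_bij_betw[of uminus UNIV UNIV "\<lambda>k::int. - (exp ((- x) * of_int k) * occupation \<tau> (- c) k)"] by simp
  hence "((\<lambda>k. exp (x * of_int k) * (occupation \<tau> c k - 1)) has_sum - kronecker \<tau> (- c) (- x)) UNIV"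
    by (simp add: occupation_reflect[OF occupation_denominator[OF \<tau> c]])
  moreover have "theta_num \<tau> (- c - x) = - theta_num \<tau> (c + x)"
    using theta_num_minus[of \<tau> "c + x"] by simp
  hence "- kronecker \<tau> (- c) (- x) = kronecker \<tau> c x"
    by (simp add: kronecker_eq[OF \<tau>] theta_num_minus)
  ultimately show ?thesis by simp
qed


section \<open>Continuation of the cycle sums\<close>

lemma open_theta_nonzero:
  assumes "Im \<tau> > 0"
  shows "open {c. theta_num \<tau> c \<noteq> 0}"
proof -
  have "continuous_on UNIV (theta_num \<tau>)"
    using theta_num_holomorphic[OF assms] by (rule holomorphic_on_imp_continuous_on)
  hence "open (theta_num \<tau> -` (- {0}))" by (intro open_vimage) (auto simp: open_Compl)
  moreover have "theta_num \<tau> -` (- {0}) = {c. theta_num \<tau> c \<noteq> 0}" by auto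
  ultimately show ?thesis by simp
qed

lemma has_sum_minus:
  fixes f g :: "'a \<Rightarrow> complex"
  assumes "(f has_sum A) S" "(g has_sum B) S"
  shows "((\<lambda>x. f x - g x) has_sum (A - B)) S"
  using has_sum_add[OF assms(1), of "\<lambda>x. - g x" "- B"] assms(2) by (simp add: has_sum_uminus)

lemma occupation_has_derivative:
  assumes "1 - exp c * nome \<tau> powi k \<noteq> 0"
  shows "((\<lambda>c. occupation \<tau> c k) has_field_derivative occupation \<tau> c k * (1 - occupation \<tau> c k)) (at c)"
proof -
  define w where "w = exp c * nome \<tau> powi k"
  have w: "1 - w \<noteq> 0" using assms by (simp add: w_def)
  have "((\<lambda>c. exp c * nome \<tau> powi k) has_field_derivative w) (at c)"
    unfolding w_def by (auto intro!: derivative_eq_intros)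
  from DERIV_divide[OF DERIV_minus[OF this] DERIV_diff[OF DERIV_const[of 1] this]]
  have "((\<lambda>c. - (exp c * nome \<tau> powi k) / (1 - exp c * nome \<tau> powi k)) has_field_derivative
      (- w * (1 - w) - (- w) * (0 - w)) / ((1 - w) * (1 - w))) (at c)"
    using w by (simp add: w_def)
  moreover have "(- w * (1 - w) - (- w) * (0 - w)) / ((1 - w) * (1 - w)) = - w / (1 - w) * (1 - (- w / (1 - w)))"
  proof -
    have "1 - (- w / (1 - w)) = 1 / (1 - w)" using w by (simp add: field_simps)
    moreover have "- w * (1 - w) - (- w) * (0 - w) = - w * 1" by algebra
    ultimately show ?thesis by (simp only: times_divide_times_eq)
  qed
  ultimately show ?thesis by (simp add: occupation_def w_def)
qed

definition power_sum :: "complex \<Rightarrow> nat \<Rightarrow> complex \<Rightarrow> complex \<Rightarrow> complex" where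
  "power_sum \<tau> a c x = (\<Sum>\<^sub>\<infinity>k. exp (x * of_int k) * occupation \<tau> c k ^ a)"

text \<open>Differentiation in \<open>c\<close> raises the power, because \<open>p' = p (1 - p)\<close> for \<open>p = occupation \<tau> c k\<close>.\<close>

lemma power_sum_deriv:
  assumes \<tau>: "Im \<tau> > 0" and c: "theta_num \<tau> c \<noteq> 0" and x: "0 < Re x" "Re x < width \<tau>" and a: "a \<ge> 1"
  shows "((\<lambda>c. power_sum \<tau> a c x) has_field_derivative of_nat a * (power_sum \<tau> a c x - power_sum \<tau> (Suc a) c x)) (at c)"
proof -
  let ?\<Omega> = "{c. theta_num \<tau> c \<noteq> 0}"
  let ?f = "\<lambda>k c. exp (x * of_int k) * occupation \<tau> c k ^ a"
  have der: "(?f k has_field_derivative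
      of_nat a * (exp (x * of_int k) * occupation \<tau> c k ^ a - exp (x * of_int k) * occupation \<tau> c k ^ Suc a)) (at c)"
    if "c \<in> ?\<Omega>" for k c
  proof -
    obtain b where b: "a = Suc b" using a by (cases a) auto
    have "1 - exp c * nome \<tau> powi k \<noteq> 0" using occupation_denominator[OF \<tau>] that by simp
    from DERIV_cmult[OF DERIV_power[OF occupation_has_derivative[OF this], of "Suc b"], of "exp (x * of_int k)"]
    show ?thesis unfolding b by (rule DERIV_cong) (simp add: algebra_simps)
  qed
  have hol: "?f k holomorphic_on ?\<Omega>" for k
    using der by (subst holomorphic_on_open[OF open_theta_nonzero[OF \<tau>]]) blast
  have loc: "\<exists>d>0. \<exists>M. cball c d \<subseteq> ?\<Omega> \<and> M summable_on UNIV \<and> (\<forall>k. \<forall>w\<in>cball c d. norm (?f k w) \<le> M k)"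
    if c\<Omega>: "c \<in> ?\<Omega>" for c
  proof -
    obtain d where d: "d > 0" "cball c d \<subseteq> ?\<Omega>"
      using open_contains_cball[THEN iffD1, OF open_theta_nonzero[OF \<tau>], THEN bspec, OF c\<Omega>] by blast
    have "theta_num \<tau> w \<noteq> 0" if "w \<in> cball c d" for w using d(2) that by blast
    from occ_bound_compact[OF \<tau> compact_cball this]
    obtain C where C: "\<forall>w\<in>cball c d. occ_bound \<tau> w C" by blast
    have "norm (occupation \<tau> c 0) \<le> C" using C d(1) by (auto simp: occ_bound_def)
    hence C0: "C \<ge> 0" using norm_ge_zero order_trans by blast
    \<comment> \<open>A majorant of the occupation numbers up to the factor \<open>C\<close>, with
      the same decay to the right and free of \<open>c\<close>, so that
      \<open>exp_power_summable\<close> supplies the Weierstrass bound on the disc.\<close>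
    define p where "p = (\<lambda>k::int. if k \<ge> 0 then complex_of_real (norm (nome \<tau>) ^ nat k) else 1)"
    have q: "norm (nome \<tau>) ^ n \<le> 1" for n using norm_nome_less_1[OF \<tau>] by (intro power_le_one) auto
    have p1: "norm (p k) \<le> 1" for k using q by (auto simp: p_def norm_power)
    have s: "(\<lambda>k. norm (exp (x * of_int k) * p k ^ a * (p k - 1) ^ 0)) summable_on UNIV"
    proof (rule exp_power_summable[OF \<tau>, where C = 2])
      fix k
      show "norm (p k) \<le> 2" using p1[of k] by linarith
      show "norm (p k - 1) \<le> 2" using p1[of k] norm_triangle_ineq4[of "p k" 1, unfolded norm_one] by linarith
      show "norm (p k) \<le> 2 * norm (nome \<tau>) ^ nat k" if "k \<ge> 0" using that by (simp add: p_def norm_power)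
    next
      have "1 * width \<tau> \<le> real a * width \<tau>" using a \<tau> by (intro mult_right_mono) (auto simp: width_def)
      thus "Re x < real a * width \<tau>" using x by linarith
    qed (use x in auto)
    have "norm (?f k w) \<le> norm (exp (x * of_int k) * p k ^ a * (p k - 1) ^ 0) * C ^ a" if w: "w \<in> cball c d" for k w
    proof -
      have "norm (occupation \<tau> w k) \<le> norm (p k) * C"
        using C w by (auto simp: occ_bound_def p_def norm_power mult.commute)
      hence "norm (occupation \<tau> w k) ^ a \<le> (norm (p k) * C) ^ a" by (intro power_mono) auto
      hence "norm (exp (x * of_int k)) * norm (occupation \<tau> w k) ^ a \<le> norm (exp (x * of_int k)) * (norm (p k) * C) ^ a"
        by (intro mult_left_mono) auto
      thus ?thesis by (simp add: norm_mult norm_power power_mult_distrib mult_ac)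
    qed
    thus ?thesis using d summable_on_cmult_left[OF s, of "C ^ a"] by blast
  qed
  have "deriv (?f k) c = of_nat a * (exp (x * of_int k) * occupation \<tau> c k ^ a - exp (x * of_int k) * occupation \<tau> c k ^ Suc a)" for k
    using der[of c k] c by (simp add: DERIV_imp_deriv)
  moreover have "((\<lambda>k. deriv (?f k) c) has_sum deriv (\<lambda>c. power_sum \<tau> a c x) c) UNIV"
    unfolding power_sum_def by (rule holomorphic_infsum(2)[OF open_theta_nonzero[OF \<tau>] hol loc]) (use c in auto)
  ultimately have 1: "((\<lambda>k. of_nat a * (exp (x * of_int k) * occupation \<tau> c k ^ a - exp (x * of_int k) * occupation \<tau> c k ^ Suc a)) has_sum deriv (\<lambda>c. power_sum \<tau> a c x) c) UNIV"
    by simp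
  have s: "((\<lambda>k. exp (x * of_int k) * occupation \<tau> c k ^ n) has_sum power_sum \<tau> n c x) UNIV" if "n \<ge> 1" for n
  proof -
    have "1 * width \<tau> \<le> real n * width \<tau>" using that \<tau> by (intro mult_right_mono) (auto simp: width_def)
    hence "Re x < real n * width \<tau>" using x by linarith
    hence "(\<lambda>k. norm (exp (x * of_int k) * occupation \<tau> c k ^ n)) summable_on UNIV"
      using exp_occupation_summable[OF \<tau> c, of 0 x n] x by simp
    thus ?thesis unfolding power_sum_def by (rule has_sum_infsum[OF abs_summable_summable])
  qed
  have "((\<lambda>k. exp (x * of_int k) * occupation \<tau> c k ^ a - exp (x * of_int k) * occupation \<tau> c k ^ Suc a) has_sum
      (power_sum \<tau> a c x - power_sum \<tau> (Suc a) c x)) UNIV"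
    by (rule has_sum_minus[OF s[OF a] s]) simp
  from has_sum_unique[OF 1 has_sum_cmult_right[OF this]]
  have "deriv (\<lambda>c. power_sum \<tau> a c x) c = of_nat a * (power_sum \<tau> a c x - power_sum \<tau> (Suc a) c x)" .
  moreover have "(\<lambda>c. power_sum \<tau> a c x) holomorphic_on ?\<Omega>"
    unfolding power_sum_def by (rule holomorphic_infsum(1)[OF open_theta_nonzero[OF \<tau>] hol loc])
  hence "((\<lambda>c. power_sum \<tau> a c x) has_field_derivative deriv (\<lambda>c. power_sum \<tau> a c x) c) (at c)"
    using c by (intro holomorphic_derivI[OF _ open_theta_nonzero[OF \<tau>]]) auto
  ultimately show "((\<lambda>c. power_sum \<tau> a c x) has_field_derivative of_nat a * (power_sum \<tau> a c x - power_sum \<tau> (Suc a) c x)) (at c)"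
    by simp
qed

lemma higher_deriv_theta_num:
  assumes "Im \<tau> > 0"
  shows "(deriv ^^ i) (theta_num \<tau>) holomorphic_on UNIV"
  using theta_num_holomorphic[OF assms] by (intro holomorphic_higher_deriv) auto

text \<open>Only \<open>c\<close> is differentiated, so the denominator
  \<open>theta_num \<tau> x\<close> of the Kronecker function never gets a higher power and the
  numerator stays entire in \<open>x\<close>.\<close>

lemma power_sum_continuation:
  assumes \<tau>: "Im \<tau> > 0"
  shows "\<exists>n \<alpha>. (\<forall>i. \<alpha> i holomorphic_on {c. theta_num \<tau> c \<noteq> 0}) \<and>
    (\<forall>c x. theta_num \<tau> c \<noteq> 0 \<longrightarrow> 0 < Re x \<longrightarrow> Re x < width \<tau> \<longrightarrow>
      power_sum \<tau> (Suc a) c x * theta_num \<tau> x = (\<Sum>i<n. \<alpha> i c * (deriv ^^ i) (theta_num \<tau>) (c + x)))"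
proof (induction a)
  case 0
  have "power_sum \<tau> (Suc 0) c x * theta_num \<tau> x = (\<Sum>i<1::nat. theta_den \<tau> / theta_num \<tau> c * (deriv ^^ i) (theta_num \<tau>) (c + x))"
    if "theta_num \<tau> c \<noteq> 0" "0 < Re x" "Re x < width \<tau>" for c x
    using infsumI[OF kronecker_expansion[OF \<tau> that(2,3,1)]] theta_num_nonzero_strip[OF \<tau> that(2,3)]
    by (simp add: power_sum_def kronecker_eq[OF \<tau>])
  moreover have "(\<lambda>c. theta_den \<tau> / theta_num \<tau> c) holomorphic_on {c. theta_num \<tau> c \<noteq> 0}"
    using holomorphic_on_subset[OF theta_num_holomorphic[OF \<tau>]] by (intro holomorphic_intros) auto
  ultimately show ?case by (intro exI[of _ "1::nat"] exI[of _ "\<lambda>_ c. theta_den \<tau> / theta_num \<tau> c"]) blast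
next
  case (Suc a)
  let ?\<Omega> = "{c. theta_num \<tau> c \<noteq> 0}"
  let ?T = "\<lambda>i. (deriv ^^ i) (theta_num \<tau>)"
  obtain n where "\<exists>\<alpha>. (\<forall>i. \<alpha> i holomorphic_on ?\<Omega>) \<and>
    (\<forall>c x. theta_num \<tau> c \<noteq> 0 \<longrightarrow> 0 < Re x \<longrightarrow> Re x < width \<tau> \<longrightarrow>
      power_sum \<tau> (Suc a) c x * theta_num \<tau> x = (\<Sum>i<n. \<alpha> i c * ?T i (c + x)))"
    using Suc.IH ..
  then obtain \<alpha> where IH: "(\<forall>i. \<alpha> i holomorphic_on ?\<Omega>) \<and>
    (\<forall>c x. theta_num \<tau> c \<noteq> 0 \<longrightarrow> 0 < Re x \<longrightarrow> Re x < width \<tau> \<longrightarrow>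
      power_sum \<tau> (Suc a) c x * theta_num \<tau> x = (\<Sum>i<n. \<alpha> i c * ?T i (c + x)))" ..
  note hol = IH[THEN conjunct1, rule_format] and eq = IH[THEN conjunct2, rule_format]
  define A where "A = (of_nat (Suc a) :: complex)"
  have A: "A \<noteq> 0" by (simp add: A_def del: of_nat_Suc)
  \<comment> \<open>Solving \<open>power_sum_deriv\<close> for the next power gives S - S' / A with
    S the current sum; these are the coefficients of that combination, the derivative of each
    shifted theta moving its index up by one.\<close>
  define \<beta> where "\<beta> = (\<lambda>i c. (if i < n then \<alpha> i c - deriv (\<alpha> i) c / A else 0) - (if i \<ge> 1 then \<alpha> (i - 1) c / A else 0))"
  have "\<beta> i holomorphic_on ?\<Omega>" for i
    unfolding \<beta>_def using hol open_theta_nonzero[OF \<tau>]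
    by (cases "i < n"; cases "i \<ge> 1") (auto intro!: holomorphic_intros holomorphic_deriv)
  moreover have "power_sum \<tau> (Suc (Suc a)) c x * theta_num \<tau> x = (\<Sum>i<Suc n. \<beta> i c * ?T i (c + x))"
    if c: "theta_num \<tau> c \<noteq> 0" and x: "0 < Re x" "Re x < width \<tau>" for c x
  proof -
    have 1: "((\<lambda>c. power_sum \<tau> (Suc a) c x * theta_num \<tau> x) has_field_derivative
        A * (power_sum \<tau> (Suc a) c x - power_sum \<tau> (Suc (Suc a)) c x) * theta_num \<tau> x) (at c)"
      unfolding A_def by (intro DERIV_cmult_right power_sum_deriv[OF \<tau> c x]) simp
    have dT: "(?T i has_field_derivative ?T (Suc i) w) (at w)" for i w
      using holomorphic_derivI[OF higher_deriv_theta_num[OF \<tau>] open_UNIV, of w i] by simp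
    have dT': "((\<lambda>c. ?T i (c + x)) has_field_derivative ?T (Suc i) (c + x)) (at c)" for i
    proof -
      have "((\<lambda>c. c + x) has_field_derivative 1) (at c)" by (auto intro!: derivative_eq_intros)
      from DERIV_chain2[OF dT this] show ?thesis by simp
    qed
    have d\<alpha>: "(\<alpha> i has_field_derivative deriv (\<alpha> i) c) (at c)" for i
      using holomorphic_derivI[OF hol open_theta_nonzero[OF \<tau>]] c by simp
    have 2: "((\<lambda>c. \<Sum>i<n. \<alpha> i c * ?T i (c + x)) has_field_derivative
        (\<Sum>i<n. deriv (\<alpha> i) c * ?T i (c + x) + ?T (Suc i) (c + x) * \<alpha> i c)) (at c)"
      by (intro DERIV_sum DERIV_mult d\<alpha> dT')
    have ev: "\<forall>\<^sub>F c' in nhds c. power_sum \<tau> (Suc a) c' x * theta_num \<tau> x = (\<Sum>i<n. \<alpha> i c' * ?T i (c' + x))"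
      using eventually_nhds_in_open[OF open_theta_nonzero[OF \<tau>], of c] c
      by (auto elim!: eventually_mono simp: eq[OF _ x])
    have "A * (power_sum \<tau> (Suc a) c x - power_sum \<tau> (Suc (Suc a)) c x) * theta_num \<tau> x =
        (\<Sum>i<n. deriv (\<alpha> i) c * ?T i (c + x) + ?T (Suc i) (c + x) * \<alpha> i c)"
      by (rule DERIV_unique[OF 1 DERIV_cong_ev[THEN iffD2, OF refl ev refl 2]])
    hence "power_sum \<tau> (Suc (Suc a)) c x * theta_num \<tau> x = power_sum \<tau> (Suc a) c x * theta_num \<tau> x -
        (\<Sum>i<n. deriv (\<alpha> i) c * ?T i (c + x) + ?T (Suc i) (c + x) * \<alpha> i c) / A"
      using A by (simp add: field_simps)
    also have "\<dots> = (\<Sum>i<n. (\<alpha> i c - deriv (\<alpha> i) c / A) * ?T i (c + x)) - (\<Sum>i<n. \<alpha> i c / A * ?T (Suc i) (c + x))"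
      unfolding eq[OF c x] sum_divide_distrib sum_subtractf[symmetric]
      by (intro sum.cong) (auto simp: field_simps A)
    also have "(\<Sum>i<n. (\<alpha> i c - deriv (\<alpha> i) c / A) * ?T i (c + x)) =
        (\<Sum>i<Suc n. (if i < n then \<alpha> i c - deriv (\<alpha> i) c / A else 0) * ?T i (c + x))"
      by simp
    also have "(\<Sum>i<n. \<alpha> i c / A * ?T (Suc i) (c + x)) =
        (\<Sum>i<Suc n. (if i \<ge> 1 then \<alpha> (i - 1) c / A else 0) * ?T i (c + x))"
      unfolding sum.lessThan_Suc_shift by simp
    finally show ?thesis by (simp only: \<beta>_def left_diff_distrib sum_subtractf)
  qed
  ultimately show ?case by (intro exI[of _ "Suc n"] exI[of _ \<beta>]) blast
qed

text \<open>Induction on \<open>b\<close> by p^(a+1) (p - 1)^(b+1) = p^(a+2) (p - 1)^b - p^(a+1) (p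
  - 1)^b, which changes \<open>a\<close>.\<close>

lemma mixed_sum_strip:
  assumes \<tau>: "Im \<tau> > 0" and c: "theta_num \<tau> c \<noteq> 0"
  shows "\<exists>E. E holomorphic_on UNIV \<and> (\<forall>x. 0 < Re x \<and> Re x < width \<tau> \<longrightarrow>
    (\<Sum>\<^sub>\<infinity>k. exp (x * of_int k) * occupation \<tau> c k ^ Suc a * (occupation \<tau> c k - 1) ^ b) * theta_num \<tau> x = E x)"
proof (induction b arbitrary: a)
  case 0
  obtain n where "\<exists>\<alpha>. (\<forall>i. \<alpha> i holomorphic_on {c. theta_num \<tau> c \<noteq> 0}) \<and>
    (\<forall>c x. theta_num \<tau> c \<noteq> 0 \<longrightarrow> 0 < Re x \<longrightarrow> Re x < width \<tau> \<longrightarrow>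
      power_sum \<tau> (Suc a) c x * theta_num \<tau> x = (\<Sum>i<n. \<alpha> i c * (deriv ^^ i) (theta_num \<tau>) (c + x)))"
    using power_sum_continuation[OF \<tau>, of a] ..
  then obtain \<alpha> where IH: "(\<forall>i. \<alpha> i holomorphic_on {c. theta_num \<tau> c \<noteq> 0}) \<and>
    (\<forall>c x. theta_num \<tau> c \<noteq> 0 \<longrightarrow> 0 < Re x \<longrightarrow> Re x < width \<tau> \<longrightarrow>
      power_sum \<tau> (Suc a) c x * theta_num \<tau> x = (\<Sum>i<n. \<alpha> i c * (deriv ^^ i) (theta_num \<tau>) (c + x)))" ..
  note eq = IH[THEN conjunct2, rule_format]
  have "(\<lambda>x. (deriv ^^ i) (theta_num \<tau>) (c + x)) holomorphic_on UNIV" for i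
  proof -
    have "(\<lambda>x. c + x) holomorphic_on UNIV" by (intro holomorphic_intros)
    from holomorphic_on_compose_gen[OF this higher_deriv_theta_num[OF \<tau>, of i]]
    show ?thesis by (simp add: o_def)
  qed
  hence "(\<lambda>x. \<Sum>i<n. \<alpha> i c * (deriv ^^ i) (theta_num \<tau>) (c + x)) holomorphic_on UNIV"
    by (intro holomorphic_on_sum holomorphic_on_mult holomorphic_on_const)
  thus ?case using eq[OF c]
    by (intro exI[of _ "\<lambda>x. \<Sum>i<n. \<alpha> i c * (deriv ^^ i) (theta_num \<tau>) (c + x)"]) (auto simp: power_sum_def)
next
  case (Suc b)
  let ?p = "occupation \<tau> c"
  obtain E1 where E1: "E1 holomorphic_on UNIV" "\<And>x. 0 < Re x \<Longrightarrow> Re x < width \<tau> \<Longrightarrow>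
    (\<Sum>\<^sub>\<infinity>k. exp (x * of_int k) * ?p k ^ Suc a * (?p k - 1) ^ b) * theta_num \<tau> x = E1 x" using Suc[of a] by blast
  obtain E2 where E2: "E2 holomorphic_on UNIV" "\<And>x. 0 < Re x \<Longrightarrow> Re x < width \<tau> \<Longrightarrow>
    (\<Sum>\<^sub>\<infinity>k. exp (x * of_int k) * ?p k ^ Suc (Suc a) * (?p k - 1) ^ b) * theta_num \<tau> x = E2 x" using Suc[of "Suc a"] by blast
  have "(\<Sum>\<^sub>\<infinity>k. exp (x * of_int k) * ?p k ^ Suc a * (?p k - 1) ^ Suc b) * theta_num \<tau> x = E2 x - E1 x"
    if x: "0 < Re x" "Re x < width \<tau>" for x
  proof -
    have s: "(\<lambda>k. exp (x * of_int k) * ?p k ^ Suc n * (?p k - 1) ^ b) summable_on UNIV" for n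
    proof (rule abs_summable_summable, rule exp_occupation_summable[OF \<tau> c])
      have "0 \<le> real b * width \<tau>" using \<tau> by (simp add: width_def)
      thus "- (real b * width \<tau>) < Re x" using x by linarith
      have "1 * width \<tau> \<le> real (Suc n) * width \<tau>" using \<tau> by (intro mult_right_mono) (auto simp: width_def)
      thus "Re x < real (Suc n) * width \<tau>" using x by linarith
    qed
    have "(\<Sum>\<^sub>\<infinity>k. exp (x * of_int k) * ?p k ^ Suc a * (?p k - 1) ^ Suc b) =
        (\<Sum>\<^sub>\<infinity>k. exp (x * of_int k) * ?p k ^ Suc (Suc a) * (?p k - 1) ^ b - exp (x * of_int k) * ?p k ^ Suc a * (?p k - 1) ^ b)"
      by (intro infsum_cong) (simp add: algebra_simps)
    also have "\<dots> = (\<Sum>\<^sub>\<infinity>k. exp (x * of_int k) * ?p k ^ Suc (Suc a) * (?p k - 1) ^ b) -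
        (\<Sum>\<^sub>\<infinity>k. exp (x * of_int k) * ?p k ^ Suc a * (?p k - 1) ^ b)"
      by (rule infsumI[OF has_sum_minus[OF has_sum_infsum[OF s] has_sum_infsum[OF s]]])
    finally show ?thesis using E1(2)[OF x] E2(2)[OF x] by (simp only: left_diff_distrib)
  qed
  thus ?case using E1(1) E2(1) by (intro exI[of _ "\<lambda>x. E2 x - E1 x"]) (auto intro!: holomorphic_intros)
qed

lemma mixed_sum_holomorphic:
  assumes \<tau>: "Im \<tau> > 0" and c: "theta_num \<tau> c \<noteq> 0"
  shows "(\<lambda>x. \<Sum>\<^sub>\<infinity>k. exp (x * of_int k) * occupation \<tau> c k ^ a * (occupation \<tau> c k - 1) ^ b) holomorphic_on
    {x. - (real b * width \<tau>) < Re x \<and> Re x < real a * width \<tau>}"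
proof (rule holomorphic_infsum(1))
  let ?S = "{x. - (real b * width \<tau>) < Re x \<and> Re x < real a * width \<tau>}"
  let ?g = "\<lambda>x k. exp (x * of_int k) * occupation \<tau> c k ^ a * (occupation \<tau> c k - 1) ^ b"
  have "?S = {x. - (real b * width \<tau>) < Re x} \<inter> {x. Re x < real a * width \<tau>}" by auto
  thus S: "open ?S" by (simp add: open_Int open_halfspace_Re_lt open_halfspace_Re_gt)
  show "(\<lambda>x. ?g x k) holomorphic_on ?S" for k by (intro holomorphic_intros)
  fix x assume "x \<in> ?S"
  then obtain d where d: "d > 0" "cball x d \<subseteq> ?S" using open_contains_cball[THEN iffD1, OF S] by blast
  \<comment> \<open>On the disc the norm of \<open>exp (w * of_int k)\<close> is at most its norm at
    one of the two real extremes, and both extremes still lie in the strip.\<close>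
  define M where "M = (\<lambda>k. norm (?g (x + of_real d) k) + norm (?g (x - of_real d) k))"
  have mem: "x + of_real d \<in> cball x d" "x - of_real d \<in> cball x d" using d(1) by (auto simp: dist_norm)
  have "x + of_real d \<in> ?S" "x - of_real d \<in> ?S" using mem d(2) by blast+
  hence "M summable_on UNIV"
    unfolding M_def by (intro summable_on_add exp_occupation_summable[OF \<tau> c]) simp_all
  moreover have "norm (?g w k) \<le> M k" if w: "w \<in> cball x d" for w k
  proof -
    have "\<bar>Re w - Re x\<bar> \<le> d" using w abs_Re_le_cmod[of "w - x"] by (simp add: dist_norm norm_minus_commute)
    hence lo: "Re x - d \<le> Re w" and hi: "Re w \<le> Re x + d" by linarith+
    have "Re w * of_int k \<le> (Re x + d) * of_int k \<or> Re w * of_int k \<le> (Re x - d) * of_int k"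
    proof (cases "k \<ge> 0")
      case True
      thus ?thesis using mult_right_mono[OF hi, of "of_int k"] by simp
    next
      case False
      thus ?thesis using mult_right_mono_neg[OF lo, of "of_int k"] by simp
    qed
    hence "exp (Re w * of_int k) \<le> exp ((Re x + d) * of_int k) + exp ((Re x - d) * of_int k)"
      by (metis add_increasing add_increasing2 exp_ge_zero exp_le_cancel_iff)
    hence "exp (Re w * of_int k) * norm (occupation \<tau> c k ^ a * (occupation \<tau> c k - 1) ^ b) \<le>
       (exp ((Re x + d) * of_int k) + exp ((Re x - d) * of_int k)) * norm (occupation \<tau> c k ^ a * (occupation \<tau> c k - 1) ^ b)"
      by (intro mult_right_mono) auto
    thus ?thesis by (simp add: M_def norm_mult norm_exp_eq_Re algebra_simps)
  qed
  ultimately show "\<exists>d>0. \<exists>M. cball x d \<subseteq> ?S \<and> M summable_on UNIV \<and> (\<forall>k. \<forall>w\<in>cball x d. norm (?g w k) \<le> M k)"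
    using d by blast
qed

text \<open>The explicit formula is known on the basic strip only, but the mixed series is
  holomorphic on the wide one, and the identity theorem carries the relation over. The wide strip
  matters because cycle totals of admissible points may leave the basic strip.\<close>

lemma mixed_sum_continuation:
  assumes \<tau>: "Im \<tau> > 0" and c: "theta_num \<tau> c \<noteq> 0" and a: "a \<ge> 1"
  shows "\<exists>E. E holomorphic_on UNIV \<and> (\<forall>x. - (real b * width \<tau>) < Re x \<and> Re x < real a * width \<tau> \<longrightarrow>
    (\<Sum>\<^sub>\<infinity>k. exp (x * of_int k) * occupation \<tau> c k ^ a * (occupation \<tau> c k - 1) ^ b) * theta_num \<tau> x = E x)"
proof -
  let ?S = "{x. - (real b * width \<tau>) < Re x \<and> Re x < real a * width \<tau>}"
  let ?V = "{x. 0 < Re x \<and> Re x < width \<tau>}"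
  let ?G = "\<lambda>x. \<Sum>\<^sub>\<infinity>k. exp (x * of_int k) * occupation \<tau> c k ^ a * (occupation \<tau> c k - 1) ^ b"
  obtain a' where a': "a = Suc a'" using a by (cases a) auto
  obtain E where E: "E holomorphic_on UNIV" "\<And>x. 0 < Re x \<Longrightarrow> Re x < width \<tau> \<Longrightarrow> ?G x * theta_num \<tau> x = E x"
    using mixed_sum_strip[OF \<tau> c, of a' b] unfolding a' by blast
  have w: "width \<tau> > 0" using \<tau> by (simp add: width_def)
  have "?S = {x. - (real b * width \<tau>) < Re x} \<inter> {x. Re x < real a * width \<tau>}" by auto
  hence S: "open ?S" "convex ?S"
    by (simp_all add: open_Int convex_Int open_halfspace_Re_lt open_halfspace_Re_gt convex_halfspace_Re_lt convex_halfspace_Re_gt)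
  have "?V = {x. 0 < Re x} \<inter> {x. Re x < width \<tau>}" by auto
  hence V: "open ?V" by (simp add: open_Int open_halfspace_Re_lt open_halfspace_Re_gt)
  have "1 * width \<tau> \<le> real a * width \<tau>" "0 \<le> real b * width \<tau>" using a w by (auto intro!: mult_right_mono)
  hence "0 < Re x \<Longrightarrow> Re x < width \<tau> \<Longrightarrow> - (real b * width \<tau>) < Re x \<and> Re x < real a * width \<tau>" for x by linarith
  hence VS: "?V \<subseteq> ?S" by blast
  have "of_real (width \<tau> / 2) \<in> ?V" using w by simp
  hence V0: "?V \<noteq> {}" by blast
  have "?G x * theta_num \<tau> x = E x" if "x \<in> ?S" for x
  proof (rule analytic_continuation_open[OF V S(1) V0 _ VS _ _ _ that])
    show "connected ?S" using S(2) by (rule convex_connected)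
    show "(\<lambda>x. ?G x * theta_num \<tau> x) holomorphic_on ?S"
      by (intro holomorphic_on_mult mixed_sum_holomorphic[OF \<tau> c] holomorphic_on_subset[OF theta_num_holomorphic[OF \<tau>]]) auto
    show "E holomorphic_on ?S" using E(1) by (rule holomorphic_on_subset) auto
  qed (use E(2) in auto)
  thus ?thesis using E(1) by blast
qed


section \<open>Fourier integrals over the torus\<close>

lemma lborel_product_integral:
  fixes g :: "'a::euclidean_space \<Rightarrow> real \<Rightarrow> complex"
  assumes g: "\<And>b. b \<in> Basis \<Longrightarrow> integrable lborel (g b)"
  shows "integrable lborel (\<lambda>x::'a. \<Prod>b\<in>Basis. g b (x \<bullet> b))"
    and "(LINT x|lborel. (\<Prod>b\<in>Basis. g b (x \<bullet> b))) = (\<Prod>b\<in>Basis. LINT s|lborel. g b s)"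
proof -
  interpret product_sigma_finite "\<lambda>_::'a. lborel :: real measure" ..
  let ?T = "\<lambda>f. \<Sum>b\<in>(Basis :: 'a set). f b *\<^sub>R b"
  have T: "?T \<in> measurable (Pi\<^sub>M Basis (\<lambda>_. lborel)) borel" by measurable
  have "g b \<in> borel_measurable borel" if "b \<in> Basis" for b using g[OF that] by simp
  hence m: "(\<lambda>x::'a. \<Prod>b\<in>Basis. g b (x \<bullet> b)) \<in> borel_measurable borel"
    by (intro borel_measurable_prod) (auto intro!: measurable_compose[of "\<lambda>x. x \<bullet> _" borel borel])
  have eq: "(\<Prod>b\<in>Basis. g b (?T f \<bullet> b)) = (\<Prod>b\<in>Basis. g b (f b))" for f
    by (intro prod.cong refl) (simp add: inner_sum_left inner_Basis if_distrib sum.delta cong: if_cong)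
  show "integrable lborel (\<lambda>x::'a. \<Prod>b\<in>Basis. g b (x \<bullet> b))"
    unfolding lborel_eq[where 'a = 'a] integrable_distr_eq[OF T m] eq
    by (rule product_integrable_prod) (use g in auto)
  show "(LINT x|lborel. (\<Prod>b\<in>Basis. g b (x \<bullet> b))) = (\<Prod>b\<in>Basis. LINT s|lborel. g b s)"
    unfolding lborel_eq[where 'a = 'a] integral_distr[OF T m] eq
    by (rule product_integral_prod) (use g in auto)
qed

lemma exp_integral_unit:
  fixes k :: int
  shows "set_integrable lborel {0..1} (\<lambda>s. exp (2 * pi * \<i> * of_int k * of_real s))"
    and "(LINT s:{0..1}|lborel. exp (2 * pi * \<i> * of_int k * of_real s)) = (if k = 0 then 1 else 0)"
proof -
  let ?f = "\<lambda>s::real. exp (2 * pi * \<i> * of_int k * of_real s)"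
  have c: "continuous_on {0..1} ?f" by (intro continuous_intros)
  show i: "set_integrable lborel {0..1} ?f" using c by (rule borel_integrable_atLeastAtMost')
  have "(LINT s:{0..1}|lborel. ?f s) = integral {0..1} ?f" by (rule set_borel_integral_eq_integral(2)[OF i])
  also have "\<dots> = (if k = 0 then 1 else 0)"
  proof (cases "k = 0")
    case False
    define a where "a = 2 * pi * \<i> * of_int k"
    have a: "a \<noteq> 0" using False by (simp add: a_def)
    have "((\<lambda>s. exp (a * of_real s) / a) has_vector_derivative exp (a * of_real s)) (at s within {0..1})" for s
    proof -
      have "((\<lambda>z. exp (a * z) / a) has_field_derivative exp (a * of_real s)) (at (of_real s))"
        using a by (auto intro!: derivative_eq_intros)
      from has_vector_derivative_real_field[OF this] show ?thesis
        by (rule has_vector_derivative_at_within)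
    qed
    hence "((\<lambda>s. exp (a * of_real s)) has_integral (exp (a * of_real 1) / a - exp (a * of_real 0) / a)) {0..1}"
      by (intro fundamental_theorem_of_calculus) auto
    moreover have "exp a = 1"
      unfolding a_def exp_eq_1 by (auto intro!: exI[of _ k])
    ultimately show ?thesis using False by (simp add: a_def integral_unique)
  qed simp
  finally show "(LINT s:{0..1}|lborel. ?f s) = (if k = 0 then 1 else 0)" .
qed

lemma cube_exp_integral:
  fixes n :: "'n::finite \<Rightarrow> int"
  shows "((\<lambda>t::real^'n. exp (2 * pi * \<i> * (\<Sum>j\<in>UNIV. of_int (n j) * of_real (t $ j)))) has_integral
    (if n = (\<lambda>_. 0) then 1 else 0)) (cbox 0 1)"
proof -
  \<comment> \<open>The product integral is indexed by basis vectors; \<open>ix\<close> recovers the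
    coordinate from the vector.\<close>
  define ix where "ix = (\<lambda>b::real^'n. THE i. b = axis i 1)"
  have ix: "ix (axis i 1) = i" for i by (auto simp: ix_def axis_eq_axis)
  define g where "g = (\<lambda>b (s::real). indicator {0..1} s *\<^sub>R exp (2 * pi * \<i> * of_int (n (ix b)) * of_real s))"
  have bij: "bij_betw (\<lambda>i::'n. axis i (1::real)) UNIV Basis"
    by (auto simp: bij_betw_def inj_on_def axis_eq_axis Basis_vec_def)
  have gi: "integrable lborel (g b)" for b
    using exp_integral_unit(1)[of "n (ix b)"] by (simp add: g_def set_integrable_def)
  have gI: "(LINT s|lborel. g b s) = (if n (ix b) = 0 then 1 else 0)" for b
    using exp_integral_unit(2)[of "n (ix b)"] by (simp add: g_def set_lebesgue_integral_def)
  have prod: "(\<Prod>b\<in>Basis. g b (t \<bullet> b)) = indicator (cbox 0 1) t *\<^sub>R exp (2 * pi * \<i> * (\<Sum>j\<in>UNIV. of_int (n j) * of_real (t $ j)))" for t :: "real^'n"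
  proof -
    have "(\<Prod>b\<in>Basis. g b (t \<bullet> b)) = (\<Prod>i\<in>UNIV. g (axis i 1) (t $ i))"
      by (subst prod.reindex_bij_betw[OF bij, symmetric]) (simp add: inner_axis)
    also have "\<dots> = (\<Prod>i\<in>UNIV. of_real (indicator {0..1} (t $ i))) * (\<Prod>i\<in>UNIV. exp (2 * pi * \<i> * of_int (n i) * of_real (t $ i)))"
      by (simp add: g_def ix scaleR_conv_of_real prod.distrib)
    also have "(\<Prod>i\<in>UNIV. of_real (indicator {0..1} (t $ i)) :: complex) = of_real (indicator (cbox 0 1) t)"
    proof (cases "t \<in> cbox 0 1")
      case True
      thus ?thesis by (auto simp: mem_box_cart)
    next
      case False
      then obtain i where "t $ i \<notin> {0..1}" by (auto simp: mem_box_cart)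
      hence "(\<Prod>i\<in>UNIV. of_real (indicator {0..1} (t $ i)) :: complex) = 0"
        by (intro prod_zero) (auto intro!: exI[of _ i])
      thus ?thesis using False by simp
    qed
    also have "(\<Prod>i\<in>UNIV. exp (2 * pi * \<i> * of_int (n i) * of_real (t $ i))) = exp (2 * pi * \<i> * (\<Sum>j\<in>UNIV. of_int (n j) * of_real (t $ j)))"
      by (simp add: exp_sum[symmetric] sum_distrib_left mult.assoc)
    finally show ?thesis by (simp add: scaleR_conv_of_real)
  qed
  let ?f = "\<lambda>t::real^'n. exp (2 * pi * \<i> * (\<Sum>j\<in>UNIV. of_int (n j) * of_real (t $ j)))"
  have int: "set_integrable lborel (cbox 0 1) ?f"
    using lborel_product_integral(1)[of g] gi by (simp add: prod set_integrable_def)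
  have "(LINT t:cbox 0 1|lborel. ?f t) = (\<Prod>b\<in>(Basis :: (real^'n) set). if n (ix b) = 0 then 1 else 0)"
    using lborel_product_integral(2)[of g] gi gI by (simp add: prod set_lebesgue_integral_def)
  also have "\<dots> = (\<Prod>i\<in>UNIV. if n i = 0 then 1 else 0)"
    by (subst prod.reindex_bij_betw[OF bij, symmetric]) (simp add: ix)
  also have "\<dots> = (if n = (\<lambda>_. 0) then 1 else 0)"
  proof (cases "n = (\<lambda>_. 0)")
    case False
    then obtain i where "n i \<noteq> 0" by auto
    hence "(\<Prod>i\<in>UNIV. if n i = 0 then 1 else 0 :: complex) = 0" by (intro prod_zero) auto
    thus ?thesis using False by simp
  qed simp
  finally have "integral (cbox 0 1) ?f = (if n = (\<lambda>_. 0) then 1 else 0)"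
    using set_borel_integral_eq_integral(2)[OF int] by simp
  thus ?thesis using integrable_integral[OF set_borel_integral_eq_integral(1)[OF int]] by simp
qed

text \<open>Multiplying out gives characters in which t_j occurs with the frequency
  \<open>m j - m (inv \<sigma> j)\<close>. Integration keeps the \<open>m\<close> invariant under
  \<sigma>, which amount to one integer per cycle.\<close>

lemma cube_cycle_integral:
  fixes A :: "'n::finite \<Rightarrow> int \<Rightarrow> complex"
  assumes \<sigma>: "\<sigma> permutes UNIV"
    and A: "\<And>i. (\<lambda>k. norm (A i k)) summable_on UNIV"
  shows "((\<lambda>t::real^'n. \<Prod>i\<in>UNIV. \<Sum>\<^sub>\<infinity>k. A i k * exp (2 * pi * \<i> * of_int k * of_real (t $ i - t $ \<sigma> i))) has_integral
    (\<Prod>C\<in>cycles_of \<sigma>. \<Sum>\<^sub>\<infinity>k. \<Prod>i\<in>C. A i k)) (cbox 0 1)"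
proof -
  define a where "a = (\<lambda>m::'n \<Rightarrow> int. \<Prod>i\<in>UNIV. A i (m i))"
  define e where "e = (\<lambda>(m::'n \<Rightarrow> int) (t::real^'n). exp (2 * pi * \<i> * (\<Sum>j\<in>UNIV. of_int (m j - m (inv \<sigma> j)) * of_real (t $ j))))"
  have norm_e: "norm (exp (2 * pi * \<i> * of_int k * of_real s)) = 1" for k s
    by (simp add: norm_exp_eq_Re)
  have as: "(\<lambda>m. norm (a m)) summable_on UNIV"
    using abs_summable_prod_PiE[of UNIV A "\<lambda>_. UNIV"] A by (simp add: a_def)
  have ne: "norm (e m t) = 1" for m t
  proof -
    have "2 * pi * \<i> * (\<Sum>j\<in>UNIV. of_int (m j - m (inv \<sigma> j)) * of_real (t $ j)) =
        \<i> * of_real (2 * pi * (\<Sum>j\<in>UNIV. of_int (m j - m (inv \<sigma> j)) * t $ j))" by simp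
    thus ?thesis unfolding e_def by (simp only: norm_exp_i_times)
  qed
  have expand: "(\<Prod>i\<in>UNIV. \<Sum>\<^sub>\<infinity>k. A i k * exp (2 * pi * \<i> * of_int k * of_real (t $ i - t $ \<sigma> i))) = (\<Sum>\<^sub>\<infinity>m. a m * e m t)" for t
  proof -
    have "(\<Prod>i\<in>UNIV. \<Sum>\<^sub>\<infinity>k. A i k * exp (2 * pi * \<i> * of_int k * of_real (t $ i - t $ \<sigma> i))) =
       (\<Sum>\<^sub>\<infinity>m. \<Prod>i\<in>UNIV. A i (m i) * exp (2 * pi * \<i> * of_int (m i) * of_real (t $ i - t $ \<sigma> i)))"
      using infsum_prod_PiE_abs[of UNIV "\<lambda>i k. A i k * exp (2 * pi * \<i> * of_int k * of_real (t $ i - t $ \<sigma> i))" "\<lambda>_. UNIV"] A norm_e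
      by (simp add: norm_mult del: of_real_diff)
    also have "\<dots> = (\<Sum>\<^sub>\<infinity>m. a m * e m t)"
    proof (rule infsum_cong)
      fix m :: "'n \<Rightarrow> int"
      have "(\<Sum>i\<in>UNIV. of_int (m i) * complex_of_real (t $ \<sigma> i)) = (\<Sum>j\<in>UNIV. of_int (m (inv \<sigma> j)) * complex_of_real (t $ j))"
        using sum.permute[OF \<sigma>, of "\<lambda>j. of_int (m (inv \<sigma> j)) * complex_of_real (t $ j)"] permutes_inverses(2)[OF \<sigma>]
        by (simp add: o_def)
      hence "(\<Sum>i\<in>UNIV. of_int (m i) * complex_of_real (t $ i - t $ \<sigma> i)) = (\<Sum>j\<in>UNIV. of_int (m j - m (inv \<sigma> j)) * of_real (t $ j))"
        by (simp add: algebra_simps sum_subtractf)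
      hence "(\<Prod>i\<in>UNIV. exp (2 * pi * \<i> * of_int (m i) * of_real (t $ i - t $ \<sigma> i))) = e m t"
        unfolding e_def exp_sum[symmetric, OF finite_class.finite_UNIV] mult.assoc sum_distrib_left[symmetric] by simp
      thus "(\<Prod>i\<in>UNIV. A i (m i) * exp (2 * pi * \<i> * of_int (m i) * of_real (t $ i - t $ \<sigma> i))) = a m * e m t"
        by (simp only: prod.distrib a_def)
    qed
    finally show ?thesis .
  qed
  have eI: "(e m has_integral (if m \<circ> \<sigma> = m then 1 else 0)) (cbox 0 1)" for m
  proof -
    have "(\<lambda>j. m j - m (inv \<sigma> j)) = (\<lambda>_. 0) \<longleftrightarrow> m \<circ> \<sigma> = m"
      using permutes_inverses[OF \<sigma>] by (auto simp: fun_eq_iff) metis+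
    thus ?thesis using cube_exp_integral[of "\<lambda>j. m j - m (inv \<sigma> j)"] by (simp add: e_def)
  qed
  have ul: "uniform_limit (cbox 0 1) (\<lambda>X t. \<Sum>m\<in>X. a m * e m t) (\<lambda>t. \<Sum>\<^sub>\<infinity>m. a m * e m t) (finite_subsets_at_top UNIV)"
    by (rule Weierstrass_m_test_general[OF _ as]) (simp add: norm_mult ne)
  have ce: "continuous_on (cbox 0 1) (\<lambda>t. \<Sum>m\<in>X. a m * e m t)" for X
    unfolding e_def by (intro continuous_intros)
  obtain I J where IJ: "\<And>X. ((\<lambda>t. \<Sum>m\<in>X. a m * e m t) has_integral I X) (cbox 0 1)"
    "((\<lambda>t. \<Sum>\<^sub>\<infinity>m. a m * e m t) has_integral J) (cbox 0 1)" "(I \<longlongrightarrow> J) (finite_subsets_at_top UNIV)"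
    using uniform_limit_integral_cbox[OF ul ce finite_subsets_at_top_neq_bot] by blast
  have "I X = (\<Sum>m\<in>X. a m * (if m \<circ> \<sigma> = m then 1 else 0))" if "finite X" for X
    by (rule has_integral_unique[OF IJ(1)]) (intro has_integral_sum that has_integral_mult_right eI)
  hence "((\<lambda>X. \<Sum>m\<in>X. a m * (if m \<circ> \<sigma> = m then 1 else 0)) \<longlongrightarrow> J) (finite_subsets_at_top UNIV)"
    using IJ(3) by (rule_tac Lim_transform_eventually) (auto intro!: eventually_finite_subsets_at_top_weakI)
  hence "J = (\<Sum>\<^sub>\<infinity>m. a m * (if m \<circ> \<sigma> = m then 1 else 0))"
    by (intro infsumI[symmetric]) (simp add: has_sum_def)
  also have "\<dots> = (\<Sum>\<^sub>\<infinity>m | m \<circ> \<sigma> = m. a m)" by (rule infsum_cong_neutral) auto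
  also have "\<dots> = (\<Prod>C\<in>cycles_of \<sigma>. \<Sum>\<^sub>\<infinity>k. \<Prod>i\<in>C. A i k)"
    unfolding a_def
  proof (rule invariant_functions_sum(2)[OF \<sigma>])
    fix C assume "C \<in> cycles_of \<sigma>"
    then obtain i where i: "i \<in> C" using orbit_refl[OF \<sigma>] by (auto simp: cycles_of_def)
    \<comment> \<open>All factors but one are bounded by their total sums, so a single summable
      factor dominates the product over the cycle.\<close>
    define B where "B = (\<Prod>j\<in>C - {i}. \<Sum>\<^sub>\<infinity>k. norm (A j k))"
    have "norm (\<Prod>j\<in>C. A j k) \<le> norm (A i k) * B" for k
    proof -
      have "norm (A j k) \<le> (\<Sum>\<^sub>\<infinity>k. norm (A j k))" for j
        using finite_sum_le_infsum[OF A[of j], of "{k}"] by simp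
      hence "(\<Prod>j\<in>C - {i}. norm (A j k)) \<le> B" unfolding B_def by (intro prod_mono) auto
      hence "norm (A i k) * (\<Prod>j\<in>C - {i}. norm (A j k)) \<le> norm (A i k) * B" by (intro mult_left_mono) auto
      thus ?thesis using i by (simp add: prod_norm norm_mult prod.remove[of C i])
    qed
    thus "(\<lambda>k. norm (\<Prod>j\<in>C. A j k)) summable_on UNIV"
      by (intro summable_on_comparison_test[OF summable_on_cmult_left[OF A[of i], of B]]) auto
  qed
  finally show ?thesis using IJ(2) unfolding expand by simp
qed


section \<open>Traces and torus integrals as cycle expansions\<close>

lemma theta_minus: "theta \<tau> (- z) = - theta \<tau> z"
  by (simp add: theta_eq theta_num_minus)

lemma theta_eq_0_iff: "Im \<tau> > 0 \<Longrightarrow> theta \<tau> z = 0 \<longleftrightarrow> theta_num \<tau> z = 0"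
  using theta_den_nonzero by (simp add: theta_eq)

lemma theta_holomorphic: "Im \<tau> > 0 \<Longrightarrow> theta \<tau> holomorphic_on UNIV"
  unfolding theta_eq[abs_def] using theta_den_nonzero theta_num_holomorphic by (intro holomorphic_intros)

lemma theta_mult:
  assumes "Im \<tau> > 0"
  shows "theta \<tau> (x + y) * theta \<tau> (x - y) =
     infsum (gauss_term \<tau> x) {r. odd r} / theta_den \<tau> * (infsum (gauss_term \<tau> y) {d. even d} / theta_den \<tau>) -
     infsum (gauss_term \<tau> x) {r. even r} / theta_den \<tau> * (infsum (gauss_term \<tau> y) {d. odd d} / theta_den \<tau>)"
  unfolding theta_eq times_divide_times_eq diff_divide_distrib[symmetric] theta_num_mult[OF assms] ..

lemma theta_nonzero_strip:
  assumes "Im \<tau> > 0" "0 < Re x \<and> Re x < width \<tau> \<or> - width \<tau> < Re x \<and> Re x < 0"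
  shows "theta \<tau> x \<noteq> 0"
  using theta_num_nonzero_strip[OF assms(1), of x] theta_num_nonzero_strip[OF assms(1), of "- x"] assms
  by (auto simp: theta_eq_0_iff theta_num_minus)

lemma cycles_of_closed:
  assumes "C \<in> cycles_of \<sigma>" "i \<in> C"
  shows "\<sigma> i \<in> C"
  using assms by (auto simp: cycles_of_def intro: orbit.step)

text \<open>A fixed point is stored as a value of the Kronecker function and not as a series: at an
  admissible point \<open>z $ i\<close> need not lie in a strip of convergence.\<close>

definition cycle_factor :: "complex \<Rightarrow> complex \<Rightarrow> complex ^ 'n::{finite,linorder} \<Rightarrow> ('n \<Rightarrow> 'n) \<Rightarrow> 'n set \<Rightarrow> complex" where
  "cycle_factor \<tau> c z \<sigma> C =
     (if \<exists>i. C = {i} then kronecker \<tau> c (\<Sum>i\<in>C. z $ i)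
      else \<Sum>\<^sub>\<infinity>k. exp ((\<Sum>i\<in>C. z $ i) * of_int k) * occupation \<tau> c k ^ card {i\<in>C. i \<le> \<sigma> i} *
             (occupation \<tau> c k - 1) ^ card {i\<in>C. \<sigma> i < i})"

definition cycle_expansion :: "complex \<Rightarrow> complex \<Rightarrow> complex ^ 'n::{finite,linorder} \<Rightarrow> complex" where
  "cycle_expansion \<tau> c z =
     (\<Sum>\<sigma> | \<sigma> permutes UNIV. of_int (sign \<sigma>) * (\<Prod>C\<in>cycles_of \<sigma>. cycle_factor \<tau> c z \<sigma> C))"

lemma Re_subset_sum:
  fixes z :: "complex ^ 'n::{finite,linorder}"
  assumes "\<And>i. Re (z $ i) > 0" "Re (\<Sum>i\<in>UNIV. z $ i) < w" "C \<noteq> {}"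
  shows "0 < Re (\<Sum>i\<in>C. z $ i)" "Re (\<Sum>i\<in>C. z $ i) < w"
proof -
  show "Re (\<Sum>i\<in>C. z $ i) > 0" using assms by (auto intro!: sum_pos)
  have "Re (\<Sum>i\<in>C. z $ i) \<le> Re (\<Sum>i\<in>UNIV. z $ i)"
    unfolding Re_sum using assms(1) by (intro sum_mono2) (auto intro: less_imp_le)
  thus "Re (\<Sum>i\<in>C. z $ i) < w" using assms(2) by simp
qed

lemma trace_cycle_expansion:
  fixes z :: "complex ^ 'n::{finite,linorder}"
  assumes \<tau>: "Im \<tau> > 0" and z: "\<And>i. Re (z $ i) > 0" "Re (\<Sum>i\<in>UNIV. z $ i) < width \<tau>"
    and c: "theta_num \<tau> c \<noteq> 0"
  shows "theta \<tau> (c + (\<Sum>i\<in>UNIV. z $ i)) * euler_prod (nome \<tau>) * (\<Sum>\<^sub>\<infinity>lam\<in>int_partitions. trace_term \<tau> z lam) =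
    theta \<tau> c * cycle_expansion \<tau> c z"
proof -
  let ?Z = "\<Sum>i\<in>UNIV. z $ i"
  let ?F = "\<Sum>\<^sub>\<infinity>lam\<in>int_partitions. trace_term \<tau> z lam"
  let ?S = "\<Sum>\<^sub>\<infinity>m. (\<Prod>i\<in>UNIV. exp (z $ i * of_int (m i))) * (\<Prod>s\<in>range m. occupation \<tau> c s)"
  note sub = Re_subset_sum[OF z]
  have w: "width \<tau> > 0" using \<tau> by (simp add: width_def)
  have ne: "C \<noteq> {}" if "\<sigma> permutes UNIV" "C \<in> cycles_of \<sigma>" for \<sigma> and C :: "'n set"
    using that orbit_refl[OF that(1)] by (auto simp: cycles_of_def)
  have summ: "(\<lambda>k. norm (\<Prod>i\<in>C. exp (z $ i * of_int k) * order_weight (occupation \<tau> c) i (\<sigma> i) k)) summable_on UNIV"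
    if \<sigma>: "\<sigma> permutes UNIV" "C \<in> cycles_of \<sigma>" for \<sigma> C
    unfolding cycle_product
  proof (rule exp_occupation_summable[OF \<tau> c])
    have "0 \<le> real (card {i\<in>C. \<sigma> i < i}) * width \<tau>" using w by simp
    thus "- (real (card {i\<in>C. \<sigma> i < i}) * width \<tau>) < Re (\<Sum>i\<in>C. z $ i)" using sub(1)[OF ne[OF \<sigma>]] by linarith
    have "1 * width \<tau> \<le> real (card {i\<in>C. i \<le> \<sigma> i}) * width \<tau>" using card_ascents(1)[OF \<sigma>] w
      by (intro mult_right_mono) auto
    thus "Re (\<Sum>i\<in>C. z $ i) < real (card {i\<in>C. i \<le> \<sigma> i}) * width \<tau>" using sub(2)[OF ne[OF \<sigma>]] by linarith
  qed
  \<comment> \<open>Here all nonempty partial sums of \<open>z\<close> lie in the basic strip, so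
    the series of a fixed point may be resummed by \<open>kronecker_expansion\<close>.\<close>
  have factor: "(\<Sum>\<^sub>\<infinity>k. \<Prod>i\<in>C. exp (z $ i * of_int k) * order_weight (occupation \<tau> c) i (\<sigma> i) k) = cycle_factor \<tau> c z \<sigma> C"
    if \<sigma>: "\<sigma> permutes UNIV" "C \<in> cycles_of \<sigma>" for \<sigma> C
  proof (cases "\<exists>i. C = {i}")
    case True
    then obtain i where C: "C = {i}" by blast
    hence "\<sigma> i = i" using cycles_of_closed[OF \<sigma>(2), of i] by simp
    thus ?thesis using infsumI[OF kronecker_expansion[OF \<tau> _ _ c, of "z $ i"]] sub[of "{i}"]
      by (simp add: C cycle_factor_def order_weight_def)
  next
    case False
    thus ?thesis by (simp only: cycle_factor_def if_False cycle_product)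
  qed
  have "?S = (\<Sum>\<sigma> | \<sigma> permutes UNIV. of_int (sign \<sigma>) *
      (\<Prod>C\<in>cycles_of \<sigma>. \<Sum>\<^sub>\<infinity>k. \<Prod>i\<in>C. exp (z $ i * of_int k) * order_weight (occupation \<tau> c) i (\<sigma> i) k))"
    by (rule level_sum_cycles(2)[of "\<lambda>i k. exp (z $ i * of_int k)" "occupation \<tau> c"]) (rule summ)
  also have "\<dots> = cycle_expansion \<tau> c z"
    unfolding cycle_expansion_def
    by (intro sum.cong refl arg_cong2[where f = "(*)"] prod.cong factor) auto
  finally have "?S = cycle_expansion \<tau> c z" .
  hence "theta_num \<tau> (c + ?Z) * ?F = theta_num \<tau> c * partition_gf (nome \<tau>) * cycle_expansion \<tau> c z"
    using trace_formula[OF assms] by simp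
  hence "theta_num \<tau> (c + ?Z) * euler_prod (nome \<tau>) * ?F =
      theta_num \<tau> c * (partition_gf (nome \<tau>) * euler_prod (nome \<tau>)) * cycle_expansion \<tau> c z"
    by (metis mult.assoc mult.commute)
  thus ?thesis by (simp add: partition_gf_nome[OF \<tau>] theta_eq)
qed

text \<open>Frobenius' determinant with \<open>a i = z $ i + w $ i\<close> and
  \<open>b j = w $ j\<close>, whose diagonal differences are the \<open>z $ i\<close>. The left-hand
  side is free of \<open>c\<close>, so any generic value serves.\<close>

lemma varpi_det:
  fixes z w :: "complex ^ 'n::{finite,linorder}"
  assumes \<tau>: "Im \<tau> > 0"
    and nz: "\<And>i j. theta \<tau> (z $ i + w $ i - w $ j) \<noteq> 0"
    and c: "\<And>T. theta \<tau> (c + (\<Sum>i\<in>T. z $ i)) \<noteq> 0"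
  shows "varpi \<tau> z w = theta \<tau> (\<Sum>i\<in>UNIV. z $ i) * theta \<tau> c / theta \<tau> (c + (\<Sum>i\<in>UNIV. z $ i)) *
    (\<Sum>\<sigma> | \<sigma> permutes UNIV. of_int (sign \<sigma>) * (\<Prod>i\<in>UNIV. kronecker \<tau> c (z $ i + w $ i - w $ \<sigma> i)))"
proof -
  let ?f = "theta \<tau>" and ?a = "\<lambda>i. z $ i + w $ i" and ?b = "\<lambda>i. w $ i"
  let ?Z = "\<Sum>i\<in>UNIV. z $ i"
  let ?P = "{(i,j). i < j} :: ('n \<times> 'n) set"
  have ab: "(\<Sum>i\<in>T. ?a i - ?b i) = (\<Sum>i\<in>T. z $ i)" for T by simp
  have "block_det UNIV (\<lambda>i j. ?f (c + ?a i - ?b j) / (?f c * ?f (?a i - ?b j))) =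
     ?f (c + (\<Sum>i\<in>UNIV. ?a i - ?b i)) / ?f c *
     ((\<Prod>(i,j)\<in>{(i,j). i \<in> UNIV \<and> j \<in> UNIV \<and> i < j}. ?f (?a i - ?a j) * ?f (?b j - ?b i)) /
      ((\<Prod>i\<in>UNIV. ?f (?a i - ?b i)) * (\<Prod>(i,j)\<in>{(i,j). i \<in> UNIV \<and> j \<in> UNIV \<and> i < j}. ?f (?a i - ?b j) * ?f (?a j - ?b i))))"
    by (rule frobenius_det[where B = "\<lambda>x. infsum (gauss_term \<tau> x) {r. odd r} / theta_den \<tau>"
          and A = "\<lambda>x. infsum (gauss_term \<tau> x) {r. even r} / theta_den \<tau>"])
      (use theta_mult[OF \<tau>] nz c in \<open>simp_all only: ab not_False_eq_True\<close>)
  also have "block_det UNIV (\<lambda>i j. ?f (c + ?a i - ?b j) / (?f c * ?f (?a i - ?b j))) =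
      (\<Sum>\<sigma> | \<sigma> permutes UNIV. of_int (sign \<sigma>) * (\<Prod>i\<in>UNIV. kronecker \<tau> c (?a i - ?b (\<sigma> i))))"
    by (simp add: block_det_def det_def kronecker_def add_diff_eq add.assoc)
  finally have det: "(\<Sum>\<sigma> | \<sigma> permutes UNIV. of_int (sign \<sigma>) * (\<Prod>i\<in>UNIV. kronecker \<tau> c (?a i - ?b (\<sigma> i)))) =
     ?f (c + ?Z) / ?f c * ((\<Prod>(i,j)\<in>?P. ?f (?a i - ?a j) * ?f (?b j - ?b i)) /
      ((\<Prod>i\<in>UNIV. ?f (z $ i)) * (\<Prod>(i,j)\<in>?P. ?f (?a i - ?b j) * ?f (?a j - ?b i))))"
    by simp
  have frac: "X / (W * Y) = X' / (W * Y')" if "X / Y = X' / Y'" for W X X' Y Y' :: complex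
    using that by (metis divide_divide_eq_left mult.commute)
  have "(\<Prod>(i,j)\<in>?P. ?f (z $ i + w $ i - z $ j - w $ j) * ?f (w $ i - w $ j)) / (\<Prod>(i,j)\<in>?P. ?f (z $ i + w $ i - w $ j) * ?f (w $ i - z $ j - w $ j)) =
      (\<Prod>(i,j)\<in>?P. ?f (?a i - ?a j) * ?f (?b j - ?b i)) / (\<Prod>(i,j)\<in>?P. ?f (?a i - ?b j) * ?f (?a j - ?b i))"
    \<comment> \<open>Compared with the determinant, each pair has one sign changed in the numerator
      and one in the denominator.\<close>
    unfolding prod_dividef[symmetric]
  proof (intro prod.cong refl)
    fix p :: "'n \<times> 'n"
    obtain i j where p: "p = (i, j)" by force
    have 1: "?f (w $ i - w $ j) = - ?f (?b j - ?b i)" using theta_minus[of \<tau> "?b j - ?b i"] by simp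
    have 2: "?f (w $ i - z $ j - w $ j) = - ?f (?a j - ?b i)" using theta_minus[of \<tau> "?a j - ?b i"] by (simp add: algebra_simps)
    have 3: "z $ i + w $ i - z $ j - w $ j = ?a i - ?a j" by simp
    show "(case p of (i, j) \<Rightarrow> ?f (z $ i + w $ i - z $ j - w $ j) * ?f (w $ i - w $ j)) / (case p of (i, j) \<Rightarrow> ?f (z $ i + w $ i - w $ j) * ?f (w $ i - z $ j - w $ j)) =
      (case p of (i, j) \<Rightarrow> ?f (?a i - ?a j) * ?f (?b j - ?b i)) / (case p of (i, j) \<Rightarrow> ?f (?a i - ?b j) * ?f (?a j - ?b i))"
      unfolding p prod.case 1 2 3 by simp
  qed
  hence "varpi \<tau> z w = ?f ?Z * ((\<Prod>(i,j)\<in>?P. ?f (?a i - ?a j) * ?f (?b j - ?b i)) /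
      ((\<Prod>i\<in>UNIV. ?f (z $ i)) * (\<Prod>(i,j)\<in>?P. ?f (?a i - ?b j) * ?f (?a j - ?b i))))"
    unfolding varpi_def by (intro arg_cong[where f = "(*) (?f ?Z)"] frac)
  moreover have "?f c \<noteq> 0" "?f (c + ?Z) \<noteq> 0" using c[of "{}"] c[of UNIV] by auto
  ultimately show ?thesis unfolding det by simp
qed

text \<open>On each circle dv / v pulls back to 2 pi i dt, which cancels the normalisation.\<close>

lemma torus_integral_eq:
  fixes z :: "complex ^ 'n::{finite,linorder}"
  assumes "\<And>j. \<rho> $ j > 0"
  shows "torus_integral \<tau> z \<rho> = integral (cbox 0 1) (\<lambda>t. varpi \<tau> z (torus_lift \<rho> t))"
proof -
  have "vector_derivative (circlepath 0 r) (at s) / circlepath 0 r s = 2 * pi * \<i>" if "r > 0" for r s :: real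
    using that unfolding vector_derivative_circlepath by (simp add: circlepath)
  hence "(\<Prod>j\<in>(UNIV :: 'n set). vector_derivative (circlepath 0 (\<rho> $ j)) (at (t $ j)) / circlepath 0 (\<rho> $ j) (t $ j)) = (2 * pi * \<i>) ^ CARD('n)" for t
    using assms by simp
  hence "torus_integral \<tau> z \<rho> = (1 / (2 * pi * \<i>)) ^ CARD('n) * (integral (cbox 0 1) (\<lambda>t. varpi \<tau> z (torus_lift \<rho> t)) * (2 * pi * \<i>) ^ CARD('n))"
    unfolding torus_integral_def by (simp only: integral_mult_left)
  also have "\<dots> = ((1 / (2 * pi * \<i>)) * (2 * pi * \<i>)) ^ CARD('n) * integral (cbox 0 1) (\<lambda>t. varpi \<tau> z (torus_lift \<rho> t))"
    unfolding power_mult_distrib by (simp only: mult_ac)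
  finally show ?thesis by simp
qed

text \<open>The cycle expansion comes from integrating the determinant permutation by permutation.
  The second claim adds the strip bounds of the entries along a nontrivial cycle: the logarithms of
  the radii telescope away and the total of \<open>z\<close> over the cycle remains.\<close>

lemma torus_formula:
  fixes z :: "complex ^ 'n::{finite,linorder}"
  assumes \<tau>: "Im \<tau> > 0" and \<rho>: "admissible_radii \<tau> z \<rho>" and z: "\<And>i. theta \<tau> (z $ i) \<noteq> 0"
    and c: "\<And>T. theta \<tau> (c + (\<Sum>i\<in>T. z $ i)) \<noteq> 0"
  shows "torus_integral \<tau> z \<rho> = theta \<tau> (\<Sum>i\<in>UNIV. z $ i) * theta \<tau> c / theta \<tau> (c + (\<Sum>i\<in>UNIV. z $ i)) * cycle_expansion \<tau> c z"
    and "\<And>\<sigma> C. \<sigma> permutes UNIV \<Longrightarrow> C \<in> cycles_of \<sigma> \<Longrightarrow> \<not> (\<exists>i. C = {i}) \<Longrightarrow>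
      - (real (card {i\<in>C. \<sigma> i < i}) * width \<tau>) < Re (\<Sum>i\<in>C. z $ i) \<and>
      Re (\<Sum>i\<in>C. z $ i) < real (card {i\<in>C. i \<le> \<sigma> i}) * width \<tau>"
proof -
  define x where "x = (\<lambda>j. ln (\<rho> $ j))"
  have pos: "\<rho> $ j > 0" for j using \<rho> by (simp add: admissible_radii_def)
  have \<rho>x: "\<rho> $ j = exp (x j)" for j using pos by (simp add: x_def)
  have inv: "inverse (norm (nome \<tau>)) = exp (width \<tau>)" by (simp add: norm_nome width_def exp_minus)
  \<comment> \<open>In logarithms, the first admissibility condition at i < j places the entry (i,
    j) in the right strip, and the second places the entry (j, i) in the left one.\<close>
  have up: "0 < Re (z $ i) + x i - x j" "Re (z $ i) + x i - x j < width \<tau>"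
    and down: "- width \<tau> < Re (z $ j) + x j - x i" "Re (z $ j) + x j - x i < 0" if "i < j" for i j
  proof -
    have "norm (exp (z $ i)) * \<rho> $ i / \<rho> $ j = exp (Re (z $ i) + x i - x j)"
      "\<rho> $ i / (norm (exp (z $ j)) * \<rho> $ j) = exp (x i - Re (z $ j) - x j)"
      by (simp_all add: \<rho>x norm_exp_eq_Re exp_add exp_diff)
    hence "1 < exp (Re (z $ i) + x i - x j)" "exp (Re (z $ i) + x i - x j) < exp (width \<tau>)"
      "1 < exp (x i - Re (z $ j) - x j)" "exp (x i - Re (z $ j) - x j) < exp (width \<tau>)"
      using \<rho> that unfolding admissible_radii_def inv by metis+
    thus "0 < Re (z $ i) + x i - x j" "Re (z $ i) + x i - x j < width \<tau>"
      "- width \<tau> < Re (z $ j) + x j - x i" "Re (z $ j) + x j - x i < 0" by auto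
  qed
  have c0: "theta_num \<tau> c \<noteq> 0" using c[of "{}"] theta_eq_0_iff[OF \<tau>] by simp
  let ?p = "occupation \<tau> c"
  define y where "y = (\<lambda>\<sigma> i. z $ i + of_real (x i - x (\<sigma> i)))"
  have y_up: "0 < Re (y \<sigma> i) \<and> Re (y \<sigma> i) < width \<tau>" if "i < \<sigma> i" for \<sigma> i
    using up[OF that] by (simp add: y_def)
  have y_down: "- width \<tau> < Re (y \<sigma> i) \<and> Re (y \<sigma> i) < 0" if "\<sigma> i < i" for \<sigma> i
    using down[OF that] by (simp add: y_def)
  \<comment> \<open>At a fixed point the angles cancel and the entry is constant on the torus, so
    its Fourier series has only the mode 0.\<close>
  define A where "A = (\<lambda>\<sigma> i k. if \<sigma> i = i then (if k = 0 then kronecker \<tau> c (z $ i) else 0)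
      else exp (y \<sigma> i * of_int k) * order_weight ?p i (\<sigma> i) k)"
  have A_summable: "(\<lambda>k. norm (A \<sigma> i k)) summable_on UNIV" for \<sigma> i
  proof (cases i "\<sigma> i" rule: linorder_cases)
    case less
    thus ?thesis using exp_occupation_summable[OF \<tau> c0, of 0 "y \<sigma> i" 1] y_up[of i \<sigma>, OF less] less_imp_le[OF less] less_imp_neq[OF less]
      by (simp add: A_def order_weight_def)
  next
    case equal
    have "(\<lambda>k. norm (if k = (0::int) then kronecker \<tau> c (z $ i) else 0)) summable_on UNIV"
      by (rule summable_on_cong_neutral[where S = "{0}", THEN iffD1, rotated 3]) auto
    thus ?thesis using equal[symmetric] by (simp add: A_def)
  next
    case greater
    thus ?thesis using exp_occupation_summable[OF \<tau> c0, of 1 "y \<sigma> i" 0] y_down[of \<sigma> i, OF greater] greater[unfolded not_le[symmetric]] less_imp_neq[OF greater]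
      by (simp add: A_def order_weight_def)
  qed
  have kron: "kronecker \<tau> c (z $ i + torus_lift \<rho> t $ i - torus_lift \<rho> t $ \<sigma> i) =
      (\<Sum>\<^sub>\<infinity>k. A \<sigma> i k * exp (2 * pi * \<i> * of_int k * of_real (t $ i - t $ \<sigma> i)))" for \<sigma> i t
  proof -
    define v where "v = z $ i + torus_lift \<rho> t $ i - torus_lift \<rho> t $ \<sigma> i"
    have v: "v = y \<sigma> i + 2 * pi * \<i> * of_real (t $ i - t $ \<sigma> i)"
      by (simp add: v_def torus_lift_def y_def x_def algebra_simps)
    have Rev: "Re v = Re (y \<sigma> i)" by (simp add: v)
    have e: "exp (v * of_int k) = exp (y \<sigma> i * of_int k) * exp (2 * pi * \<i> * of_int k * of_real (t $ i - t $ \<sigma> i))" for k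
      unfolding v exp_add[symmetric] by (rule arg_cong[where f = exp]) (simp only: algebra_simps)
    show ?thesis
    proof (cases i "\<sigma> i" rule: linorder_cases)
      case less
      have "kronecker \<tau> c v = (\<Sum>\<^sub>\<infinity>k. exp (v * of_int k) * ?p k)"
        using infsumI[OF kronecker_expansion[OF \<tau> _ _ c0, of v]] y_up[of i \<sigma>, OF less] Rev by simp
      also have "\<dots> = (\<Sum>\<^sub>\<infinity>k. A \<sigma> i k * exp (2 * pi * \<i> * of_int k * of_real (t $ i - t $ \<sigma> i)))"
        using less less_imp_neq[OF less] unfolding e by (intro infsum_cong) (auto simp: A_def order_weight_def)
      finally show ?thesis by (simp only: v_def)
    next
      case equal
      have "(\<Sum>\<^sub>\<infinity>k. A \<sigma> i k * exp (2 * pi * \<i> * of_int k * of_real (t $ i - t $ \<sigma> i))) =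
          (\<Sum>\<^sub>\<infinity>k\<in>{0::int}. kronecker \<tau> c (z $ i))"
        using equal[symmetric] by (intro infsum_cong_neutral) (auto simp: A_def)
      thus ?thesis using equal[symmetric] by simp
    next
      case greater
      have "kronecker \<tau> c v = (\<Sum>\<^sub>\<infinity>k. exp (v * of_int k) * (?p k - 1))"
        using infsumI[OF kronecker_expansion_neg[OF \<tau> _ _ c0, of v]] y_down[of \<sigma> i, OF greater] Rev by simp
      also have "\<dots> = (\<Sum>\<^sub>\<infinity>k. A \<sigma> i k * exp (2 * pi * \<i> * of_int k * of_real (t $ i - t $ \<sigma> i)))"
        using greater less_imp_neq[OF greater] unfolding e by (intro infsum_cong) (auto simp: A_def order_weight_def)
      finally show ?thesis by (simp only: v_def)
    qed
  qed
  have fixed: "(\<exists>i. C = {i} \<and> \<sigma> i = i) \<or> (\<forall>i\<in>C. \<sigma> i \<noteq> i) \<and> \<not> (\<exists>i. C = {i})"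
    and xsum: "(\<Sum>i\<in>C. y \<sigma> i) = (\<Sum>i\<in>C. z $ i)" if \<sigma>: "\<sigma> permutes UNIV" "C \<in> cycles_of \<sigma>" for \<sigma> C
  proof -
    obtain j where j: "C = orbit \<sigma> j" using \<sigma>(2) by (auto simp: cycles_of_def)
    have cl: "\<sigma> ` C \<subseteq> C" using j by (auto intro: orbit.step)
    have inj: "inj_on \<sigma> C" using permutes_inj[OF \<sigma>(1)] by (rule inj_on_subset) auto
    have im: "\<sigma> ` C = C" using cl inj by (simp add: endo_inj_surj)
    show "(\<exists>i. C = {i} \<and> \<sigma> i = i) \<or> (\<forall>i\<in>C. \<sigma> i \<noteq> i) \<and> \<not> (\<exists>i. C = {i})"
      using card_ascents(2)[OF \<sigma>] cl by auto
    have "(\<Sum>i\<in>C. x (\<sigma> i)) = (\<Sum>i\<in>C. x i)" using sum.reindex[OF inj, of x] im by simp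
    hence "(\<Sum>i\<in>C. x i - x (\<sigma> i)) = 0" by (simp add: sum_subtractf)
    hence "(\<Sum>i\<in>C. complex_of_real (x i - x (\<sigma> i))) = 0" by (metis of_real_0 of_real_sum)
    thus "(\<Sum>i\<in>C. y \<sigma> i) = (\<Sum>i\<in>C. z $ i)" by (simp only: y_def sum.distrib add_0_right)
  qed
  have cyc: "(\<Sum>\<^sub>\<infinity>k. \<Prod>i\<in>C. A \<sigma> i k) = cycle_factor \<tau> c z \<sigma> C" if \<sigma>: "\<sigma> permutes UNIV" "C \<in> cycles_of \<sigma>" for \<sigma> C
    using fixed[OF \<sigma>]
  proof (elim disjE exE conjE)
    fix i assume i: "C = {i}" "\<sigma> i = i"
    have "(\<Sum>\<^sub>\<infinity>k. \<Prod>i\<in>C. A \<sigma> i k) = (\<Sum>\<^sub>\<infinity>k\<in>{0::int}. kronecker \<tau> c (z $ i))"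
      using i by (intro infsum_cong_neutral) (auto simp: A_def)
    thus ?thesis using i by (simp add: cycle_factor_def)
  next
    assume n: "\<forall>i\<in>C. \<sigma> i \<noteq> i" "\<not> (\<exists>i. C = {i})"
    have "(\<Sum>\<^sub>\<infinity>k. \<Prod>i\<in>C. A \<sigma> i k) = (\<Sum>\<^sub>\<infinity>k. \<Prod>i\<in>C. exp (y \<sigma> i * of_int k) * order_weight ?p i (\<sigma> i) k)"
      using n(1) by (intro infsum_cong prod.cong) (auto simp: A_def)
    thus ?thesis using n(2) by (simp only: cycle_product xsum[OF \<sigma>] cycle_factor_def if_False)
  qed
  let ?K = "theta \<tau> (\<Sum>i\<in>UNIV. z $ i) * theta \<tau> c / theta \<tau> (c + (\<Sum>i\<in>UNIV. z $ i))"
  have nz: "theta \<tau> (z $ i + torus_lift \<rho> t $ i - torus_lift \<rho> t $ j) \<noteq> 0" for t i j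
  proof (cases i j rule: linorder_cases)
    case equal
    thus ?thesis using z by simp
  qed (use up[of i j] down[of j i] in \<open>auto intro!: theta_nonzero_strip[OF \<tau>] simp: torus_lift_def x_def\<close>)
  have "((\<lambda>t. \<Prod>i\<in>UNIV. kronecker \<tau> c (z $ i + torus_lift \<rho> t $ i - torus_lift \<rho> t $ \<sigma> i)) has_integral
      (\<Prod>C\<in>cycles_of \<sigma>. cycle_factor \<tau> c z \<sigma> C)) (cbox 0 1)" if \<sigma>: "\<sigma> permutes UNIV" for \<sigma>
    using cube_cycle_integral[OF \<sigma>, of "A \<sigma>", OF A_summable] cyc[OF \<sigma>] unfolding kron by simp
  hence "((\<lambda>t. ?K * (\<Sum>\<sigma> | \<sigma> permutes UNIV. of_int (sign \<sigma>) * (\<Prod>i\<in>UNIV. kronecker \<tau> c (z $ i + torus_lift \<rho> t $ i - torus_lift \<rho> t $ \<sigma> i)))) has_integral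
      ?K * cycle_expansion \<tau> c z) (cbox 0 1)"
    unfolding cycle_expansion_def
    by (intro has_integral_mult_right has_integral_sum) (auto simp: finite_permutations)
  hence "((\<lambda>t. varpi \<tau> z (torus_lift \<rho> t)) has_integral ?K * cycle_expansion \<tau> c z) (cbox 0 1)"
    by (simp only: varpi_det[OF \<tau> nz c])
  thus "torus_integral \<tau> z \<rho> = ?K * cycle_expansion \<tau> c z"
    unfolding torus_integral_eq[OF pos] by (rule integral_unique)
  show "- (real (card {i\<in>C. \<sigma> i < i}) * width \<tau>) < Re (\<Sum>i\<in>C. z $ i) \<and>
      Re (\<Sum>i\<in>C. z $ i) < real (card {i\<in>C. i \<le> \<sigma> i}) * width \<tau>"
    if \<sigma>: "\<sigma> permutes UNIV" "C \<in> cycles_of \<sigma>" "\<not> (\<exists>i. C = {i})" for \<sigma> C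
  proof -
    have w: "width \<tau> > 0" using \<tau> by (simp add: width_def)
    have nf: "\<forall>i\<in>C. \<sigma> i \<noteq> i" using fixed[OF \<sigma>(1,2)] \<sigma>(3) by blast
    have lo: "- (if \<sigma> i < i then width \<tau> else 0) < Re (y \<sigma> i)"
      and hi: "Re (y \<sigma> i) < (if i \<le> \<sigma> i then width \<tau> else 0)" if "i \<in> C" for i
      using y_up[of i \<sigma>] y_down[of \<sigma> i] nf that w by (auto simp: not_less le_less)
    have "finite C" "C \<noteq> {}" using card_ascents(1)[OF \<sigma>(1,2)] by auto
    have "(\<Sum>i\<in>C. - (if \<sigma> i < i then width \<tau> else 0)) < (\<Sum>i\<in>C. Re (y \<sigma> i))"
      using lo by (intro sum_strict_mono \<open>finite C\<close> \<open>C \<noteq> {}\<close>)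
    moreover have "(\<Sum>i\<in>C. Re (y \<sigma> i)) < (\<Sum>i\<in>C. if i \<le> \<sigma> i then width \<tau> else 0)"
      using hi by (intro sum_strict_mono \<open>finite C\<close> \<open>C \<noteq> {}\<close>)
    moreover have "(\<Sum>i\<in>C. Re (y \<sigma> i)) = Re (\<Sum>i\<in>C. z $ i)"
      unfolding xsum[OF \<sigma>(1,2), symmetric] by simp
    moreover have "(\<Sum>i\<in>C. - (if \<sigma> i < i then width \<tau> else 0)) = - (real (card {i\<in>C. \<sigma> i < i}) * width \<tau>)"
      by (simp add: sum_negf sum.inter_filter[symmetric])
    moreover have "(\<Sum>i\<in>C. if i \<le> \<sigma> i then width \<tau> else 0) = real (card {i\<in>C. i \<le> \<sigma> i}) * width \<tau>"
      by (simp add: sum.inter_filter[symmetric])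
    ultimately show ?thesis by linarith
  qed
qed


section \<open>Domains of convergence\<close>

lemma partition_exp_summable:
  assumes "Re x > 0" "lam \<in> int_partitions"
  shows "partition_exp x lam summable_on UNIV"
proof -
  have "maya_code (0, lam) \<in> {X. finite X}"
    using bij_betw_maya_code assms(2) unfolding bij_betw_def by blast
  hence "(\<lambda>s. norm (exp (x * of_int s))) summable_on maya_set (maya_code (0, lam))"
    using assms(1) by (intro exp_maya_set_summable) auto
  hence "(\<lambda>s. exp (x * of_int s)) summable_on range (maya_seq 0 lam)"
    unfolding maya_code_def prod.case maya_set_involution by (rule abs_summable_summable)
  hence "(\<lambda>k. exp (x * of_int (maya_seq 0 lam k))) summable_on UNIV"
    using summable_on_reindex[OF maya_seq_inj[OF assms(2), of 0], of "\<lambda>s. exp (x * of_int s)"] by (simp add: o_def)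
  from summable_on_cmult_right[OF this, of "exp (x / 2)"]
  show ?thesis
    by (rule summable_on_cong[THEN iffD1, rotated])
      (simp add: partition_exp_def maya_seq_def algebra_simps flip: exp_add)
qed

text \<open>The test family for the upper bound in \<open>trace_convergent_iff\<close>: its trace
  terms behave like (q exp Z)^N, with Z the sum of the coordinates.\<close>

definition one_row :: "nat \<Rightarrow> nat \<Rightarrow> nat" where
  "one_row N = (\<lambda>k. if k = 0 then N else 0)"

lemma one_row_partition: "one_row N \<in> int_partitions" "partition_size (one_row N) = N" "inj one_row"
proof -
  have "{k. one_row N k \<noteq> 0} \<subseteq> {0}" by (auto simp: one_row_def)
  hence f: "finite {k. one_row N k \<noteq> 0}" by (rule finite_subset) simp
  thus "one_row N \<in> int_partitions" by (auto simp: int_partitions_def antimono_def one_row_def)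
  have "partition_size (one_row N) = (\<Sum>k\<in>{0}. one_row N k)"
    unfolding partition_size_def by (rule sum.mono_neutral_left) (auto simp: one_row_def)
  thus "partition_size (one_row N) = N" by (simp add: one_row_def)
  show "inj one_row" by (rule injI) (metis one_row_def)
qed

lemma one_row_sum:
  assumes "Re x > 0"
  shows "(\<Sum>\<^sub>\<infinity>k. partition_exp x (one_row N) k) =
    exp (x * (of_nat N - 1/2)) + ((\<Sum>\<^sub>\<infinity>k. partition_exp x (one_row 0) k) - exp (x * (- 1/2)))"
proof -
  have eq: "(\<Sum>\<^sub>\<infinity>k. partition_exp x (one_row M) k) = exp (x * (of_nat M - 1/2)) + (\<Sum>\<^sub>\<infinity>k\<in>-{0}. partition_exp x (one_row 0) k)" for M
  proof -
    have s: "partition_exp x (one_row M) summable_on - {0}"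
      by (rule summable_on_subset_banach[OF partition_exp_summable[OF assms one_row_partition(1)]]) auto
    have "(\<Sum>\<^sub>\<infinity>k. partition_exp x (one_row M) k) = (\<Sum>\<^sub>\<infinity>k\<in>{0} \<union> - {0}. partition_exp x (one_row M) k)" by simp
    also have "\<dots> = partition_exp x (one_row M) 0 + (\<Sum>\<^sub>\<infinity>k\<in>-{0}. partition_exp x (one_row M) k)"
      by (subst infsum_Un_disjoint) (use s in auto)
    also have "(\<Sum>\<^sub>\<infinity>k\<in>-{0}. partition_exp x (one_row M) k) = (\<Sum>\<^sub>\<infinity>k\<in>-{0}. partition_exp x (one_row 0) k)"
      by (intro infsum_cong) (simp add: partition_exp_def one_row_def)
    finally show ?thesis by (simp add: partition_exp_def one_row_def)
  qed
  show ?thesis using eq[of N] eq[of 0] by simp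
qed

text \<open>The exact domain matters because \<open>is_GW_function\<close> prescribes values
  wherever the trace converges. The empty partition forces positive real parts, partitions with one
  row force |q exp Z| < 1 for the sum Z of the coordinates, and \<open>fock_trace\<close> gives the
  converse.\<close>

lemma trace_convergent_iff:
  fixes z :: "complex ^ 'n::{finite,linorder}"
  assumes \<tau>: "Im \<tau> > 0"
  shows "trace_convergent \<tau> z \<longleftrightarrow> (\<forall>i. Re (z $ i) > 0) \<and> Re (\<Sum>i\<in>UNIV. z $ i) < width \<tau>"
proof safe
  assume conv: "trace_convergent \<tau> z"
  show pos: "Re (z $ i) > 0" for i
  proof (rule ccontr)
    assume "\<not> Re (z $ i) > 0"
    hence neg: "Re (z $ i) \<le> 0" by simp
    have "partition_exp (z $ i) (one_row 0) summable_on UNIV"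
      using conv one_row_partition(1) by (auto simp: trace_convergent_def)
    hence "summable (partition_exp (z $ i) (one_row 0))" by (rule summable_on_imp_summable)
    hence "(\<lambda>k. norm (partition_exp (z $ i) (one_row 0) k)) \<longlonglongrightarrow> 0"
      using summable_LIMSEQ_zero tendsto_norm_zero by blast
    moreover have "1 \<le> norm (partition_exp (z $ i) (one_row 0) k)" for k
      using mult_nonneg_nonpos[of "real k + 1/2" "Re (z $ i)"] neg
      by (simp add: partition_exp_def one_row_def norm_exp_eq_Re algebra_simps)
    ultimately show False by (meson LIMSEQ_le_const not_one_le_zero)
  qed
  let ?Z = "\<Sum>i\<in>UNIV. z $ i"
  show "Re ?Z < width \<tau>"
  proof (rule ccontr)
    assume "\<not> Re ?Z < width \<tau>"
    hence big: "width \<tau> \<le> Re ?Z" by simp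
    define b where "b = (\<lambda>i. (\<Sum>\<^sub>\<infinity>k. partition_exp (z $ i) (one_row 0) k) - exp (z $ i * (- 1/2)))"
    \<comment> \<open>What remains of the term after the power is extracted. It tends to exp (- Z /
      2), which is nonzero, so the terms cannot tend to 0 when the base of the power has norm at
      least 1.\<close>
    define g where "g = (\<lambda>N::nat. \<Prod>i\<in>UNIV. exp (z $ i * (- 1/2)) + b i * exp (- z $ i) ^ N)"
    have tr: "trace_term \<tau> z (one_row N) = (nome \<tau> * exp ?Z) ^ N * g N" for N
    proof -
      have "(\<Sum>\<^sub>\<infinity>k. partition_exp (z $ i) (one_row N) k) = exp (z $ i) ^ N * (exp (z $ i * (- 1/2)) + b i * exp (- z $ i) ^ N)" for i
      proof -
        have "exp (z $ i) ^ N * exp (- z $ i) ^ N = 1" by (simp add: exp_minus flip: power_mult_distrib)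
        moreover have "exp (z $ i * (of_nat N - 1/2)) = exp (z $ i) ^ N * exp (z $ i * (- 1/2))"
          by (simp add: algebra_simps flip: exp_of_nat_mult exp_add)
        moreover have "(\<Sum>\<^sub>\<infinity>k. partition_exp (z $ i) (one_row N) k) = exp (z $ i * (of_nat N - 1/2)) + b i"
          unfolding b_def by (rule one_row_sum[OF pos])
        ultimately show ?thesis by (simp add: algebra_simps)
      qed
      thus ?thesis by (simp add: trace_term_def one_row_partition(2) g_def prod.distrib prod_power_distrib exp_sum power_mult_distrib)
    qed
    have "(\<lambda>N. exp (z $ i * (- 1/2)) + b i * exp (- z $ i) ^ N) \<longlonglongrightarrow> exp (z $ i * (- 1/2)) + b i * 0" for i
      using pos[of i] by (intro tendsto_intros LIMSEQ_power_zero) (simp add: norm_exp_eq_Re)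
    hence "g \<longlonglongrightarrow> (\<Prod>i\<in>UNIV. exp (z $ i * (- 1/2)) + b i * 0)"
      unfolding g_def by (intro tendsto_prod)
    hence g1: "g \<longlonglongrightarrow> (\<Prod>i\<in>UNIV. exp (z $ i * (- 1/2)))" by simp
    have "trace_term \<tau> z summable_on one_row ` UNIV"
      by (rule summable_on_subset_banach[of _ int_partitions]) (use conv one_row_partition(1) in \<open>auto simp: trace_convergent_def\<close>)
    hence "(\<lambda>N. trace_term \<tau> z (one_row N)) summable_on UNIV"
      using summable_on_reindex[OF one_row_partition(3), of "trace_term \<tau> z"] by (simp add: o_def)
    hence "summable (\<lambda>N. trace_term \<tau> z (one_row N))" by (rule summable_on_imp_summable)
    hence lim: "(\<lambda>N. norm (trace_term \<tau> z (one_row N))) \<longlonglongrightarrow> 0"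
      using summable_LIMSEQ_zero tendsto_norm_zero by blast
    have "1 \<le> norm (nome \<tau> * exp ?Z)"
      using big by (simp add: norm_mult norm_nome norm_exp_eq_Re width_def flip: exp_add)
    hence "1 * norm (g N) \<le> norm (nome \<tau> * exp ?Z) ^ N * norm (g N)" for N
      by (intro mult_right_mono one_le_power) auto
    hence "norm (g N) \<le> norm (trace_term \<tau> z (one_row N))" for N
      by (simp add: tr norm_mult norm_power)
    hence "g \<longlonglongrightarrow> 0"
      using lim by (intro tendsto_norm_zero_cancel[OF tendsto_sandwich[OF _ _ tendsto_const lim]]) auto
    hence "(\<Prod>i\<in>UNIV. exp (z $ i * (- 1/2))) = 0" using g1 LIMSEQ_unique by blast
    thus False by simp
  qed
next
  assume z: "\<forall>i. Re (z $ i) > 0" "Re (\<Sum>i\<in>UNIV. z $ i) < width \<tau>"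
  hence z': "\<And>i. Re (z $ i) > 0" by simp
  show "trace_convergent \<tau> z"
    unfolding trace_convergent_def
    using fock_trace(1)[OF \<tau> z' site_weight_levels_summable[OF \<tau> z' z(2), of 0]] z' partition_exp_summable
    by blast
qed

text \<open>The zeros of theta are countable, and finitely many translates of a countable set do not
  exhaust the plane.\<close>

lemma generic_shift:
  assumes \<tau>: "Im \<tau> > 0" and A: "finite A"
  obtains c where "\<And>a. a \<in> A \<Longrightarrow> theta \<tau> (c + a) \<noteq> 0"
proof -
  have w: "width \<tau> > 0" using \<tau> by (simp add: width_def)
  have "theta \<tau> (of_real (width \<tau> / 2)) \<noteq> 0" using w by (intro theta_nonzero_strip[OF \<tau>]) simp
  moreover have "theta \<tau> 0 = 0" by (simp add: theta_eq)
  ultimately have "\<not> theta \<tau> constant_on UNIV" unfolding constant_on_def by (metis UNIV_I)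
  moreover have "fsigma (UNIV :: complex set)" using fsigma.intros[of "\<lambda>_. UNIV :: complex set"] by simp
  ultimately have Z: "countable {c\<in>UNIV. theta \<tau> c = 0}"
    by (intro holomorphic_countable_zeros theta_holomorphic[OF \<tau>]) auto
  have "{c. theta \<tau> (c + a) = 0} \<subseteq> (\<lambda>c. c - a) ` {c\<in>UNIV. theta \<tau> c = 0}" for a
    by (auto intro!: image_eqI[of _ _ "_ + a"])
  hence "countable {c. theta \<tau> (c + a) = 0}" for a using Z by (meson countable_image countable_subset)
  hence "countable (\<Union>a\<in>A. {c. theta \<tau> (c + a) = 0})" by (rule countable_UN[OF countable_finite[OF A]])
  hence "(\<Union>a\<in>A. {c. theta \<tau> (c + a) = 0}) \<noteq> UNIV" using uncountable_UNIV_complex by metis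
  then obtain c where "c \<notin> (\<Union>a\<in>A. {c. theta \<tau> (c + a) = 0})" by blast
  thus ?thesis using that[of c] by blast
qed

lemma generic_shift_subsets:
  fixes z :: "complex ^ 'n::{finite,linorder}"
  assumes "Im \<tau> > 0"
  obtains c where "\<And>T. theta \<tau> (c + (\<Sum>i\<in>T. z $ i)) \<noteq> 0"
proof (rule generic_shift[OF assms, of "(\<lambda>T. \<Sum>i\<in>T. z $ i) ` UNIV"])
qed (use that in auto)

text \<open>The convergence conditions of all nontrivial cycles at once. The domain of the trace
  lies in it by \<open>trace_cycle_region\<close>, and the admissible points with nonzero
  \<open>theta \<tau> (z $ i)\<close> do by \<open>torus_formula\<close>.\<close>

definition cycle_region :: "complex \<Rightarrow> complex ^ 'n::{finite,linorder} \<Rightarrow> bool" where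
  "cycle_region \<tau> z \<longleftrightarrow> (\<forall>\<sigma> C. \<sigma> permutes UNIV \<longrightarrow> C \<in> cycles_of \<sigma> \<longrightarrow> \<not> (\<exists>i. C = {i}) \<longrightarrow>
      - (real (card {i\<in>C. \<sigma> i < i}) * width \<tau>) < Re (\<Sum>i\<in>C. z $ i) \<and>
      Re (\<Sum>i\<in>C. z $ i) < real (card {i\<in>C. i \<le> \<sigma> i}) * width \<tau>)"

lemma cycle_numerator:
  fixes \<sigma> :: "'n::{finite,linorder} \<Rightarrow> 'n"
  assumes \<tau>: "Im \<tau> > 0" and c: "theta \<tau> c \<noteq> 0" and \<sigma>: "\<sigma> permutes UNIV" "C \<in> cycles_of \<sigma>"
  shows "\<exists>E. E holomorphic_on UNIV \<and> (\<forall>z. cycle_region \<tau> z \<longrightarrow> theta \<tau> (\<Sum>i\<in>C. z $ i) \<noteq> 0 \<longrightarrow>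
    cycle_factor \<tau> c z \<sigma> C = E (\<Sum>i\<in>C. z $ i) / theta \<tau> (\<Sum>i\<in>C. z $ i))"
proof (cases "\<exists>i. C = {i}")
  case True
  have "(\<lambda>x. c + x) holomorphic_on UNIV" by (intro holomorphic_intros)
  from holomorphic_on_compose_gen[OF this theta_holomorphic[OF \<tau>]]
  have "(\<lambda>x. theta \<tau> (c + x) / theta \<tau> c) holomorphic_on UNIV"
    using c by (intro holomorphic_on_divide) (auto simp: o_def)
  thus ?thesis using True
    by (intro exI[of _ "\<lambda>x. theta \<tau> (c + x) / theta \<tau> c"]) (simp add: cycle_factor_def kronecker_def)
next
  case False
  let ?a = "card {i\<in>C. i \<le> \<sigma> i}" and ?b = "card {i\<in>C. \<sigma> i < i}"
  have c': "theta_num \<tau> c \<noteq> 0" using c theta_eq_0_iff[OF \<tau>] by simp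
  obtain E where E: "E holomorphic_on UNIV" "\<And>x. - (real ?b * width \<tau>) < Re x \<Longrightarrow> Re x < real ?a * width \<tau> \<Longrightarrow>
    (\<Sum>\<^sub>\<infinity>k. exp (x * of_int k) * occupation \<tau> c k ^ ?a * (occupation \<tau> c k - 1) ^ ?b) * theta_num \<tau> x = E x"
    using mixed_sum_continuation[OF \<tau> c' card_ascents(1)[OF \<sigma>], of ?b] by blast
  have "(\<lambda>x. E x / theta_den \<tau>) holomorphic_on UNIV"
    using E(1) theta_den_nonzero[OF \<tau>] by (intro holomorphic_intros)
  moreover have "cycle_factor \<tau> c z \<sigma> C = E (\<Sum>i\<in>C. z $ i) / theta_den \<tau> / theta \<tau> (\<Sum>i\<in>C. z $ i)"
    if z: "cycle_region \<tau> z" "theta \<tau> (\<Sum>i\<in>C. z $ i) \<noteq> 0" for z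
  proof -
    let ?x = "\<Sum>i\<in>C. z $ i"
    have "- (real ?b * width \<tau>) < Re ?x \<and> Re ?x < real ?a * width \<tau>"
      using z(1) \<sigma> False unfolding cycle_region_def by blast
    hence "E ?x = cycle_factor \<tau> c z \<sigma> C * theta_num \<tau> ?x"
      using E(2)[of ?x] False by (simp add: cycle_factor_def)
    moreover have "theta_num \<tau> ?x \<noteq> 0" using z(2) theta_eq_0_iff[OF \<tau>] by simp
    ultimately show ?thesis using theta_den_nonzero[OF \<tau>] by (simp add: theta_eq)
  qed
  ultimately show ?thesis by (intro exI[of _ "\<lambda>x. E x / theta_den \<tau>"]) blast
qed

lemma cycle_expansion_meromorphic:
  assumes \<tau>: "Im \<tau> > 0" and c: "theta \<tau> c \<noteq> 0"
  shows "\<exists>g :: complex ^ 'n::{finite,linorder} \<Rightarrow> complex. holomorphic_vec g UNIV \<and>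
    (\<forall>z. cycle_region \<tau> z \<longrightarrow> (\<forall>S. S \<noteq> {} \<longrightarrow> theta \<tau> (\<Sum>i\<in>S. z $ i) \<noteq> 0) \<longrightarrow>
      cycle_expansion \<tau> c z = g z / (\<Prod>S\<in>UNIV - {{}}. theta \<tau> (\<Sum>i\<in>S. z $ i)))"
proof -
  have "\<exists>E. \<forall>\<sigma> C. \<sigma> permutes (UNIV :: 'n set) \<longrightarrow> C \<in> cycles_of \<sigma> \<longrightarrow> E \<sigma> C holomorphic_on UNIV \<and>
    (\<forall>z. cycle_region \<tau> z \<longrightarrow> theta \<tau> (\<Sum>i\<in>C. z $ i) \<noteq> 0 \<longrightarrow>
    cycle_factor \<tau> c z \<sigma> C = E \<sigma> C (\<Sum>i\<in>C. z $ i) / theta \<tau> (\<Sum>i\<in>C. z $ i))"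
    using cycle_numerator[OF \<tau> c] by (intro choice allI) blast
  then obtain E where E: "\<forall>\<sigma> C. \<sigma> permutes (UNIV :: 'n set) \<longrightarrow> C \<in> cycles_of \<sigma> \<longrightarrow> E \<sigma> C holomorphic_on UNIV \<and>
    (\<forall>z. cycle_region \<tau> z \<longrightarrow> theta \<tau> (\<Sum>i\<in>C. z $ i) \<noteq> 0 \<longrightarrow>
    cycle_factor \<tau> c z \<sigma> C = E \<sigma> C (\<Sum>i\<in>C. z $ i) / theta \<tau> (\<Sum>i\<in>C. z $ i))" ..
  note E_hol = E[rule_format, THEN conjunct1] and E_eq = E[rule_format, THEN conjunct2, rule_format]
  let ?U = "UNIV - {{}} :: 'n set set"
  have cU: "cycles_of \<sigma> \<subseteq> ?U" if "\<sigma> permutes UNIV" for \<sigma> :: "'n \<Rightarrow> 'n"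
    using orbit_refl[OF that] by (auto simp: cycles_of_def)
  \<comment> \<open>The cycles vary with the permutation, so all nonempty subsets enter the common
    denominator, and those that are not cycles reappear in the numerator. The summand 0 matches the
    form of \<open>holomorphic_vec_comp_sum\<close>.\<close>
  define g where "g = (\<lambda>z :: complex ^ 'n::{finite,linorder}. \<Sum>\<sigma> | \<sigma> permutes UNIV. of_int (sign \<sigma>) *
    ((\<Prod>C\<in>cycles_of \<sigma>. E \<sigma> C (0 + (\<Sum>i\<in>C. z $ i))) * (\<Prod>S\<in>?U - cycles_of \<sigma>. theta \<tau> (0 + (\<Sum>i\<in>S. z $ i)))))"
  have "holomorphic_vec g UNIV"
    unfolding g_def
    by (intro holomorphic_vec_sum holomorphic_vec_mult holomorphic_vec_const holomorphic_vec_prod holomorphic_vec_comp_sum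
        theta_holomorphic[OF \<tau>] E_hol) auto
  moreover have "cycle_expansion \<tau> c z = g z / (\<Prod>S\<in>?U. theta \<tau> (\<Sum>i\<in>S. z $ i))"
    if z: "cycle_region \<tau> z" "\<forall>S. S \<noteq> {} \<longrightarrow> theta \<tau> (\<Sum>i\<in>S. z $ i) \<noteq> 0" for z
    unfolding cycle_expansion_def g_def sum_divide_distrib
  proof (intro sum.cong refl)
    fix \<sigma> :: "'n \<Rightarrow> 'n" assume "\<sigma> \<in> {\<sigma>. \<sigma> permutes UNIV}"
    hence \<sigma>: "\<sigma> permutes UNIV" by simp
    let ?A = "\<Prod>S\<in>?U - cycles_of \<sigma>. theta \<tau> (\<Sum>i\<in>S. z $ i)" and ?B = "\<Prod>C\<in>cycles_of \<sigma>. theta \<tau> (\<Sum>i\<in>C. z $ i)"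
    have U: "(\<Prod>S\<in>?U. theta \<tau> (\<Sum>i\<in>S. z $ i)) = ?A * ?B"
      by (rule prod.subset_diff[OF cU[OF \<sigma>]]) simp
    have A: "?A \<noteq> 0" using z(2) by simp
    have "(\<Prod>C\<in>cycles_of \<sigma>. cycle_factor \<tau> c z \<sigma> C) = (\<Prod>C\<in>cycles_of \<sigma>. E \<sigma> C (\<Sum>i\<in>C. z $ i) / theta \<tau> (\<Sum>i\<in>C. z $ i))"
      using cU[OF \<sigma>] z(2) by (intro prod.cong refl E_eq[OF \<sigma> _ z(1)]) auto
    also have "\<dots> = (\<Prod>C\<in>cycles_of \<sigma>. E \<sigma> C (\<Sum>i\<in>C. z $ i)) * ?A / (?A * ?B)"
      using A by (simp add: prod_dividef)
    finally show "of_int (sign \<sigma>) * (\<Prod>C\<in>cycles_of \<sigma>. cycle_factor \<tau> c z \<sigma> C) =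
        of_int (sign \<sigma>) * ((\<Prod>C\<in>cycles_of \<sigma>. E \<sigma> C (0 + (\<Sum>i\<in>C. z $ i))) * (\<Prod>S\<in>?U - cycles_of \<sigma>. theta \<tau> (0 + (\<Sum>i\<in>S. z $ i)))) /
        (\<Prod>S\<in>?U. theta \<tau> (\<Sum>i\<in>S. z $ i))"
      unfolding U by simp
  qed
  ultimately show ?thesis by blast
qed

lemma trace_cycle_region:
  fixes z :: "complex ^ 'n::{finite,linorder}"
  assumes \<tau>: "Im \<tau> > 0" and z: "\<And>i. Re (z $ i) > 0" "Re (\<Sum>i\<in>UNIV. z $ i) < width \<tau>"
  shows "cycle_region \<tau> z"
  unfolding cycle_region_def
proof (intro allI impI)
  fix \<sigma> and C :: "'n set" assume \<sigma>: "\<sigma> permutes UNIV" "C \<in> cycles_of \<sigma>"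
  have w: "width \<tau> > 0" using \<tau> by (simp add: width_def)
  have ne: "C \<noteq> {}" using \<sigma> orbit_refl[OF \<sigma>(1)] by (auto simp: cycles_of_def)
  have "0 \<le> real (card {i\<in>C. \<sigma> i < i}) * width \<tau>" using w by simp
  moreover have "1 * width \<tau> \<le> real (card {i\<in>C. i \<le> \<sigma> i}) * width \<tau>" using card_ascents(1)[OF \<sigma>] w
    by (intro mult_right_mono) auto
  ultimately show "- (real (card {i\<in>C. \<sigma> i < i}) * width \<tau>) < Re (\<Sum>i\<in>C. z $ i) \<and>
      Re (\<Sum>i\<in>C. z $ i) < real (card {i\<in>C. i \<le> \<sigma> i}) * width \<tau>"
    using Re_subset_sum[OF z ne] by linarith
qed

lemma trace_eq_torus:
  fixes z :: "complex ^ 'n::{finite,linorder}"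
  assumes \<tau>: "Im \<tau> > 0" and conv: "trace_convergent \<tau> z" and \<rho>: "admissible_radii \<tau> z \<rho>"
  shows "theta \<tau> (\<Sum>i\<in>UNIV. z $ i) * euler_prod (nome \<tau>) * (\<Sum>\<^sub>\<infinity>lam\<in>int_partitions. trace_term \<tau> z lam) = torus_integral \<tau> z \<rho>"
proof -
  have z: "\<And>i. Re (z $ i) > 0" "Re (\<Sum>i\<in>UNIV. z $ i) < width \<tau>"
    using conv trace_convergent_iff[OF \<tau>] by auto
  have nz: "theta \<tau> (z $ i) \<noteq> 0" for i
    using Re_subset_sum[OF z, of "{i}"] by (intro theta_nonzero_strip[OF \<tau>]) auto
  obtain c where c: "\<And>T. theta \<tau> (c + (\<Sum>i\<in>T. z $ i)) \<noteq> 0" using generic_shift_subsets[OF \<tau>] by blast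
  have "theta_num \<tau> c \<noteq> 0" using c[of "{}"] theta_eq_0_iff[OF \<tau>] by simp
  from trace_cycle_expansion[OF \<tau> z this]
  have "euler_prod (nome \<tau>) * (\<Sum>\<^sub>\<infinity>lam\<in>int_partitions. trace_term \<tau> z lam) =
      theta \<tau> c * cycle_expansion \<tau> c z / theta \<tau> (c + (\<Sum>i\<in>UNIV. z $ i))"
    using c[of UNIV] by (simp add: nonzero_eq_divide_eq mult_ac)
  thus ?thesis unfolding torus_formula(1)[OF \<tau> \<rho> nz c] mult.assoc by simp
qed


section \<open>Continuation and comparison\<close>

definition admissible :: "complex \<Rightarrow> complex ^ 'n::{finite,linorder} \<Rightarrow> bool" where
  "admissible \<tau> z \<longleftrightarrow> (\<forall>i. theta \<tau> (z $ i) \<noteq> 0) \<and> (\<exists>\<rho>. admissible_radii \<tau> z \<rho>)"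

text \<open>Independence of the radii is read off from the cycle expansion, which does not mention
  them, and not from a deformation of the torus.\<close>

lemma torus_integral_unique:
  fixes z :: "complex ^ 'n::{finite,linorder}"
  assumes \<tau>: "Im \<tau> > 0" and z: "\<And>i. theta \<tau> (z $ i) \<noteq> 0"
    and "admissible_radii \<tau> z \<rho>" "admissible_radii \<tau> z \<rho>'"
  shows "torus_integral \<tau> z \<rho> = torus_integral \<tau> z \<rho>'"
proof -
  obtain c where "\<And>T. theta \<tau> (c + (\<Sum>i\<in>T. z $ i)) \<noteq> 0" using generic_shift_subsets[OF \<tau>] by blast
  thus ?thesis using torus_formula(1)[OF \<tau> _ z] assms(3,4) by metis
qed

text \<open>
  Both functions continue to quotients with the same explicit denominator.  The values prescribed by
  convergent traces and by torus integrals have to be kept even where that denominator vanishes.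
\<close>

lemma GW_functions_exist:
  assumes \<tau>: "Im \<tau> > 0"
  shows "\<exists>F :: complex ^ 'n::{finite,linorder} \<Rightarrow> complex. is_GW_function \<tau> F"
    and "\<exists>P :: complex ^ 'n::{finite,linorder} \<Rightarrow> complex. is_GW_pairing \<tau> P"
proof -
  have w: "width \<tau> > 0" using \<tau> by (simp add: width_def)
  \<comment> \<open>At this point every nonempty partial sum of coordinates lies inside the strip,
    the total being half the width; it witnesses that the denominator \<open>h\<close> is not
    identically zero.\<close>
  define x where "x = width \<tau> / (2 * real CARD('n))"
  define z1 :: "(complex, 'n) vec" where "z1 = (\<chi> i. of_real x)"
  have x: "x > 0" using w by (simp add: x_def)
  have z1: "Re (z1 $ i) > 0" "Re (\<Sum>i\<in>UNIV. z1 $ i) < width \<tau>" for i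
    using w by (simp_all add: z1_def x_def)
  obtain c where c: "\<And>T. theta \<tau> (c + (\<Sum>i\<in>T. z1 $ i)) \<noteq> 0" using generic_shift_subsets[OF \<tau>] by blast
  have c0: "theta \<tau> c \<noteq> 0" using c[of "{}"] by simp
  have c0': "theta_num \<tau> c \<noteq> 0" using c0 theta_eq_0_iff[OF \<tau>] by simp
  obtain g :: "(complex, 'n) vec \<Rightarrow> complex" where g: "holomorphic_vec g UNIV"
    "\<And>z. cycle_region \<tau> z \<Longrightarrow> (\<forall>S. S \<noteq> {} \<longrightarrow> theta \<tau> (\<Sum>i\<in>S. z $ i) \<noteq> 0) \<Longrightarrow>
      cycle_expansion \<tau> c z = g z / (\<Prod>S\<in>UNIV - {{}}. theta \<tau> (\<Sum>i\<in>S. z $ i))"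
    using cycle_expansion_meromorphic[OF \<tau> c0] by blast
  \<comment> \<open>The factors at \<open>c + (\<Sum>i\<in>T. z $ i)\<close> exclude the points for
    which the fixed \<open>c\<close> is not generic. The numerator \<open>k\<close> repeats them
    except for \<open>T = UNIV\<close>, which is a true denominator of the formula.\<close>
  define h where "h = (\<lambda>z :: (complex, 'n) vec. (\<Prod>S\<in>UNIV - {{}}. theta \<tau> (0 + (\<Sum>i\<in>S. z $ i))) * (\<Prod>T\<in>UNIV. theta \<tau> (c + (\<Sum>i\<in>T. z $ i))))"
  define k where "k = (\<lambda>z :: (complex, 'n) vec. theta \<tau> c * g z * (\<Prod>T\<in>UNIV - {UNIV}. theta \<tau> (c + (\<Sum>i\<in>T. z $ i))))"
  have hol_sub: "holomorphic_vec (\<lambda>z. theta \<tau> (a + (\<Sum>i\<in>S. z $ i))) UNIV" for a and S :: "'n set"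
    by (rule holomorphic_vec_comp_sum[OF theta_holomorphic[OF \<tau>]])
  have h_hol: "holomorphic_vec h UNIV"
    unfolding h_def by (intro holomorphic_vec_mult holomorphic_vec_prod hol_sub)
  have k_hol: "holomorphic_vec k UNIV"
    unfolding k_def by (intro holomorphic_vec_mult holomorphic_vec_prod hol_sub g(1) holomorphic_vec_const)
  have "theta \<tau> (\<Sum>i\<in>S. z1 $ i) \<noteq> 0" if "S \<noteq> {}" for S
    using Re_subset_sum[OF z1 that] by (intro theta_nonzero_strip[OF \<tau>]) auto
  hence hz1: "h z1 \<noteq> 0" using c by (auto simp: h_def)
  have main: "theta \<tau> c / theta \<tau> (c + (\<Sum>i\<in>UNIV. z $ i)) * cycle_expansion \<tau> c z = k z / h z"
    "theta \<tau> (c + (\<Sum>i\<in>T. z $ i)) \<noteq> 0"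
    if "h z \<noteq> 0" "cycle_region \<tau> z" for z T
  proof -
    have nz: "theta \<tau> (\<Sum>i\<in>S. z $ i) \<noteq> 0" if "S \<noteq> {}" for S using \<open>h z \<noteq> 0\<close> that by (auto simp: h_def)
    have nz': "theta \<tau> (c + (\<Sum>i\<in>T. z $ i)) \<noteq> 0" for T using \<open>h z \<noteq> 0\<close> by (auto simp: h_def)
    thus "theta \<tau> (c + (\<Sum>i\<in>T. z $ i)) \<noteq> 0" .
    let ?Q = "\<Prod>T\<in>UNIV - {UNIV}. theta \<tau> (c + (\<Sum>i\<in>T. z $ i))"
    have Q: "?Q \<noteq> 0" using nz' by simp
    have "(\<Prod>T\<in>UNIV. theta \<tau> (c + (\<Sum>i\<in>T. z $ i))) = theta \<tau> (c + (\<Sum>i\<in>UNIV. z $ i)) * ?Q"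
      by (rule prod.remove) auto
    hence "k z / h z = theta \<tau> c * g z * ?Q / ((\<Prod>S\<in>UNIV - {{}}. theta \<tau> (\<Sum>i\<in>S. z $ i)) * (theta \<tau> (c + (\<Sum>i\<in>UNIV. z $ i)) * ?Q))"
      by (simp add: k_def h_def)
    also have "\<dots> = theta \<tau> c / theta \<tau> (c + (\<Sum>i\<in>UNIV. z $ i)) * (g z / (\<Prod>S\<in>UNIV - {{}}. theta \<tau> (\<Sum>i\<in>S. z $ i)))"
      using Q by simp
    finally show "theta \<tau> c / theta \<tau> (c + (\<Sum>i\<in>UNIV. z $ i)) * cycle_expansion \<tau> c z = k z / h z"
      using g(2)[OF that(2)] nz by simp
  qed
  have e: "euler_prod (nome \<tau>) \<noteq> 0" using partition_gf_nome[OF \<tau>] by auto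

  define F where "F = (\<lambda>z :: (complex, 'n) vec. if trace_convergent \<tau> z
    then \<Sum>\<^sub>\<infinity>lam\<in>int_partitions. trace_term \<tau> z lam else inverse (euler_prod (nome \<tau>)) * k z / h z)"
  have "F z = inverse (euler_prod (nome \<tau>)) * k z / h z" if "h z \<noteq> 0" for z
  proof (cases "trace_convergent \<tau> z")
    case True
    hence z: "\<And>i. Re (z $ i) > 0" "Re (\<Sum>i\<in>UNIV. z $ i) < width \<tau>"
      using trace_convergent_iff[OF \<tau>] by auto
    note m = main[OF that trace_cycle_region[OF \<tau> z]]
    have "F z = theta \<tau> c / theta \<tau> (c + (\<Sum>i\<in>UNIV. z $ i)) * cycle_expansion \<tau> c z / euler_prod (nome \<tau>)"
      using trace_cycle_expansion[OF \<tau> z c0'] m(2)[of UNIV] e True by (simp add: F_def field_simps)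
    also have "\<dots> = inverse (euler_prod (nome \<tau>)) * k z / h z"
      unfolding m(1) by (simp add: field_simps)
    finally show ?thesis .
  qed (simp add: F_def)
  hence "meromorphic_vec F"
    by (intro meromorphic_vecI[OF _ h_hol hz1, of "\<lambda>z. inverse (euler_prod (nome \<tau>)) * k z"] holomorphic_vec_mult holomorphic_vec_const k_hol) simp
  hence "is_GW_function \<tau> F" by (simp add: is_GW_function_def F_def)
  thus "\<exists>F :: (complex, 'n) vec \<Rightarrow> complex. is_GW_function \<tau> F" by blast

  define P where "P = (\<lambda>z :: (complex, 'n) vec. if admissible \<tau> z
    then torus_integral \<tau> z (SOME \<rho>. admissible_radii \<tau> z \<rho>) else theta \<tau> (0 + (\<Sum>i\<in>UNIV. z $ i)) * k z / h z)"
  have "P z = theta \<tau> (0 + (\<Sum>i\<in>UNIV. z $ i)) * k z / h z" if "h z \<noteq> 0" for z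
  proof (cases "admissible \<tau> z")
    case True
    hence z: "\<And>i. theta \<tau> (z $ i) \<noteq> 0" and ex: "\<exists>\<rho>. admissible_radii \<tau> z \<rho>" by (auto simp: admissible_def)
    have \<rho>: "admissible_radii \<tau> z (SOME \<rho>. admissible_radii \<tau> z \<rho>)" using ex by (rule someI_ex)
    have "theta \<tau> (c + (\<Sum>i\<in>T. z $ i)) \<noteq> 0" for T using that by (auto simp: h_def)
    note t = torus_formula[OF \<tau> \<rho> z this]
    have "cycle_region \<tau> z" unfolding cycle_region_def using t(2) by blast
    note m = main(1)[OF that this]
    have "P z = theta \<tau> (\<Sum>i\<in>UNIV. z $ i) * (theta \<tau> c / theta \<tau> (c + (\<Sum>i\<in>UNIV. z $ i)) * cycle_expansion \<tau> c z)"
      using True t(1) by (simp add: P_def)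
    thus ?thesis unfolding m by simp
  qed (simp add: P_def)
  hence "meromorphic_vec P"
    by (intro meromorphic_vecI[OF _ h_hol hz1, of "\<lambda>z. theta \<tau> (0 + (\<Sum>i\<in>UNIV. z $ i)) * k z"] holomorphic_vec_mult hol_sub k_hol) simp
  moreover have "P z = torus_integral \<tau> z \<rho>" if "\<And>i. theta \<tau> (z $ i) \<noteq> 0" "admissible_radii \<tau> z \<rho>" for z \<rho>
  proof -
    have "admissible \<tau> z" using that by (auto simp: admissible_def)
    moreover have "admissible_radii \<tau> z (SOME \<rho>. admissible_radii \<tau> z \<rho>)" using that(2) by (rule someI)
    ultimately show ?thesis using torus_integral_unique[OF \<tau> that(1) _ that(2)] by (simp add: P_def)
  qed
  ultimately have "is_GW_pairing \<tau> P" by (simp add: is_GW_pairing_def)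
  thus "\<exists>P :: (complex, 'n) vec \<Rightarrow> complex. is_GW_pairing \<tau> P" by blast
qed

lemma common_domain:
  assumes \<tau>: "Im \<tau> > 0"
  obtains V :: "(complex, 'n::{finite,linorder}) vec set" and \<rho> where "open V" "V \<noteq> {}"
    "\<And>z. z \<in> V \<Longrightarrow> trace_convergent \<tau> z \<and> admissible_radii \<tau> z \<rho>"
proof -
  have w: "width \<tau> > 0" using \<tau> by (simp add: width_def)
  \<comment> \<open>All real parts are \<epsilon>, and the logarithmic radii drop by 2 \<epsilon>
    per rank. For i < j the quantities to be bounded are then 2 d \<epsilon> plus or minus
    \<epsilon>, with d the difference of ranks, between 1 and the number n of indices; the choice (2
    n + 2) \<epsilon> = \<open>width \<tau>\<close> keeps them positive and below the width.\<close>
  define \<epsilon> where "\<epsilon> = width \<tau> / (2 * real CARD('n) + 2)"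
  have \<epsilon>: "\<epsilon> > 0" using w by (simp add: \<epsilon>_def)
  have \<epsilon>w: "(2 * real CARD('n) + 2) * \<epsilon> = width \<tau>" by (simp add: \<epsilon>_def)
  define rk where "rk = (\<lambda>i::'n. card {l. l < i})"
  have rk_less: "rk i < rk j" if "i < j" for i j
    unfolding rk_def using that by (intro psubset_card_mono) (auto intro: less_trans)
  have rk_le: "rk i \<le> CARD('n)" for i unfolding rk_def by (intro card_mono) auto
  define \<xi> where "\<xi> = (\<lambda>i. - 2 * \<epsilon> * real (rk i))"
  define \<rho> :: "(real, 'n) vec" where "\<rho> = (\<chi> i. exp (\<xi> i))"
  have inv: "inverse (norm (nome \<tau>)) = exp (width \<tau>)" by (simp add: norm_nome width_def exp_minus)
  have adm: "admissible_radii \<tau> z \<rho> \<longleftrightarrow> (\<forall>i j. i < j \<longrightarrow>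
      0 < Re (z $ i) + \<xi> i - \<xi> j \<and> Re (z $ i) + \<xi> i - \<xi> j < width \<tau> \<and>
      0 < \<xi> i - Re (z $ j) - \<xi> j \<and> \<xi> i - Re (z $ j) - \<xi> j < width \<tau>)" for z
  proof -
    have "norm (exp (z $ i)) * \<rho> $ i / \<rho> $ j = exp (Re (z $ i) + \<xi> i - \<xi> j)"
      "\<rho> $ i / (norm (exp (z $ j)) * \<rho> $ j) = exp (\<xi> i - Re (z $ j) - \<xi> j)" for i j
      by (simp_all add: \<rho>_def norm_exp_eq_Re exp_add exp_diff)
    thus ?thesis unfolding admissible_radii_def inv by (simp add: \<rho>_def)
  qed
  define V :: "(complex, 'n) vec set" where
    "V = {z. (\<forall>i. Re (z $ i) > 0) \<and> Re (\<Sum>i\<in>UNIV. z $ i) < width \<tau> \<and> (\<forall>i j. i < j \<longrightarrow>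
      0 < Re (z $ i) + \<xi> i - \<xi> j \<and> Re (z $ i) + \<xi> i - \<xi> j < width \<tau> \<and>
      0 < \<xi> i - Re (z $ j) - \<xi> j \<and> \<xi> i - Re (z $ j) - \<xi> j < width \<tau>)}"
  have "open V"
  proof -
    let ?A = "\<lambda>i j. {z :: (complex, 'n) vec. 0 < Re (z $ i) + \<xi> i - \<xi> j} \<inter> {z. Re (z $ i) + \<xi> i - \<xi> j < width \<tau>} \<inter>
      {z. 0 < \<xi> i - Re (z $ j) - \<xi> j} \<inter> {z. \<xi> i - Re (z $ j) - \<xi> j < width \<tau>}"
    have "V = (\<Inter>i\<in>UNIV. {z. 0 < Re (z $ i)}) \<inter> {z. Re (\<Sum>i\<in>UNIV. z $ i) < width \<tau>} \<inter>
        (\<Inter>p\<in>{p. fst p < snd p}. ?A (fst p) (snd p))"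
      by (auto simp: V_def)
    also have "open \<dots>"
      by (intro open_Int open_INT ballI finite open_Collect_less continuous_intros)
    finally show ?thesis .
  qed
  moreover have "(\<chi> i. of_real \<epsilon>) \<in> V"
  proof -
    have "0 \<le> real CARD('n) * \<epsilon>" using \<epsilon> by simp
    moreover have "2 * (real CARD('n) * \<epsilon>) + 2 * \<epsilon> = width \<tau>" using \<epsilon>w by (simp add: algebra_simps)
    ultimately have n: "real CARD('n) * \<epsilon> < width \<tau>" using \<epsilon> by linarith
    have "0 < \<epsilon> + \<xi> i - \<xi> j \<and> \<epsilon> + \<xi> i - \<xi> j < width \<tau> \<and> 0 < \<xi> i - \<epsilon> - \<xi> j \<and> \<xi> i - \<epsilon> - \<xi> j < width \<tau>"
      if "i < j" for i j
    proof -
      define d where "d = real (rk j) - real (rk i)"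
      have d: "1 \<le> d" "d \<le> real CARD('n)" using rk_less[OF that] rk_le[of j] by (auto simp: d_def)
      have "1 * \<epsilon> \<le> d * \<epsilon>" "d * \<epsilon> \<le> real CARD('n) * \<epsilon>" using d \<epsilon> by (auto intro!: mult_right_mono)
      moreover have "\<xi> i - \<xi> j = 2 * (d * \<epsilon>)" by (simp add: \<xi>_def d_def algebra_simps)
      moreover have "2 * (real CARD('n) * \<epsilon>) + 2 * \<epsilon> = width \<tau>" using \<epsilon>w by (simp add: algebra_simps)
      ultimately show ?thesis using \<epsilon> by linarith
    qed
    thus ?thesis using n \<epsilon> by (simp add: V_def)
  qed
  hence "V \<noteq> {}" by blast
  moreover have "trace_convergent \<tau> z \<and> admissible_radii \<tau> z \<rho>" if "z \<in> V" for z
    using that unfolding adm trace_convergent_iff[OF \<tau>] V_def by blast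
  ultimately show ?thesis using that by blast
qed

theorem theorem1p2:
  fixes \<tau> :: complex
  assumes "Im \<tau> > 0"
  shows "(\<exists>F :: complex ^ 'n::{finite,linorder} \<Rightarrow> complex. is_GW_function \<tau> F) \<and>
         (\<exists>P :: complex ^ 'n::{finite,linorder} \<Rightarrow> complex. is_GW_pairing \<tau> P) \<and>
         (\<forall>(F :: complex ^ 'n::{finite,linorder} \<Rightarrow> complex) P.
            is_GW_function \<tau> F \<and> is_GW_pairing \<tau> P \<longrightarrow> meromorphic_eq (T_function \<tau> F) P)"
proof (intro conjI allI impI)
  show "\<exists>F :: complex ^ 'n::{finite,linorder} \<Rightarrow> complex. is_GW_function \<tau> F"
    "\<exists>P :: complex ^ 'n::{finite,linorder} \<Rightarrow> complex. is_GW_pairing \<tau> P"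
    by (fact GW_functions_exist[OF assms])+
  fix F P :: "complex ^ 'n::{finite,linorder} \<Rightarrow> complex"
  assume FP: "is_GW_function \<tau> F \<and> is_GW_pairing \<tau> P"
  obtain V :: "(complex, 'n) vec set" and \<rho> where V: "open V" "V \<noteq> {}"
    "\<And>z. z \<in> V \<Longrightarrow> trace_convergent \<tau> z \<and> admissible_radii \<tau> z \<rho>"
    using common_domain[OF assms] by blast
  show "meromorphic_eq (T_function \<tau> F) P"
  proof (rule meromorphic_eqI)
    have "holomorphic_vec (\<lambda>z :: (complex, 'n) vec. theta \<tau> (0 + (\<Sum>i\<in>UNIV. z $ i)) * euler_prod (nome \<tau>)) UNIV"
      by (intro holomorphic_vec_mult holomorphic_vec_const holomorphic_vec_comp_sum theta_holomorphic assms)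
    moreover have "meromorphic_vec F" using FP by (simp add: is_GW_function_def)
    ultimately show "meromorphic_vec (T_function \<tau> F)"
      using meromorphic_vec_mult_left by (simp add: T_function_def[abs_def])
    show "meromorphic_vec P" using FP by (simp add: is_GW_pairing_def)
    fix z assume "z \<in> V"
    hence conv: "trace_convergent \<tau> z" and \<rho>: "admissible_radii \<tau> z \<rho>" using V(3) by auto
    have z: "\<And>i. Re (z $ i) > 0" "Re (\<Sum>i\<in>UNIV. z $ i) < width \<tau>"
      using conv trace_convergent_iff[OF assms] by auto
    have "theta \<tau> (z $ i) \<noteq> 0" for i
      using Re_subset_sum[OF z, of "{i}"] by (intro theta_nonzero_strip[OF assms]) auto
    hence "P z = torus_integral \<tau> z \<rho>" using FP \<rho> by (simp add: is_GW_pairing_def)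
    moreover have "F z = (\<Sum>\<^sub>\<infinity>lam\<in>int_partitions. trace_term \<tau> z lam)"
      using FP conv by (simp add: is_GW_function_def)
    ultimately show "T_function \<tau> F z = P z"
      using trace_eq_torus[OF assms conv \<rho>] by (simp add: T_function_def)
  qed (use V in auto)
qed

end
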